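(* Let $T$ be an interval exchange map of Roth type and let $r\ge1$ be an integer. For every $\Phi\in\mathrm{BV}^r_*(I)$ there exist $\chi\in\Gamma_*(r)$ and $\Psi\in C^{r-2+Lip}(I)$ such that $$\Phi=\chi+\Psi\circ T-\Psi .$$
   Context: Interval exchange map: alphabet $\mathcal A$ with $d\ge2$ letters, admissible combinatorial data $\pi_0,\pi_1:\mathcal A\to\{1,\dots,d\}$ (bijections with $\pi_0^{-1}(\{1,\dots,k\})\neq\pi_1^{-1}(\{1,\dots,k\})$ for $1\le k<d$), lengths $\lambda\in(0,\infty)^{\mathcal A}$, $\lambda^*=\sum\lambda_\alpha$, $I=[0,\lambda^* )$, $I_\alpha=[0,\lambda_\alpha)\times\{\alpha\}$, $j_\varepsilon(x,\alpha)=x+\sum_{\pi_\varepsilon(\beta)<\pi_\varepsilon(\alpha)}\lambda_\beta$, $T=j_1\circ j_0^{-1}$. Roth type: $T$ has the Keane property (no $(\alpha,\beta,m)$ with $\pi_0(\beta)>1$, $m\ge1$, $T^m(j_0(0,\alpha))=j_0(0,\beta)$) and satisfies (a),(b),(c) below. Rauzy–Veech step: with $\pi_0(\alpha_0)=\pi_1(\alpha_1)=d$, $\lambda_{\alpha_\varepsilon}>\lambda_{\alpha_{1-\varepsilon}}$, pass to the first return map of $T$ to $[0,\lambda^*-\lambda_{\alpha_{1-\varepsilon}})$, an i.e.m. with $\hat\lambda_{\alpha_\varepsilon}=\lambda_{\alpha_\varepsilon}-\lambda_{\alpha_{1-\varepsilon}}$, other lengths unchanged, $\hat\pi_\varepsilon=\pi_\varepsilon$,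 $\hat\pi_{1-\varepsilon}(\alpha)=\pi_{1-\varepsilon}(\alpha)$ if $\pi_{1-\varepsilon}(\alpha)\le\pi_{1-\varepsilon}(\alpha_\varepsilon)$, $\pi_{1-\varepsilon}(\alpha)+1$ if $\pi_{1-\varepsilon}(\alpha_\varepsilon)<\pi_{1-\varepsilon}(\alpha)<d$, $\pi_{1-\varepsilon}(\alpha_\varepsilon)+1$ if $\pi_{1-\varepsilon}(\alpha)=d$; name $\alpha_\varepsilon$; matrix $V=\mathbf I+E_{\alpha_\varepsilon\alpha_{1-\varepsilon}}$; iterating gives $V^{[n]}$. $n(0)=0$, $n(k+1)$ largest integer such that steps $n(k)<n\le n(k+1)$ have at most $d-1$ distinct names; $Z(k)=V^{[n(k-1)+1]}\cdots V^{[n(k)]}$, $Q(k,l)=Z(k+1)\cdots Z(l)$, $Q(l)=Q(0,l)$; $\|M\|$ sum of absolute values of entries; $S(k,l)$ linear map of $\mathbb R^{\mathcal A}$ with matrix ${}^tQ(k,l)$, $S(l)=S(0,l)$. (a) $\forall\varepsilon>0\exists C_\varepsilon$: $\|Z(k+1)\|\le C_\varepsilon\|Q(k)\|^\varepsilon$ $\forall k$. (b) With $\Gamma_*=\{v:\sum\lambda_\alpha v_\alpha=0\}$, $\exists\theta,C>0$: $\|S(k)|_{\Gamma_*}\|\le C\|Q(k)\|^{1-\theta}$ $\forall k$. (c) With $\Gamma^{(k)}_s=\{v:\exists\sigma,C>0,\ \|S(k,l)v\|\le C\|S(k,l)\|^{-\sigma}\|v\|\ \forall l\ge k\}$ (a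 subspace, mapped onto $\Gamma^{(l)}_s$ by $S(k,l)$) and $S_\flat(k,l)$ the induced isomorphism of quotients: $\forall\varepsilon>0\exists C_\varepsilon$: $\|S_\flat(k,l)^{-1}\|\le C_\varepsilon\|Q(l)\|^\varepsilon$ and $\|S(k,l)|_{\Gamma_s^{(k)}}\|\le C_\varepsilon\|Q(l)\|^\varepsilon$ for $0\le k\le l$. Function spaces: $\Gamma(r)$ = functions on $I$ whose restriction to each $j_0(I_\alpha)$ is a polynomial of degree $<r$. $\mathrm{BV}^r_*(I)$ = functions $\Phi:I\to\mathbb R$ such that for each $\alpha$, $\Phi$ is $C^{r-1}$ on $j_0(I_\alpha)$, $D^{r-1}\Phi$ is absolutely continuous on $j_0(I_\alpha)$ and $D^r\Phi$ is of bounded variation on $j_0(I_\alpha)$, and such that each $D^l\Phi$, $0<l\le r$, has mean value $0$ on $I$ (discontinuities at endpoints of the $j_0(I_\alpha)$ are allowed). $\Gamma_*(r)=\Gamma(r)\cap\mathrm{BV}^r_*(I)$. $C^{r-2+Lip}(I)$ = functions of class $C^{r-2}$ on all of $I$ whose $(r-2)$-th derivative is Lipschitz on $I$; for $r=1$ it is the space of bounded functions on $I$. *)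

theory Defs
  imports "HOL-Analysis.Analysis" "HOL-Computational_Algebra.Polynomial"
begin

text \<open>Alphabet: a finite type 'a, d = CARD('a). Combinatorial data p0 p1 :: 'a => nat
(the maps pi_0, pi_1), lengths lam :: 'a => real.\<close>

definition admissible :: "('a::finite \<Rightarrow> nat) \<Rightarrow> ('a \<Rightarrow> nat) \<Rightarrow> bool" where
  "admissible p0 p1 \<longleftrightarrow>
     bij_betw p0 UNIV {1..CARD('a)} \<and> bij_betw p1 UNIV {1..CARD('a)} \<and>
     (\<forall>k. 1 \<le> k \<and> k < CARD('a) \<longrightarrow> {a. p0 a \<le> k} \<noteq> {a. p1 a \<le> k})"

definition total_length :: "('a::finite \<Rightarrow> real) \<Rightarrow> real" where
  "total_length lam = (\<Sum>a\<in>UNIV. lam a)"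

definition left_end :: "('a::finite \<Rightarrow> nat) \<Rightarrow> ('a \<Rightarrow> real) \<Rightarrow> 'a \<Rightarrow> real" where
  "left_end p lam a = (\<Sum>b\<in>{b. p b < p a}. lam b)"

definition piece :: "('a::finite \<Rightarrow> nat) \<Rightarrow> ('a \<Rightarrow> real) \<Rightarrow> 'a \<Rightarrow> real set" where
  "piece p0 lam a = {left_end p0 lam a ..< left_end p0 lam a + lam a}"

text \<open>T = j_1 o j_0^{-1} (values outside I are irrelevant)\<close>
definition iem :: "('a::finite \<Rightarrow> nat) \<Rightarrow> ('a \<Rightarrow> nat) \<Rightarrow> ('a \<Rightarrow> real) \<Rightarrow> real \<Rightarrow> real" where
  "iem p0 p1 lam x = (let a = (SOME a. x \<in> piece p0 lam a)
                      in x - left_end p0 lam a + left_end p1 lam a)"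

definition keane :: "('a::finite \<Rightarrow> nat) \<Rightarrow> ('a \<Rightarrow> nat) \<Rightarrow> ('a \<Rightarrow> real) \<Rightarrow> bool" where
  "keane p0 p1 lam \<longleftrightarrow>
     \<not> (\<exists>a b (m::nat). p0 b > 1 \<and> m \<ge> 1 \<and>
          (iem p0 p1 lam ^^ m) (left_end p0 lam a) = left_end p0 lam b)"

type_synonym 'a iem_data = "('a \<Rightarrow> nat) \<times> ('a \<Rightarrow> nat) \<times> ('a \<Rightarrow> real)"

definition rv_perm :: "('a::finite \<Rightarrow> nat) \<Rightarrow> 'a \<Rightarrow> 'a \<Rightarrow> nat" where
  "rv_perm p w a = (if p a \<le> p w then p a
                    else if p a < CARD('a) then p a + 1
                    else p w + 1)"

definition last0 :: "'a::finite iem_data \<Rightarrow> 'a" where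
  "last0 s = (THE a. fst s a = CARD('a))"
definition last1 :: "'a::finite iem_data \<Rightarrow> 'a" where
  "last1 s = (THE a. fst (snd s) a = CARD('a))"

text \<open>eps = 0 iff lam(alpha_0) > lam(alpha_1); the winner alpha_eps is the name of the step.
(Under the Keane property, lam(alpha_0) \<noteq> lam(alpha_1) at every step.)\<close>
definition rv_winner :: "'a::finite iem_data \<Rightarrow> 'a" where
  "rv_winner s = (if snd (snd s) (last0 s) > snd (snd s) (last1 s) then last0 s else last1 s)"
definition rv_loser :: "'a::finite iem_data \<Rightarrow> 'a" where
  "rv_loser s = (if snd (snd s) (last0 s) > snd (snd s) (last1 s) then last1 s else last0 s)"

definition rv_step :: "'a::finite iem_data \<Rightarrow> 'a iem_data" where
  "rv_step s = (let (p0, p1, lam) = s; w = rv_winner s; l = rv_loser s;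
                    lam' = lam(w := lam w - lam l)
                in if lam (last0 s) > lam (last1 s) then (p0, rv_perm p1 w, lam')
                   else (rv_perm p0 w, p1, lam'))"

definition rv_matrix :: "'a::finite iem_data \<Rightarrow> real^'a^'a" where
  "rv_matrix s = (\<chi> i j. (if i = j then 1 else 0) +
                          (if i = rv_winner s \<and> j = rv_loser s then 1 else 0))"

definition rv_iter :: "'a::finite iem_data \<Rightarrow> nat \<Rightarrow> 'a iem_data" where
  "rv_iter s n = (rv_step ^^ n) s"

definition rv_name :: "'a::finite iem_data \<Rightarrow> nat \<Rightarrow> 'a" where
  "rv_name s n = rv_winner (rv_iter s (n - 1))"
definition rv_V :: "'a::finite iem_data \<Rightarrow> nat \<Rightarrow> real^'a^'a" where
  "rv_V s n = rv_matrix (rv_iter s (n - 1))"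

fun mprod :: "(nat \<Rightarrow> real^'a^'a) \<Rightarrow> nat \<Rightarrow> nat \<Rightarrow> real^'a^'a" where
  "mprod f a 0 = mat 1"
| "mprod f a (Suc b) = (if Suc b \<le> a then mat 1 else mprod f a b ** f (Suc b))"

fun nseq :: "'a::finite iem_data \<Rightarrow> nat \<Rightarrow> nat" where
  "nseq s 0 = 0"
| "nseq s (Suc k) = (GREATEST m. nseq s k \<le> m \<and>
                       card (rv_name s ` {nseq s k <.. m}) \<le> CARD('a) - 1)"

definition Zmat :: "'a::finite iem_data \<Rightarrow> nat \<Rightarrow> real^'a^'a" where
  "Zmat s k = mprod (rv_V s) (nseq s (k - 1)) (nseq s k)"

definition Qmat :: "'a::finite iem_data \<Rightarrow> nat \<Rightarrow> nat \<Rightarrow> real^'a^'a" where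
  "Qmat s k l = mprod (Zmat s) k l"

definition mnorm :: "real^'a::finite^'a \<Rightarrow> real" where
  "mnorm M = (\<Sum>i\<in>UNIV. \<Sum>j\<in>UNIV. \<bar>M $ i $ j\<bar>)"

definition Smap :: "'a::finite iem_data \<Rightarrow> nat \<Rightarrow> nat \<Rightarrow> real^'a \<Rightarrow> real^'a" where
  "Smap s k l v = transpose (Qmat s k l) *v v"

definition Gamma_s :: "'a::finite iem_data \<Rightarrow> nat \<Rightarrow> (real^'a) set" where
  "Gamma_s s k = {v. \<exists>\<sigma>>0. \<exists>C>0. \<forall>l\<ge>k.
       norm (Smap s k l v) \<le> C * mnorm (transpose (Qmat s k l)) powr (- \<sigma>) * norm v}"

definition roth_a :: "'a::finite iem_data \<Rightarrow> bool" where
  "roth_a s \<longleftrightarrow> (\<forall>\<epsilon>>0. \<exists>C. \<forall>k.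
      mnorm (Zmat s (k + 1)) \<le> C * mnorm (Qmat s 0 k) powr \<epsilon>)"

text \<open>(b): the operator norm of S(k) restricted to Gamma_* is at most C ||Q(k)||^{1-theta}\<close>
definition roth_b :: "'a::finite iem_data \<Rightarrow> bool" where
  "roth_b s \<longleftrightarrow> (\<exists>\<theta>>0. \<exists>C>0. \<forall>k. \<forall>v::real^'a.
      (\<Sum>a\<in>UNIV. snd (snd s) a * v $ a) = 0 \<longrightarrow>
      norm (Smap s 0 k v) \<le> C * mnorm (Qmat s 0 k) powr (1 - \<theta>) * norm v)"

text \<open>(c): the quotient norm of the class of v modulo Gamma_s^{(k)} is infdist v (Gamma_s s k);
  the bound on the norm of the inverse of the induced quotient isomorphism S_flat(k,l) reads
  ||[v]|| \<le> B ||[S(k,l) v]|| for all v.\<close>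
definition roth_c :: "'a::finite iem_data \<Rightarrow> bool" where
  "roth_c s \<longleftrightarrow> (\<forall>\<epsilon>>0. \<exists>C. \<forall>k l. k \<le> l \<longrightarrow>
      (\<forall>v. infdist v (Gamma_s s k) \<le> C * mnorm (Qmat s 0 l) powr \<epsilon> * infdist (Smap s k l v) (Gamma_s s l)) \<and>
      (\<forall>v\<in>Gamma_s s k. norm (Smap s k l v) \<le> C * mnorm (Qmat s 0 l) powr \<epsilon> * norm v))"

definition roth_type :: "('a::finite \<Rightarrow> nat) \<Rightarrow> ('a \<Rightarrow> nat) \<Rightarrow> ('a \<Rightarrow> real) \<Rightarrow> bool" where
  "roth_type p0 p1 lam \<longleftrightarrow> keane p0 p1 lam \<and>
     roth_a (p0, p1, lam) \<and> roth_b (p0, p1, lam) \<and> roth_c (p0, p1, lam)"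

definition bounded_variation_on :: "(real \<Rightarrow> real) \<Rightarrow> real set \<Rightarrow> bool" where
  "bounded_variation_on f J \<longleftrightarrow> (\<exists>B. \<forall>(n::nat) (x::nat \<Rightarrow> real).
      (\<forall>i\<le>n. x i \<in> J) \<and> (\<forall>i<n. x i \<le> x (Suc i)) \<longrightarrow>
      (\<Sum>i<n. \<bar>f (x (Suc i)) - f (x i)\<bar>) \<le> B)"

definition abs_continuous_on :: "(real \<Rightarrow> real) \<Rightarrow> real set \<Rightarrow> bool" where
  "abs_continuous_on f J \<longleftrightarrow> (\<forall>\<epsilon>>0. \<exists>\<delta>>0. \<forall>(n::nat) (a::nat \<Rightarrow> real) b.
      (\<forall>i<n. a i \<in> J \<and> b i \<in> J \<and> a i \<le> b i) \<and>
      (\<forall>i<n. \<forall>j<n. i \<noteq> j \<longrightarrow> b i \<le> a j \<or> b j \<le> a i) \<and>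
      (\<Sum>i<n. b i - a i) < \<delta> \<longrightarrow>
      (\<Sum>i<n. \<bar>f (b i) - f (a i)\<bar>) < \<epsilon>)"

text \<open>BV^r_*(I). D l is the l-th derivative (piecewise, one-sided at the left endpoints);
  D r is the almost-everywhere derivative of the absolutely continuous D (r-1).\<close>
definition BV_star :: "('a::finite \<Rightarrow> nat) \<Rightarrow> ('a \<Rightarrow> real) \<Rightarrow> nat \<Rightarrow> (real \<Rightarrow> real) \<Rightarrow> bool" where
  "BV_star p0 lam r \<Phi> \<longleftrightarrow> (\<exists>D :: nat \<Rightarrow> real \<Rightarrow> real.
      (\<forall>x\<in>{0..<total_length lam}. D 0 x = \<Phi> x) \<and>
      (\<forall>a. (\<forall>l. l + 1 < r \<longrightarrow> (\<forall>x\<in>piece p0 lam a.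
                 (D l has_real_derivative D (l + 1) x) (at x within piece p0 lam a))) \<and>
           abs_continuous_on (D (r - 1)) (piece p0 lam a) \<and>
           (AE x in lebesgue. x \<in> piece p0 lam a \<longrightarrow>
                 (D (r - 1) has_real_derivative D r x) (at x within piece p0 lam a)) \<and>
           bounded_variation_on (D r) (piece p0 lam a)) \<and>
      (\<forall>l. 0 < l \<and> l \<le> r \<longrightarrow> (D l has_integral 0) {0..<total_length lam}))"

definition Gamma_poly :: "('a::finite \<Rightarrow> nat) \<Rightarrow> ('a \<Rightarrow> real) \<Rightarrow> nat \<Rightarrow> (real \<Rightarrow> real) \<Rightarrow> bool" where
  "Gamma_poly p0 lam r g \<longleftrightarrow> (\<exists>P :: 'a \<Rightarrow> real poly. \<forall>a.
      degree (P a) < r \<and> (\<forall>x\<in>piece p0 lam a. g x = poly (P a) x))"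

definition Gamma_star :: "('a::finite \<Rightarrow> nat) \<Rightarrow> ('a \<Rightarrow> real) \<Rightarrow> nat \<Rightarrow> (real \<Rightarrow> real) \<Rightarrow> bool" where
  "Gamma_star p0 lam r g \<longleftrightarrow> Gamma_poly p0 lam r g \<and> BV_star p0 lam r g"

definition C_Lip :: "real \<Rightarrow> nat \<Rightarrow> (real \<Rightarrow> real) \<Rightarrow> bool" where
  "C_Lip L r \<Psi> \<longleftrightarrow>
     (if r \<le> 1 then (\<exists>B. \<forall>x\<in>{0..<L}. \<bar>\<Psi> x\<bar> \<le> B)
      else (\<exists>D :: nat \<Rightarrow> real \<Rightarrow> real.
              (\<forall>x\<in>{0..<L}. D 0 x = \<Psi> x) \<and>
              (\<forall>l. l + 2 < r \<longrightarrow> (\<forall>x\<in>{0..<L}.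
                   (D l has_real_derivative D (l + 1) x) (at x within {0..<L}))) \<and>
              (\<exists>K. K-lipschitz_on {0..<L} (D (r - 2)))))"

end

theory Submission
  imports Defs
begin

text \<open>
  In coordinates normalised to the pieces, a Rauzy--Veech step acts on functions by
  \<open>F l y \<mapsto> F l y + F w (y + lam w - lam l)\<close> (\<open>w\<close> winner, \<open>l\<close> loser), whatever the permutations are.
  For \<open>r = 1\<close>, the special Birkhoff sums of the derivative have variation bounded independently of the
  level, so up to a bounded error they are given by the action of the Rauzy--Veech matrices on vectors
  of zero mean, which condition (b) controls. As the pieces of level \<open>k\<close> have length about \<open>1 / N k\<close>,
  with \<open>N k\<close> the norm of \<open>Q(k)\<close>, the special Birkhoff sums of the function itself oscillate by at most
  a negative power of \<open>N k\<close> on each piece. Condition (c) then yields a piecewise constant correction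
  after which they decay like a negative power of \<open>N k\<close>. By condition (a) these bounds are summable over
  all elementary steps, so the ordinary Birkhoff sums of the corrected function are bounded, and their
  upper limit solves the equation. Larger \<open>r\<close> follow by integrating the solution for the derivative.
\<close>

section \<open>Geometry of a Rauzy--Veech step\<close>

text \<open>Condition (b) and the decay on the stable space at level 0 start at level 0, whereas the
  errors to be propagated arise at every level \<open>j\<close>. Pulling a vector back to level 0
  costs the power \<open>CARD('a)\<close> of \<open>N j\<close>, because the matrices are
  unimodular. Interpolating with a bound that is valid from level \<open>j\<close> on (the norm of
  \<open>Q j k\<close> in one case, the second half of (c) in the other) turns this cost into a gain
  or an arbitrarily small loss, at the price of a smaller exponent at the target level. The
  correction vector is fixed only modulo the stable space: the first half of (c) makes the
  pulled-back increments summable in the quotient, and the stable component that remains decays by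
  itself. Birkhoff sums are compared level by level, not through return times. One elementary step
  changes an orbit sum by at most two terms, so what matters is the number of elementary steps in a
  block, and the norm of the block matrix bounds it.\<close>

lemma left_end_add_le:
  fixes p :: "'a::finite \<Rightarrow> nat"
  assumes "\<forall>a. lam a > 0" "p a < p b"
  shows "left_end p lam a + lam a \<le> left_end p lam b"
proof -
  have "left_end p lam a + lam a = sum lam (insert a {c. p c < p a})"
    by (simp add: left_end_def)
  also have "\<dots> \<le> sum lam {c. p c < p b}"
    using assms by (intro sum_mono2) (auto intro: less_imp_le)
  finally show ?thesis by (simp add: left_end_def)
qed

lemma left_end_nonneg:
  fixes p :: "'a::finite \<Rightarrow> nat"
  assumes "\<forall>a. lam a > 0"
  shows "0 \<le> left_end p lam a"
  using assms unfolding left_end_def by (intro sum_nonneg) (auto intro: less_imp_le)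

lemma left_end_add_le_total:
  fixes p :: "'a::finite \<Rightarrow> nat"
  assumes "\<forall>a. lam a > 0"
  shows "left_end p lam a + lam a \<le> total_length lam"
proof -
  have "left_end p lam a + lam a = sum lam (insert a {c. p c < p a})"
    by (simp add: left_end_def)
  also have "\<dots> \<le> sum lam UNIV"
    using assms by (intro sum_mono2) (auto intro: less_imp_le)
  finally show ?thesis by (simp add: total_length_def)
qed

lemma piece_subset:
  fixes p :: "'a::finite \<Rightarrow> nat"
  assumes "\<forall>a. lam a > 0"
  shows "piece p lam a \<subseteq> {0..<total_length lam}"
  using left_end_nonneg[OF assms, of p a] left_end_add_le_total[OF assms, of p a]
  by (auto simp: piece_def)

lemma bij_last:
  fixes p :: "'a::finite \<Rightarrow> nat"
  assumes "bij_betw p UNIV {1..CARD('a)}"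
  shows "p a \<le> CARD('a)" "1 \<le> p a" "inj p"
  using assms unfolding bij_betw_def by auto

lemma left_end_last:
  fixes p :: "'a::finite \<Rightarrow> nat"
  assumes "bij_betw p UNIV {1..CARD('a)}" "p w = CARD('a)"
  shows "left_end p lam w = total_length lam - lam w"
proof -
  have "{c. p c < p w} = UNIV - {w}"
    using assms bij_last[OF assms(1)] by (auto simp: inj_def) (metis le_neq_implies_less)
  then show ?thesis
    by (simp add: left_end_def total_length_def sum_diff1)
qed

lemma left_end_Suc:
  fixes p :: "'a::finite \<Rightarrow> nat"
  assumes "inj p" "p b = Suc (p a)"
  shows "left_end p lam b = left_end p lam a + lam a"
proof -
  have "{c. p c < p b} = insert a {c. p c < p a}"
    using assms by (auto simp: inj_def less_Suc_eq)
  then show ?thesis by (simp add: left_end_def)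
qed

text \<open>Among the pieces starting at or before \<open>x\<close>, the one furthest to the right
  contains \<open>x\<close>: its successor, if there is one, starts after \<open>x\<close>.\<close>

lemma piece_exists:
  fixes p :: "'a::finite \<Rightarrow> nat"
  assumes bij: "bij_betw p UNIV {1..CARD('a)}" and "x \<in> {0..<total_length lam}"
  obtains a where "x \<in> piece p lam a"
proof -
  note b = bij_last[OF bij]
  have "CARD('a) \<in> p ` UNIV" "1 \<in> p ` UNIV"
    using bij by (auto simp: bij_betw_def Suc_le_eq)
  then obtain a1 ad where a1: "p a1 = 1" and ad: "p ad = CARD('a)" by (metis imageE)
  define A where "A = {a. left_end p lam a \<le> x}"
  have e: "{c. p c < 1} = {}" using b(2) by (auto simp: Suc_le_eq)
  have "left_end p lam a1 = 0" unfolding left_end_def a1 e by simp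
  then have "a1 \<in> A" using assms(2) by (simp add: A_def)
  then have "Max (p ` A) \<in> p ` A" by (intro Max_in) auto
  then obtain a where a: "a \<in> A" "p a = Max (p ` A)" by auto
  have a2: "p b \<le> p a" if "b \<in> A" for b using that a(2) by simp
  have "x < left_end p lam a + lam a"
  proof (cases "p a = CARD('a)")
    case True
    then show ?thesis using left_end_last[OF bij True, of lam] assms(2) by simp
  next
    case False
    then have "Suc (p a) \<in> p ` UNIV" using b(1)[of a] bij by (auto simp: bij_betw_def)
    then obtain b' where b': "p b' = Suc (p a)" by (metis imageE)
    then have "b' \<notin> A" using a2 by fastforce
    then show ?thesis using left_end_Suc[OF b(3) b', of lam] by (simp add: A_def)
  qed
  then show ?thesis using a(1) that by (auto simp: A_def piece_def)
qed

lemma piece_unique: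
  fixes p :: "'a::finite \<Rightarrow> nat"
  assumes "inj p" "\<forall>a. lam a > 0" "x \<in> piece p lam a" "x \<in> piece p lam b"
  shows "a = b"
proof (rule ccontr)
  assume "a \<noteq> b"
  then have "p a < p b \<or> p b < p a" using assms(1) by (meson injD linorder_neqE_nat)
  then show False
    using left_end_add_le[OF assms(2), of p a b] left_end_add_le[OF assms(2), of p b a] assms(3,4)
    by (auto simp: piece_def)
qed

lemma iem_eq:
  fixes p0 :: "'a::finite \<Rightarrow> nat"
  assumes "inj p0" "\<forall>a. lam a > 0" "x \<in> piece p0 lam a"
  shows "iem p0 p1 lam x = x - left_end p0 lam a + left_end p1 lam a"
proof -
  have "(SOME a. x \<in> piece p0 lam a) = a"
    using assms piece_unique by (intro some_equality) blast+
  then show ?thesis by (simp add: iem_def)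
qed

lemma iem_left_end_add:
  fixes p0 :: "'a::finite \<Rightarrow> nat"
  assumes "inj p0" "\<forall>a. lam a > 0" "0 \<le> y" "y < lam a"
  shows "iem p0 p1 lam (left_end p0 lam a + y) = left_end p1 lam a + y"
  using iem_eq[OF assms(1,2), of "left_end p0 lam a + y" a p1] assms(3,4)
  by (simp add: piece_def)

lemma iem_mem:
  fixes p0 :: "'a::finite \<Rightarrow> nat"
  assumes "bij_betw p0 UNIV {1..CARD('a)}" "\<forall>a. lam a > 0" "x \<in> {0..<total_length lam}"
  shows "iem p0 p1 lam x \<in> {0..<total_length lam}"
proof -
  obtain a where a: "x \<in> piece p0 lam a" using piece_exists assms by blast
  then have "iem p0 p1 lam x \<in> piece p1 lam a"
    using iem_eq[OF bij_last(3)[OF assms(1)] assms(2) a] by (auto simp: piece_def)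
  then show ?thesis using piece_subset[OF assms(2)] by blast
qed

section \<open>Keane data and the two types of step\<close>

abbreviation top_perm :: "'a::finite iem_data \<Rightarrow> 'a \<Rightarrow> nat" where "top_perm s \<equiv> fst s"
abbreviation bot_perm :: "'a::finite iem_data \<Rightarrow> 'a \<Rightarrow> nat" where "bot_perm s \<equiv> fst (snd s)"
abbreviation lens :: "'a::finite iem_data \<Rightarrow> 'a \<Rightarrow> real" where "lens s \<equiv> snd (snd s)"
abbreviation iem_of :: "'a::finite iem_data \<Rightarrow> real \<Rightarrow> real" where
  "iem_of s \<equiv> iem (top_perm s) (bot_perm s) (lens s)"

text \<open>The invariant of the algorithm: admissibility keeps the two last letters distinct and
  the Keane property excludes ties, so the step makes sense and can be iterated.\<close>

definition keane_data :: "'a::finite iem_data \<Rightarrow> bool" where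
  "keane_data s \<longleftrightarrow> admissible (top_perm s) (bot_perm s) \<and> (\<forall>a. lens s a > 0) \<and>
     keane (top_perm s) (bot_perm s) (lens s)"

lemma keane_dataD:
  fixes s :: "'a::finite iem_data"
  assumes "keane_data s"
  shows "bij_betw (top_perm s) UNIV {1..CARD('a)}" "bij_betw (bot_perm s) UNIV {1..CARD('a)}"
    "inj (top_perm s)" "inj (bot_perm s)" "\<forall>a. lens s a > 0"
    "keane (top_perm s) (bot_perm s) (lens s)"
  using assms by (auto simp: keane_data_def admissible_def bij_betw_def)

lemma the_last:
  fixes p :: "'a::finite \<Rightarrow> nat"
  assumes "bij_betw p UNIV {1..CARD('a)}"
  shows "p (THE a. p a = CARD('a)) = CARD('a)"
proof -
  have "CARD('a) \<in> p ` UNIV" using assms by (auto simp: bij_betw_def Suc_le_eq)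
  then obtain b where "p b = CARD('a)" by (metis imageE)
  moreover have "a = b" if "p a = CARD('a)" for a
    using bij_last(3)[OF assms] \<open>p b = CARD('a)\<close> that by (metis injD)
  ultimately show ?thesis by (rule theI)
qed

lemma last_perm:
  fixes s :: "'a::finite iem_data"
  assumes "keane_data s"
  shows "top_perm s (last0 s) = CARD('a)" "bot_perm s (last1 s) = CARD('a)"
  using the_last[OF keane_dataD(1)[OF assms]] the_last[OF keane_dataD(2)[OF assms]]
  by (auto simp: last0_def last1_def)

text \<open>Admissibility at \<open>k = CARD('a) - 1\<close>: removing a common last letter would
  leave the same set on both lines.\<close>

lemma last_distinct:
  fixes s :: "'a::finite iem_data"
  assumes "CARD('a) \<ge> 2" "keane_data s"
  shows "last0 s \<noteq> last1 s"
proof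
  assume e: "last0 s = last1 s"
  note b = keane_dataD[OF assms(2)] last_perm[OF assms(2)]
  have *: "{a. p a \<le> CARD('a) - 1} = UNIV - {w}"
    if "bij_betw p UNIV {1..CARD('a)}" "p w = CARD('a)" for p :: "'a \<Rightarrow> nat" and w
  proof -
    have "p a \<le> CARD('a) - 1 \<longleftrightarrow> a \<noteq> w" for a
    proof -
      have "p a = p w \<longleftrightarrow> a = w" using bij_last(3)[OF that(1)] by (simp add: inj_eq)
      then show ?thesis using bij_last(1)[OF that(1), of a] that(2) assms(1) by linarith
    qed
    then show ?thesis by auto
  qed
  have "{a. top_perm s a \<le> CARD('a) - 1} = {a. bot_perm s a \<le> CARD('a) - 1}"
    using *[OF b(1) b(7)] *[OF b(2) b(8)] e by simp
  moreover have "1 \<le> CARD('a) - 1" "CARD('a) - 1 < CARD('a)" using assms(1) by auto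
  ultimately show False using assms(2) unfolding keane_data_def admissible_def by blast
qed

text \<open>A tie would be the connection \<open>T (left_end p0 (last1 s)) = left_end p0 (last0 s)\<close>.\<close>

lemma keane_no_tie:
  fixes s :: "'a::finite iem_data"
  assumes "CARD('a) \<ge> 2" "keane_data s"
  shows "lens s (last0 s) \<noteq> lens s (last1 s)"
proof
  assume e: "lens s (last0 s) = lens s (last1 s)"
  note b = keane_dataD[OF assms(2)] last_perm[OF assms(2)]
  have "iem_of s (left_end (top_perm s) (lens s) (last1 s) + 0) = left_end (bot_perm s) (lens s) (last1 s) + 0"
    using b(5) by (intro iem_left_end_add b) auto
  then have "(iem_of s ^^ 1) (left_end (top_perm s) (lens s) (last1 s)) = left_end (top_perm s) (lens s) (last0 s)"
    using left_end_last[OF b(1) b(7)] left_end_last[OF b(2) b(8)] e by simp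
  moreover have "top_perm s (last0 s) > 1" using b(7) assms(1) by simp
  ultimately show False using b(6) unfolding keane_def by (metis le_refl)
qed

lemma rv_step_cases:
  fixes s :: "'a::finite iem_data"
  assumes "CARD('a) \<ge> 2" "keane_data s"
  obtains (top) "rv_winner s = last0 s" "rv_loser s = last1 s"
      "top_perm s (rv_winner s) = CARD('a)" "bot_perm s (rv_loser s) = CARD('a)"
      "rv_step s = (top_perm s, rv_perm (bot_perm s) (rv_winner s),
         (lens s)(rv_winner s := lens s (rv_winner s) - lens s (rv_loser s)))"
  | (bot) "rv_winner s = last1 s" "rv_loser s = last0 s"
      "bot_perm s (rv_winner s) = CARD('a)" "top_perm s (rv_loser s) = CARD('a)"
      "rv_step s = (rv_perm (top_perm s) (rv_winner s), bot_perm s,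
         (lens s)(rv_winner s := lens s (rv_winner s) - lens s (rv_loser s)))"
proof (cases "lens s (last0 s) > lens s (last1 s)")
  case True
  then show ?thesis using last_perm[OF assms(2)]
    by (intro top) (auto simp: rv_winner_def rv_loser_def rv_step_def Let_def split: prod.split)
next
  case False
  then show ?thesis using last_perm[OF assms(2)]
    by (intro bot) (auto simp: rv_winner_def rv_loser_def rv_step_def Let_def split: prod.split)
qed

lemma rv_winner_loser:
  fixes s :: "'a::finite iem_data"
  assumes "CARD('a) \<ge> 2" "keane_data s"
  shows "rv_winner s \<noteq> rv_loser s" "lens s (rv_loser s) < lens s (rv_winner s)"
    "lens (rv_step s) = (lens s)(rv_winner s := lens s (rv_winner s) - lens s (rv_loser s))"
proof -
  show "rv_winner s \<noteq> rv_loser s" "lens s (rv_loser s) < lens s (rv_winner s)"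
    using last_distinct[OF assms] keane_no_tie[OF assms]
    by (auto simp: rv_winner_def rv_loser_def)
  show "lens (rv_step s) = (lens s)(rv_winner s := lens s (rv_winner s) - lens s (rv_loser s))"
    by (rule rv_step_cases[OF assms]) auto
qed

lemma left_end_upd_last:
  fixes p :: "'a::finite \<Rightarrow> nat"
  assumes "bij_betw p UNIV {1..CARD('a)}" "p w = CARD('a)"
  shows "left_end p (lam(w := z)) a = left_end p lam a"
  unfolding left_end_def using bij_last(1)[OF assms(1), of a] assms(2)
  by (intro sum.cong) auto

text \<open>\<open>rv_perm\<close> takes the last letter \<open>l\<close> out and reinserts it
  directly behind \<open>w\<close>; the relative order of the other letters is untouched.\<close>

lemma rv_perm_less_iff:
  fixes p :: "'a::finite \<Rightarrow> nat"
  assumes "bij_betw p UNIV {1..CARD('a)}" "p l = CARD('a)" "w \<noteq> l" "a \<noteq> l"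
  shows "rv_perm p w c < rv_perm p w a \<longleftrightarrow> (if c = l then p w < p a else p c < p a)"
proof -
  note b = bij_last[OF assms(1)]
  have lt: "p x < CARD('a)" if "x \<noteq> l" for x
    using b(1)[of x] b(3) assms(2) that by (metis injD le_neq_implies_less)
  show ?thesis using lt[of a] lt[of w] lt[of c] assms b(3)
    by (auto simp: rv_perm_def)
qed

lemma rv_perm_loser:
  fixes p :: "'a::finite \<Rightarrow> nat"
  assumes "bij_betw p UNIV {1..CARD('a)}" "p l = CARD('a)" "w \<noteq> l"
  shows "rv_perm p w l = Suc (p w)" "rv_perm p w c < rv_perm p w l \<longleftrightarrow> c \<noteq> l \<and> p c \<le> p w"
proof -
  note b = bij_last[OF assms(1)]
  have lt: "p x < CARD('a)" if "x \<noteq> l" for x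
    using b(1)[of x] b(3) assms(2) that by (metis injD le_neq_implies_less)
  show 1: "rv_perm p w l = Suc (p w)" using lt[of w] assms by (simp add: rv_perm_def)
  show "rv_perm p w c < rv_perm p w l \<longleftrightarrow> c \<noteq> l \<and> p c \<le> p w"
    unfolding 1 using lt[of w] lt[of c] assms by (auto simp: rv_perm_def)
qed

lemma rv_perm_bij:
  fixes p :: "'a::finite \<Rightarrow> nat"
  assumes "bij_betw p UNIV {1..CARD('a)}" "p l = CARD('a)" "w \<noteq> l"
  shows "bij_betw (rv_perm p w) UNIV {1..CARD('a)}"
proof -
  note b = bij_last[OF assms(1)]
  have lt: "p x < CARD('a)" if "x \<noteq> l" for x
    using b(1)[of x] b(3) assms(2) that by (metis injD le_neq_implies_less)
  have "inj (rv_perm p w)"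
  proof (rule injI)
    fix x y assume e: "rv_perm p w x = rv_perm p w y"
    show "x = y"
    proof (rule ccontr)
      assume ne: "x \<noteq> y"
      then have "p x < p y \<or> p y < p x" using b(3) by (meson injD linorder_neqE_nat)
      then show False
        using e ne rv_perm_less_iff[OF assms, of x y] rv_perm_less_iff[OF assms, of y x]
          rv_perm_loser(2)[OF assms, of x] rv_perm_loser(2)[OF assms, of y]
        by (metis less_irrefl linorder_not_le nat_less_le)
    qed
  qed
  moreover have "rv_perm p w ` UNIV \<subseteq> {1..CARD('a)}"
  proof -
    have "1 \<le> rv_perm p w a \<and> rv_perm p w a \<le> CARD('a)" for a
      using b(1)[of a] b(2)[of a] lt[of w] assms by (auto simp: rv_perm_def)
    then show ?thesis by auto
  qed
  ultimately show ?thesis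
    unfolding bij_betw_def by (metis card_atLeastAtMost card_image card_subset_eq diff_Suc_1 finite_atLeastAtMost)
qed

text \<open>Initial segments of length at most \<open>p w\<close> do not change. A longer one now
  contains \<open>w\<close>, which is last for \<open>q\<close> and so belongs to no proper initial
  segment of \<open>q\<close>.\<close>

lemma rv_perm_initial_segments:
  fixes p q :: "'a::finite \<Rightarrow> nat"
  assumes "bij_betw p UNIV {1..CARD('a)}" "p l = CARD('a)" "w \<noteq> l" "q w = CARD('a)" "k < CARD('a)"
    and "{a. q a \<le> k} \<noteq> {a. p a \<le> k}"
  shows "{a. q a \<le> k} \<noteq> {a. rv_perm p w a \<le> k}"
proof (cases "k \<le> p w")
  case True
  note b = bij_last[OF assms(1)]
  have "p w < CARD('a)"
    using b(1)[of w] b(3) assms(2,3) by (metis injD le_neq_implies_less)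
  then have "rv_perm p w a \<le> k \<longleftrightarrow> p a \<le> k" for a
    using True b(1)[of a] by (auto simp: rv_perm_def)
  then show ?thesis using assms(6) by simp
next
  case False
  then have "w \<in> {a. rv_perm p w a \<le> k}" by (simp add: rv_perm_def)
  then show ?thesis using assms(4,5) by (metis (no_types, lifting) linorder_not_less mem_Collect_eq)
qed

text \<open>The length taken from \<open>w\<close> is exactly that of \<open>l\<close>, which now
  stands directly behind \<open>w\<close>; hence the letters further to the right do not move, and
  \<open>l\<close> starts at the new right end of \<open>w\<close>.\<close>

lemma left_end_rv_perm:
  fixes p :: "'a::finite \<Rightarrow> nat"
  assumes "bij_betw p UNIV {1..CARD('a)}" "p l = CARD('a)" "w \<noteq> l"
  shows "a \<noteq> l \<Longrightarrow> left_end (rv_perm p w) (lam(w := lam w - lam l)) a = left_end p lam a"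
    and "left_end (rv_perm p w) (lam(w := lam w - lam l)) l = left_end p lam w + lam w - lam l"
proof -
  note b = bij_last[OF assms(1)]
  have lt: "p x < CARD('a)" if "x \<noteq> l" for x
    using b(1)[of x] b(3) assms(2) that by (metis injD le_neq_implies_less)
  define lam' where "lam' = lam(w := lam w - lam l)"
  have upd: "sum lam' A = sum lam A - (if w \<in> A then lam l else 0)" for A
  proof -
    have "sum lam' A = (\<Sum>x\<in>A. lam x - (if x = w then lam l else 0))"
      by (intro sum.cong) (auto simp: lam'_def)
    then show ?thesis by (simp add: sum_subtractf sum.delta)
  qed
  show "left_end (rv_perm p w) (lam(w := lam w - lam l)) a = left_end p lam a" if "a \<noteq> l"
  proof (cases "p w < p a")
    case True
    have "{c. rv_perm p w c < rv_perm p w a} = insert l {c. p c < p a}"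
      using rv_perm_less_iff[OF assms that] True by auto
    then show ?thesis
      unfolding left_end_def lam'_def[symmetric] upd
      using True lt[OF that] assms(2) by auto
  next
    case False
    have "{c. rv_perm p w c < rv_perm p w a} = {c. p c < p a}"
    proof (intro Collect_cong)
      fix c
      show "rv_perm p w c < rv_perm p w a \<longleftrightarrow> p c < p a"
        using rv_perm_less_iff[OF assms that, of c] False lt[OF that] assms(2) by (cases "c = l") auto
    qed
    then show ?thesis
      unfolding left_end_def lam'_def[symmetric] upd using False by auto
  qed
  have "{c. rv_perm p w c < rv_perm p w l} = insert w {c. p c < p w}"
    unfolding rv_perm_loser(2)[OF assms] using b(3) lt[OF assms(3)] assms(2,3)
    by (auto simp: inj_def le_less)
  then show "left_end (rv_perm p w) (lam(w := lam w - lam l)) l = left_end p lam w + lam w - lam l"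
    unfolding left_end_def lam'_def[symmetric] upd by simp
qed

lemma total_length_upd:
  "total_length ((lam::'a::finite \<Rightarrow> real)(w := lam w - z)) = total_length lam - z"
proof -
  have "total_length (lam(w := lam w - z)) = (\<Sum>x\<in>UNIV. lam x - (if x = w then z else 0))"
    unfolding total_length_def by (intro sum.cong) auto
  then show ?thesis by (simp add: sum_subtractf sum.delta total_length_def)
qed

text \<open>The disjunction separates the two types. First type: \<open>w\<close> is last on the top
  line, and the map carries piece \<open>l\<close> onto the right end of piece \<open>w\<close>.
  Second type: \<open>w\<close> is last on the bottom line, and the map carries the right end of
  piece \<open>w\<close> onto piece \<open>l\<close>.\<close>

lemma rv_step_geometry:
  fixes s :: "'a::finite iem_data"
  assumes "CARD('a) \<ge> 2" "keane_data s"
  defines "w \<equiv> rv_winner s" and "l \<equiv> rv_loser s"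
  defines "E \<equiv> left_end (top_perm s) (lens s)"
    and "E' \<equiv> left_end (top_perm (rv_step s)) (lens (rv_step s))"
  defines "B \<equiv> left_end (bot_perm s) (lens s)"
    and "B' \<equiv> left_end (bot_perm (rv_step s)) (lens (rv_step s))"
  shows "total_length (lens (rv_step s)) = total_length (lens s) - lens s l"
    and "a \<noteq> l \<Longrightarrow> E' a = E a" "a \<noteq> l \<Longrightarrow> B' a = B a"
    and "(E' l = E l \<and> B l = E w + lens s w - lens s l \<and> B' l = B w + lens s w - lens s l) \<or>
         (E' l = E w + lens s w - lens s l \<and> E l = B w + lens s w - lens s l \<and> B' l = B l)"
    and "bij_betw (top_perm (rv_step s)) UNIV {1..CARD('a)}"
    and "bij_betw (bot_perm (rv_step s)) UNIV {1..CARD('a)}"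
    and "admissible (top_perm (rv_step s)) (bot_perm (rv_step s))"
proof -
  note b = keane_dataD[OF assms(2)] rv_winner_loser[OF assms(1,2), folded w_def l_def]
  have adm: "{a. top_perm s a \<le> k} \<noteq> {a. bot_perm s a \<le> k}" if "1 \<le> k" "k < CARD('a)" for k
    using assms(2) that by (auto simp: keane_data_def admissible_def)
  show "total_length (lens (rv_step s)) = total_length (lens s) - lens s l"
    unfolding b(9) by (rule total_length_upd)
  have all: "(a \<noteq> l \<longrightarrow> E' a = E a) \<and> (a \<noteq> l \<longrightarrow> B' a = B a) \<and>
     ((E' l = E l \<and> B l = E w + lens s w - lens s l \<and> B' l = B w + lens s w - lens s l) \<or>
         (E' l = E w + lens s w - lens s l \<and> E l = B w + lens s w - lens s l \<and> B' l = B l)) \<and>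
    bij_betw (top_perm (rv_step s)) UNIV {1..CARD('a)} \<and>
    bij_betw (bot_perm (rv_step s)) UNIV {1..CARD('a)} \<and>
    admissible (top_perm (rv_step s)) (bot_perm (rv_step s))" for a
  proof (rule rv_step_cases[OF assms(1,2), folded w_def l_def])
    assume t: "w = last0 s" "l = last1 s" "top_perm s w = CARD('a)" "bot_perm s l = CARD('a)"
     "rv_step s = (top_perm s, rv_perm (bot_perm s) w, (lens s)(w := lens s w - lens s l))"
    have E: "E' a = E a" for a
      unfolding E_def E'_def t(5) using left_end_upd_last[OF b(1) t(3)] by simp
    have "E w = total_length (lens s) - lens s w" "B l = total_length (lens s) - lens s l"
      unfolding E_def B_def using left_end_last b t by blast+
    moreover note left_end_rv_perm[OF b(2) t(4) b(7), where lam="lens s"] rv_perm_bij[OF b(2) t(4) b(7)]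
    moreover have "admissible (top_perm s) (rv_perm (bot_perm s) w)"
      unfolding admissible_def
      using rv_perm_initial_segments[OF b(2) t(4) b(7), of "top_perm s"] t(3) adm
        rv_perm_bij[OF b(2) t(4) b(7)] b(1)
      by blast
    ultimately show ?thesis using E b(1) by (auto simp: B_def B'_def t(5))
  next
    assume t: "w = last1 s" "l = last0 s" "bot_perm s w = CARD('a)" "top_perm s l = CARD('a)"
     "rv_step s = (rv_perm (top_perm s) w, bot_perm s, (lens s)(w := lens s w - lens s l))"
    have E: "B' a = B a" for a
      unfolding B_def B'_def t(5) using left_end_upd_last[OF b(2) t(3)] by simp
    have "B w = total_length (lens s) - lens s w" "E l = total_length (lens s) - lens s l"
      unfolding E_def B_def using left_end_last b t by blast+
    moreover note left_end_rv_perm[OF b(1) t(4) b(7), where lam="lens s"] rv_perm_bij[OF b(1) t(4) b(7)]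
    moreover have "admissible (rv_perm (top_perm s) w) (bot_perm s)"
      unfolding admissible_def
    proof (intro conjI allI impI b rv_perm_bij[OF b(1) t(4) b(7)])
      fix k assume k: "1 \<le> k \<and> k < CARD('a)"
      show "{a. rv_perm (top_perm s) w a \<le> k} \<noteq> {a. bot_perm s a \<le> k}"
        using rv_perm_initial_segments[OF b(1) t(4) b(7), of "bot_perm s" k] t(3) adm[of k] k by metis
    qed
    ultimately show ?thesis using E b(2) by (auto simp: E_def E'_def t(5))
  qed
  show "a \<noteq> l \<Longrightarrow> E' a = E a" "a \<noteq> l \<Longrightarrow> B' a = B a"
    "(E' l = E l \<and> B l = E w + lens s w - lens s l \<and> B' l = B w + lens s w - lens s l) \<or>
         (E' l = E w + lens s w - lens s l \<and> E l = B w + lens s w - lens s l \<and> B' l = B l)"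
    "bij_betw (top_perm (rv_step s)) UNIV {1..CARD('a)}"
    "bij_betw (bot_perm (rv_step s)) UNIV {1..CARD('a)}"
    "admissible (top_perm (rv_step s)) (bot_perm (rv_step s))"
    using all by blast+
qed

text \<open>On the new piece \<open>l\<close> the return takes two iterations. Of the two points
  visited, one has coordinate \<open>y\<close> in the old piece \<open>l\<close> and the other has
  coordinate \<open>y + lens s w - lens s l\<close> in the old piece \<open>w\<close>. Only their
  order depends on the type of step, so the sum of a function over them does not.\<close>

lemma iem_of_step:
  fixes s :: "'a::finite iem_data"
  assumes "CARD('a) \<ge> 2" "keane_data s"
  defines "w \<equiv> rv_winner s" and "l \<equiv> rv_loser s"
  defines "E \<equiv> left_end (top_perm s) (lens s)"
    and "E' \<equiv> left_end (top_perm (rv_step s)) (lens (rv_step s))"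
  shows "a \<noteq> l \<Longrightarrow> 0 \<le> y \<Longrightarrow> y < lens (rv_step s) a \<Longrightarrow>
      iem_of (rv_step s) (E' a + y) = iem_of s (E' a + y)"
    and "0 \<le> y \<Longrightarrow> y < lens s l \<Longrightarrow>
      iem_of (rv_step s) (E' l + y) = iem_of s (iem_of s (E' l + y))"
    and "0 \<le> y \<Longrightarrow> y < lens s l \<Longrightarrow>
      (E' l = E l \<and> iem_of s (E' l + y) = E w + (y + lens s w - lens s l)) \<or>
      (E' l + y = E w + (y + lens s w - lens s l) \<and> iem_of s (E' l + y) = E l + y)"
proof -
  note b = keane_dataD[OF assms(2)] rv_winner_loser[OF assms(1,2), folded w_def l_def]
  note g = rv_step_geometry[OF assms(1,2), folded w_def l_def E_def E'_def]
  have pos': "\<forall>a. 0 < lens (rv_step s) a" using b by auto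
  have T: "iem_of s (E a + y) = left_end (bot_perm s) (lens s) a + y"
    if "0 \<le> y" "y < lens s a" for a y
    unfolding E_def by (rule iem_left_end_add[OF b(3,5) that])
  have T': "iem_of (rv_step s) (E' a + y) = left_end (bot_perm (rv_step s)) (lens (rv_step s)) a + y"
    if "0 \<le> y" "y < lens (rv_step s) a" for a y
    unfolding E'_def by (rule iem_left_end_add[OF bij_last(3)[OF g(5)] pos' that])
  have le: "lens (rv_step s) a \<le> lens s a" for a using b(5,9) by (auto simp: less_imp_le)
  show "iem_of (rv_step s) (E' a + y) = iem_of s (E' a + y)"
    if "a \<noteq> l" "0 \<le> y" "y < lens (rv_step s) a"
    using T[of y a] T'[OF that(2,3)] g(2,3)[OF that(1)] that le[of a] by simp
  assume y: "0 \<le> y" "y < lens s l"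
  have l: "lens (rv_step s) l = lens s l" using b(7,9) by simp
  have y': "0 \<le> y + lens s w - lens s l" "y + lens s w - lens s l < lens s w"
    using y b(8) by auto
  note eqs = T[OF y] T[OF y'] T'[of y l, unfolded l, OF y]
  from g(4)
  show "iem_of (rv_step s) (E' l + y) = iem_of s (iem_of s (E' l + y))"
  proof (elim disjE conjE)
    assume h: "E' l = E l" "left_end (bot_perm s) (lens s) l = E w + lens s w - lens s l"
      "left_end (bot_perm (rv_step s)) (lens (rv_step s)) l = left_end (bot_perm s) (lens s) w + lens s w - lens s l"
    then have e: "iem_of s (E' l + y) = E w + (y + lens s w - lens s l)" using eqs by simp
    show ?thesis unfolding e eqs(2) eqs(3) h(3) by simp
  next
    assume h: "E' l = E w + lens s w - lens s l" "E l = left_end (bot_perm s) (lens s) w + lens s w - lens s l"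
      "left_end (bot_perm (rv_step s)) (lens (rv_step s)) l = left_end (bot_perm s) (lens s) l"
    then have "E' l + y = E w + (y + lens s w - lens s l)" by simp
    then have "iem_of s (E' l + y) = left_end (bot_perm s) (lens s) w + (y + lens s w - lens s l)"
      using eqs(2) by (simp only:)
    then have e: "iem_of s (E' l + y) = E l + y" using h(2) by simp
    show ?thesis unfolding e eqs(1) eqs(3) h(3) by simp
  qed
  from g(4)
  show "(E' l = E l \<and> iem_of s (E' l + y) = E w + (y + lens s w - lens s l)) \<or>
      (E' l + y = E w + (y + lens s w - lens s l) \<and> iem_of s (E' l + y) = E l + y)"
  proof (elim disjE conjE)
    assume h: "E' l = E l" "left_end (bot_perm s) (lens s) l = E w + lens s w - lens s l"
    then show ?thesis using eqs by simp
  next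
    assume h: "E' l = E w + lens s w - lens s l" "E l = left_end (bot_perm s) (lens s) w + lens s w - lens s l"
    then have *: "E' l + y = E w + (y + lens s w - lens s l)" by simp
    then have "iem_of s (E' l + y) = left_end (bot_perm s) (lens s) w + (y + lens s w - lens s l)"
      using eqs(2) by (simp only:)
    then have "iem_of s (E' l + y) = E l + y" using h(2) by simp
    then show ?thesis using * by blast
  qed
qed

lemma piece_cases:
  fixes p :: "'a::finite \<Rightarrow> nat"
  assumes "bij_betw p UNIV {1..CARD('a)}" "x \<in> {0..<total_length lam}"
  obtains a y where "x = left_end p lam a + y" "0 \<le> y" "y < lam a"
proof -
  obtain a where "x \<in> piece p lam a" using piece_exists[OF assms] .
  then show ?thesis using that[of a "x - left_end p lam a"] by (auto simp: piece_def)
qed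

text \<open>Every iteration of the new map is one or two iterations of the old one, so connections
  of the new map can be read in the old one.\<close>

lemma iem_of_step_power:
  fixes s :: "'a::finite iem_data"
  assumes "CARD('a) \<ge> 2" "keane_data s" "x \<in> {0..<total_length (lens (rv_step s))}"
  shows "\<exists>m'\<ge>m. (iem_of (rv_step s) ^^ m) x = (iem_of s ^^ m') x"
  using assms(3)
proof (induction m arbitrary: x)
  case 0
  then show ?case by (intro exI[of _ 0]) auto
next
  case (Suc m)
  note b = keane_dataD[OF assms(2)] rv_winner_loser[OF assms(1,2)]
  note g = rv_step_geometry[OF assms(1,2)]
  have pos': "\<forall>a. 0 < lens (rv_step s) a" using b by auto
  have "\<exists>j\<ge>1. iem_of (rv_step s) x = (iem_of s ^^ j) x"
  proof (rule piece_cases[OF g(5) Suc.prems])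
    fix a y assume h: "x = left_end (top_perm (rv_step s)) (lens (rv_step s)) a + y" "0 \<le> y" "y < lens (rv_step s) a"
    show ?thesis
    proof (cases "a = rv_loser s")
      case True
      then show ?thesis using iem_of_step(2)[OF assms(1,2), of y] h b(7,9)
        by (intro exI[of _ 2]) (auto simp: numeral_2_eq_2)
    next
      case False
      then show ?thesis using iem_of_step(1)[OF assms(1,2) False h(2,3)] h
        by (intro exI[of _ 1]) auto
    qed
  qed
  then obtain j where j: "j \<ge> 1" "iem_of (rv_step s) x = (iem_of s ^^ j) x" by blast
  have "iem_of (rv_step s) x \<in> {0..<total_length (lens (rv_step s))}"
    by (rule iem_mem[OF g(5) pos' Suc.prems])
  from Suc.IH[OF this] obtain m' where "m' \<ge> m"
    "(iem_of (rv_step s) ^^ m) (iem_of (rv_step s) x) = (iem_of s ^^ m') (iem_of (rv_step s) x)" by blast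
  then show ?case using j
    by (intro exI[of _ "m' + j"]) (auto simp: funpow_add funpow_Suc_right simp del: funpow.simps)
qed

text \<open>A connection of the new map would produce one of the old map. Left ends change only for
  the loser, and then the old left end is the image of the new one. Hence \<open>T' (E' a)\<close>
  lies on the forward orbit of \<open>E a\<close>, and the forward orbit of \<open>E' c\<close>
  passes through \<open>E c\<close>.\<close>

lemma keane_data_rv_step:
  fixes s :: "'a::finite iem_data"
  assumes "CARD('a) \<ge> 2" "keane_data s"
  shows "keane_data (rv_step s)"
proof -
  define w l where "w = rv_winner s" and "l = rv_loser s"
  define E where "E = left_end (top_perm s) (lens s)"
  define E' where "E' = left_end (top_perm (rv_step s)) (lens (rv_step s))"
  define T where "T = iem_of s"
  define T' where "T' = iem_of (rv_step s)"
  note b = keane_dataD[OF assms(2)] rv_winner_loser[OF assms, folded w_def l_def]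
  note g = rv_step_geometry[OF assms, folded w_def l_def E_def E'_def]
  note st = iem_of_step[OF assms, folded w_def l_def E_def E'_def T_def T'_def]
  have pos': "\<forall>a. 0 < lens (rv_step s) a" using b by auto
  have y0: "0 < lens s l" using b(5) by simp
  have lo: "(E' l = E l) \<or> T (E' l) = E l" using st(3)[of 0] y0 by auto
  have src: "\<exists>j\<ge>1. T' (E' a) = (T ^^ j) (E a)" for a
  proof (cases "a = l")
    case False
    then show ?thesis using st(1)[of a 0] g(2) pos' by (intro exI[of _ 1]) auto
  next
    case True
    have "T' (E' l) = T (T (E' l))" using st(2)[of 0] y0 by simp
    from lo show ?thesis
    proof
      assume "E' l = E l"
      then show ?thesis using True \<open>T' (E' l) = T (T (E' l))\<close>
        by (intro exI[of _ 2]) (auto simp: numeral_2_eq_2)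
    next
      assume "T (E' l) = E l"
      then show ?thesis using True \<open>T' (E' l) = T (T (E' l))\<close> by (intro exI[of _ 1]) auto
    qed
  qed
  have tgt: "\<exists>j. (T ^^ j) (E' b) = E b" for b
  proof (cases "b = l")
    case False
    then show ?thesis using g(2) by (intro exI[of _ 0]) auto
  next
    case True
    from lo show ?thesis
    proof
      assume "E' l = E l"
      then show ?thesis using True by (intro exI[of _ 0]) auto
    next
      assume "T (E' l) = E l"
      then show ?thesis using True by (intro exI[of _ 1]) auto
    qed
  qed
  have first: "top_perm s b > 1" if "top_perm (rv_step s) b > 1" for b
  proof (rule rv_step_cases[OF assms])
    assume "rv_step s = (top_perm s, rv_perm (bot_perm s) (rv_winner s),
         (lens s)(rv_winner s := lens s (rv_winner s) - lens s (rv_loser s)))"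
    then show ?thesis using that by simp
  next
    assume h: "rv_step s = (rv_perm (top_perm s) (rv_winner s), bot_perm s,
         (lens s)(rv_winner s := lens s (rv_winner s) - lens s (rv_loser s)))"
    show ?thesis
      using that bij_last(2)[OF b(1), of b] bij_last(2)[OF b(1), of "rv_winner s"]
      unfolding h by (auto simp: rv_perm_def split: if_splits)
  qed
  have "\<not> (\<exists>a b (m::nat). top_perm (rv_step s) b > 1 \<and> m \<ge> 1 \<and> (T' ^^ m) (E' a) = E' b)"
  proof
    assume "\<exists>a b (m::nat). top_perm (rv_step s) b > 1 \<and> m \<ge> 1 \<and> (T' ^^ m) (E' a) = E' b"
    then obtain a c m where h: "top_perm (rv_step s) c > 1" "m \<ge> 1" "(T' ^^ m) (E' a) = E' c" by blast
    obtain j where j: "j \<ge> 1" "T' (E' a) = (T ^^ j) (E a)" using src by blast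
    obtain i where i: "(T ^^ i) (E' c) = E c" using tgt by blast
    have "E' a \<in> piece (top_perm (rv_step s)) (lens (rv_step s)) a"
      using pos' by (auto simp: E'_def piece_def)
    then have "E' a \<in> {0..<total_length (lens (rv_step s))}" using piece_subset[OF pos'] by blast
    then have "T' (E' a) \<in> {0..<total_length (lens (rv_step s))}"
      unfolding T'_def by (rule iem_mem[OF g(5) pos'])
    from iem_of_step_power[OF assms this, of "m - 1"] obtain m' where
      "(T' ^^ (m - 1)) (T' (E' a)) = (T ^^ m') (T' (E' a))" unfolding T_def T'_def by blast
    moreover have "(T' ^^ m) (E' a) = (T' ^^ (m - 1)) (T' (E' a))"
      using h(2) by (cases m) (auto simp: funpow_Suc_right simp del: funpow.simps)
    ultimately have "E' c = (T ^^ (m' + j)) (E a)" using h(3) j(2) by (simp add: funpow_add)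
    then have "(T ^^ (i + m' + j)) (E a) = E c" using i by (simp add: funpow_add)
    moreover have "1 \<le> i + m' + j" using j(1) by simp
    ultimately show False using b(6) first[OF h(1)] unfolding keane_def E_def T_def by blast
  qed
  then show ?thesis
    using g(7) pos' unfolding keane_data_def keane_def E'_def T'_def by blast
qed

text \<open>The removed interval lies in the last top piece. Its image lies in the bottom copy of
  that letter, to the left of the last bottom piece, and the latter is at least as long as the
  loser.\<close>

lemma iem_of_removed:
  fixes s :: "'a::finite iem_data"
  assumes "CARD('a) \<ge> 2" "keane_data s" "x \<in> {0..<total_length (lens s)}"
    "x \<notin> {0..<total_length (lens (rv_step s))}"
  shows "iem_of s x \<in> {0..<total_length (lens (rv_step s))}"
proof -
  define w l where "w = rv_winner s" and "l = rv_loser s"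
  note b = keane_dataD[OF assms(2)] rv_winner_loser[OF assms(1,2), folded w_def l_def]
  note L = rv_step_geometry(1)[OF assms(1,2), folded w_def l_def]
  have x: "total_length (lens s) - lens s l \<le> x" using assms(3,4) L by auto
  have T: "iem_of s x = left_end (bot_perm s) (lens s) a + (x - left_end (top_perm s) (lens s) a)"
    if "left_end (top_perm s) (lens s) a \<le> x" "x < left_end (top_perm s) (lens s) a + lens s a" for a
    using iem_left_end_add[OF b(3,5), of "x - left_end (top_perm s) (lens s) a" a "bot_perm s"] that by simp
  have nn: "0 \<le> iem_of s x" using iem_mem[OF b(1,5) assms(3), of "bot_perm s"] by simp
  have "iem_of s x < total_length (lens s) - lens s l"
  proof (rule rv_step_cases[OF assms(1,2), folded w_def l_def])
    assume t: "top_perm s w = CARD('a)" "bot_perm s l = CARD('a)"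
    have "bot_perm s w < bot_perm s l"
      using t(2) b(7) bij_last(1)[OF b(2), of w] b(4) by (metis injD le_neq_implies_less)
    then have "left_end (bot_perm s) (lens s) w + lens s w \<le> total_length (lens s) - lens s l"
      using left_end_add_le[OF b(5)] left_end_last[OF b(2) t(2)] by metis
    then show ?thesis using T[of w] left_end_last[OF b(1) t(1), of "lens s"] x b(8) assms(3) by auto
  next
    assume t: "bot_perm s w = CARD('a)" "top_perm s l = CARD('a)"
    have "bot_perm s l < bot_perm s w"
      using t(1) b(7) bij_last(1)[OF b(2), of l] b(4) by (metis injD le_neq_implies_less)
    then have "left_end (bot_perm s) (lens s) l + lens s l \<le> total_length (lens s) - lens s w"
      using left_end_add_le[OF b(5)] left_end_last[OF b(2) t(1)] by metis
    then show ?thesis using T[of l] left_end_last[OF b(1) t(2), of "lens s"] x b(8) assms(3) by auto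
  qed
  then show ?thesis using L nn by simp
qed

section \<open>Birkhoff sums under one step\<close>

definition birkhoff_sum :: "(real \<Rightarrow> real) \<Rightarrow> (real \<Rightarrow> real) \<Rightarrow> nat \<Rightarrow> real \<Rightarrow> real" where
  "birkhoff_sum T f n x = (\<Sum>i<n. f ((T ^^ i) x))"

lemma birkhoff_sum_0 [simp]: "birkhoff_sum T f 0 x = 0"
  by (simp add: birkhoff_sum_def)

lemma birkhoff_sum_Suc: "birkhoff_sum T f (Suc n) x = f x + birkhoff_sum T f n (T x)"
  unfolding birkhoff_sum_def
  by (subst sum.lessThan_Suc_shift) (simp add: funpow_Suc_right del: funpow.simps)

text \<open>An orbit segment of the old map is one of the new map, except for a possible first point
  in the removed interval and a possible last point whose excursion of two iterations is cut short.
  Each exception costs one value of \<open>f\<close>, whence \<open>2 * M\<close>.\<close>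

lemma birkhoff_sum_rv_step:
  fixes s :: "'a::finite iem_data" and f f' :: "real \<Rightarrow> real"
  assumes "CARD('a) \<ge> 2" "keane_data s"
  defines "l \<equiv> rv_loser s" and "E' \<equiv> left_end (top_perm (rv_step s)) (lens (rv_step s))"
  assumes f1: "\<And>a y. a \<noteq> l \<Longrightarrow> 0 \<le> y \<Longrightarrow> y < lens (rv_step s) a \<Longrightarrow> f' (E' a + y) = f (E' a + y)"
    and f2: "\<And>y. 0 \<le> y \<Longrightarrow> y < lens s l \<Longrightarrow> f' (E' l + y) = f (E' l + y) + f (iem_of s (E' l + y))"
    and bound: "\<And>x. x \<in> {0..<total_length (lens s)} \<Longrightarrow> \<bar>f x\<bar> \<le> M"
    and x: "x \<in> {0..<total_length (lens s)}"
  shows "\<exists>x'\<in>{0..<total_length (lens (rv_step s))}. \<exists>n'\<le>n.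
     \<bar>birkhoff_sum (iem_of s) f n x\<bar> \<le> 2 * M + \<bar>birkhoff_sum (iem_of (rv_step s)) f' n' x'\<bar>"
proof -
  define T where "T = iem_of s"
  define T' where "T' = iem_of (rv_step s)"
  note b = keane_dataD[OF assms(2)] rv_winner_loser[OF assms(1,2), folded l_def]
  note b' = keane_dataD[OF keane_data_rv_step[OF assms(1,2)]]
  note g = rv_step_geometry[OF assms(1,2), folded l_def E'_def]
  note st = iem_of_step[OF assms(1,2), folded l_def E'_def T_def T'_def]
  define I' where "I' = {0..<total_length (lens (rv_step s))}"
  have L: "total_length (lens (rv_step s)) \<le> total_length (lens s)" using g(1) b(5) by (simp add: less_imp_le)
  have M0: "0 \<le> M" using bound[OF x] by linarith
  \<comment> \<open>Strong induction, since one new iteration may use up two old ones.\<close>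
  have main: "\<exists>n'\<le>n. \<bar>birkhoff_sum T f n x - birkhoff_sum T' f' n' x\<bar> \<le> M" if "x \<in> I'" for n x
    using that
  proof (induction n arbitrary: x rule: less_induct)
    case (less n)
    obtain a y where h: "x = E' a + y" "0 \<le> y" "y < lens (rv_step s) a"
      using piece_cases[OF b'(1)] less.prems unfolding I'_def E'_def by metis
    have T'x: "T' x \<in> I'" unfolding I'_def T'_def using less.prems
      by (intro iem_mem b') (auto simp: I'_def)
    show ?case
    proof (cases n)
      case 0
      then show ?thesis using M0 by (intro exI[of _ 0]) auto
    next
      case (Suc m)
      show ?thesis
      proof (cases "a = l")
        case False
        obtain n' where n': "n' \<le> m" "\<bar>birkhoff_sum T f m (T' x) - birkhoff_sum T' f' n' (T' x)\<bar> \<le> M"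
          using less.IH[OF _ T'x, of m] Suc by auto
        have "T' x = T x" "f' x = f x" using st(1)[OF False h(2,3)] f1[OF False h(2,3)] h(1) by auto
        then show ?thesis using n' Suc
          by (intro exI[of _ "Suc n'"]) (auto simp: birkhoff_sum_Suc)
      next
        case True
        have y: "y < lens s l" using h(3) True b(7,9) by simp
        have e: "T' x = T (T x)" "f' x = f x + f (T x)" using st(2)[OF h(2) y] f2[OF h(2) y] h(1) True
          by (auto simp: T_def)
        show ?thesis
        proof (cases m)
          case 0
          have "\<bar>f x\<bar> \<le> M" using bound less.prems L by (auto simp: I'_def)
          then show ?thesis using 0 Suc by (intro exI[of _ 0]) (auto simp: birkhoff_sum_Suc)
        next
          case (Suc k)
          obtain n' where n': "n' \<le> k" "\<bar>birkhoff_sum T f k (T' x) - birkhoff_sum T' f' n' (T' x)\<bar> \<le> M"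
            using less.IH[OF _ T'x, of k] Suc \<open>n = Suc m\<close> by auto
          then show ?thesis using e Suc \<open>n = Suc m\<close>
            by (intro exI[of _ "Suc n'"]) (auto simp: birkhoff_sum_Suc algebra_simps)
        qed
      qed
    qed
  qed
  show ?thesis
  proof (cases "x \<in> I'")
    case True
    obtain n' where "n' \<le> n" "\<bar>birkhoff_sum T f n x - birkhoff_sum T' f' n' x\<bar> \<le> M"
      using main[OF True] by blast
    moreover have "\<bar>birkhoff_sum T f n x\<bar> \<le> 2 * M + \<bar>birkhoff_sum T' f' n' x\<bar>"
      using calculation(2) M0 by linarith
    ultimately show ?thesis using True unfolding I'_def T_def T'_def by blast
  next
    case False
    have Tx: "T x \<in> I'" using iem_of_removed[OF assms(1,2) x] False by (simp add: I'_def T_def)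
    show ?thesis
    proof (cases n)
      case 0
      then show ?thesis using M0 Tx unfolding I'_def by auto
    next
      case (Suc m)
      obtain n' where n': "n' \<le> m" "\<bar>birkhoff_sum T f m (T x) - birkhoff_sum T' f' n' (T x)\<bar> \<le> M"
        using main[OF Tx] by blast
      have "\<bar>birkhoff_sum T f n x\<bar> \<le> 2 * M + \<bar>birkhoff_sum T' f' n' (T x)\<bar>"
        using n'(2) bound[OF x] unfolding Suc birkhoff_sum_Suc by linarith
      then show ?thesis using Tx n'(1) Suc le_Suc_eq unfolding I'_def T_def T'_def by blast
    qed
  qed
qed

section \<open>Every letter wins infinitely often\<close>

lemma card_perm_le:
  fixes p :: "'a::finite \<Rightarrow> nat"
  assumes "bij_betw p UNIV {1..CARD('a)}" "k \<le> CARD('a)"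
  shows "card {a. p a \<le> k} = k"
proof -
  have "p ` {a. p a \<le> k} = {1..k}"
  proof
    show "p ` {a. p a \<le> k} \<subseteq> {1..k}" using bij_last(2)[OF assms(1)] by auto
    show "{1..k} \<subseteq> p ` {a. p a \<le> k}"
    proof
      fix x assume x: "x \<in> {1..k}"
      then have "x \<in> p ` UNIV" using assms by (auto simp: bij_betw_def)
      then show "x \<in> p ` {a. p a \<le> k}" using x by auto
    qed
  qed
  moreover have "inj_on p {a. p a \<le> k}" using bij_last(3)[OF assms(1)] by (meson inj_on_subset top_greatest)
  ultimately show ?thesis by (metis card_atLeastAtMost card_image diff_Suc_1)
qed

lemma perm_initial_segment:
  fixes p :: "'a::finite \<Rightarrow> nat"
  assumes "bij_betw p UNIV {1..CARD('a)}" "\<And>a b. b \<in> B \<Longrightarrow> a \<notin> B \<Longrightarrow> p b < p a"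
  shows "{a. p a \<le> card B} = B"
proof -
  note q = bij_last[OF assms(1)]
  have "p b \<le> card B" if "b \<in> B" for b
  proof -
    have "{c. p c \<le> p b} \<subseteq> B" using assms(2)[OF that] by fastforce
    then have "card {c. p c \<le> p b} \<le> card B" by (intro card_mono) auto
    then show ?thesis using card_perm_le[OF assms(1) q(1)] by simp
  qed
  moreover have "card B < p a" if "a \<notin> B" for a
  proof -
    have "insert a B \<subseteq> {c. p c \<le> p a}" using assms(2)[OF _ that] by (auto simp: less_imp_le)
    then have "card (insert a B) \<le> card {c. p c \<le> p a}" by (intro card_mono) auto
    then show ?thesis using card_perm_le[OF assms(1) q(1)] that by simp
  qed
  ultimately have "p a \<le> card B \<longleftrightarrow> a \<in> B" for a by (meson linorder_not_le)
  then show ?thesis by blast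
qed

locale keane_iem =
  fixes s :: "'a::finite iem_data"
  assumes card2: "CARD('a) \<ge> 2" and keane_s: "keane_data s"
begin

abbreviation "st n \<equiv> rv_iter s n"
abbreviation "lam n \<equiv> lens (st n)"
abbreviation "win n \<equiv> rv_winner (st n)"
abbreviation "los n \<equiv> rv_loser (st n)"

lemma st_Suc: "st (Suc n) = rv_step (st n)"
  by (simp add: rv_iter_def)

lemma st_0 [simp]: "st 0 = s"
  by (simp add: rv_iter_def)

lemma keane_n: "keane_data (st n)"
  by (induction n) (auto simp: st_Suc keane_s keane_data_rv_step[OF card2])

lemma lam_pos: "0 < lam n a"
  using keane_dataD(5)[OF keane_n] by blast

lemma win_neq_los: "win n \<noteq> los n" "los n \<noteq> win n"
  using rv_winner_loser(1)[OF card2 keane_n] by metis+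

lemma lam_los_less: "lam n (los n) < lam n (win n)"
  using rv_winner_loser(2)[OF card2 keane_n] .

lemma lam_Suc: "lam (Suc n) = (lam n)(win n := lam n (win n) - lam n (los n))"
  using rv_winner_loser(3)[OF card2 keane_n] by (simp add: st_Suc)

definition perm :: "bool \<Rightarrow> nat \<Rightarrow> 'a \<Rightarrow> nat" where
  "perm e n = (if e then top_perm (st n) else bot_perm (st n))"

lemma perm_bij: "bij_betw (perm e n) UNIV {1..CARD('a)}"
  using keane_dataD[OF keane_n] by (simp add: perm_def)

lemma perm_step_cases:
  obtains "perm e (Suc n) = perm e n" "perm e n (win n) = CARD('a)"
  | "perm e (Suc n) = rv_perm (perm e n) (win n)" "perm e n (los n) = CARD('a)"
  by (rule rv_step_cases[OF card2 keane_n[of n]]; cases e) (auto simp: perm_def st_Suc)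

text \<open>The winner stays last on its own line, so it is one of the two letters compared in the
  next step.\<close>

lemma win_next: "win (Suc n) = win n \<or> los (Suc n) = win n"
proof -
  obtain e where e: "perm e (Suc n) (win n) = CARD('a)"
  proof (rule rv_step_cases[OF card2 keane_n[of n]])
    assume "top_perm (st n) (win n) = CARD('a)" and h: "rv_step (st n) = (top_perm (st n),
      rv_perm (bot_perm (st n)) (win n), (lam n)(win n := lam n (win n) - lam n (los n)))"
    then show ?thesis by (intro that[of True]) (simp add: perm_def st_Suc)
  next
    assume "bot_perm (st n) (win n) = CARD('a)" and h: "rv_step (st n) = (rv_perm (top_perm (st n)) (win n),
      bot_perm (st n), (lam n)(win n := lam n (win n) - lam n (los n)))"
    then show ?thesis by (intro that[of False]) (simp add: perm_def st_Suc)
  qed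
  have "inj (perm e (Suc n))" for e using perm_bij bij_last(3) by blast
  then have "win n = last0 (st (Suc n)) \<or> win n = last1 (st (Suc n))"
    using last_perm[OF keane_n[of "Suc n"]] e
    by (cases e) (metis (mono_tags, lifting) injD perm_def)+
  then show ?thesis by (auto simp: rv_winner_def rv_loser_def)
qed

text \<open>On either line a step moves at most the letters behind the winner, by one to the right,
  and the loser, which goes directly behind the winner. So a letter that neither loses nor moves is
  the winner or lies to its left, and nothing to its right, not even the reinserted loser, can pass
  to its left.\<close>

lemma perm_step:
  assumes "b \<noteq> los n"
  shows "perm e n b \<le> perm e (Suc n) b"
    and "perm e (Suc n) b = perm e n b \<Longrightarrow> b \<noteq> win n \<Longrightarrow> perm e n b < perm e n (win n)"
    and "perm e (Suc n) b = perm e n b \<Longrightarrow> perm e n b < perm e n a \<Longrightarrow> perm e (Suc n) b < perm e (Suc n) a"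
proof -
  note q = bij_last[OF perm_bij[of e n]]
  have lt: "perm e n x < CARD('a)" if "perm e n y = CARD('a)" "x \<noteq> y" for x y
    using q(1)[of x] q(3) that by (metis injD le_neq_implies_less)
  have all: "perm e n b \<le> perm e (Suc n) b \<and>
    (perm e (Suc n) b = perm e n b \<longrightarrow> b \<noteq> win n \<longrightarrow> perm e n b < perm e n (win n)) \<and>
    (perm e (Suc n) b = perm e n b \<longrightarrow> perm e n b < perm e n a \<longrightarrow> perm e (Suc n) b < perm e (Suc n) a)" for a
  proof (rule perm_step_cases[of e n])
    assume h: "perm e (Suc n) = perm e n" "perm e n (win n) = CARD('a)"
    show ?thesis unfolding h(1) using lt[OF h(2)] h(2) by auto
  next
    assume h: "perm e (Suc n) = rv_perm (perm e n) (win n)" "perm e n (los n) = CARD('a)"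
    have bl: "perm e n b < CARD('a)" using lt[OF h(2) assms] .
    have wl: "perm e n (win n) < CARD('a)" using lt[OF h(2) win_neq_los(1)] .
    have ne: "perm e n b = perm e n (win n) \<longleftrightarrow> b = win n" using q(3) by (simp add: inj_eq)
    have al: "perm e n a = CARD('a) \<or> perm e n a < CARD('a)" using q(1)[of a] by auto
    show ?thesis unfolding h(1) rv_perm_def using bl wl ne al by auto
  qed
  show "perm e n b \<le> perm e (Suc n) b"
    "perm e (Suc n) b = perm e n b \<Longrightarrow> b \<noteq> win n \<Longrightarrow> perm e n b < perm e n (win n)"
    "perm e (Suc n) b = perm e n b \<Longrightarrow> perm e n b < perm e n a \<Longrightarrow> perm e (Suc n) b < perm e (Suc n) a"
    using all by blast+
qed

text \<open>A letter that has stopped winning keeps its length. Each of its losses shortens the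
  total length by that amount, which can happen only finitely often.\<close>

lemma los_eventually:
  assumes "\<forall>\<^sub>F n in sequentially. win n \<noteq> b"
  shows "\<forall>\<^sub>F n in sequentially. los n \<noteq> b"
proof -
  obtain N where N: "\<And>n. n \<ge> N \<Longrightarrow> win n \<noteq> b"
    using assms by (auto simp: eventually_sequentially)
  have const: "lam n b = lam N b" if "n \<ge> N" for n
    using that by (induction n rule: dec_induct) (use N lam_Suc in auto)
  define L where "L n = total_length (lam n)" for n
  have L: "L (Suc n) = L n - lam n (los n)" for n
    unfolding L_def lam_Suc by (rule total_length_upd)
  have "decseq L" using L lam_pos by (intro decseq_SucI) (simp add: less_imp_le)
  moreover have "0 \<le> L n" for n
    unfolding L_def total_length_def using lam_pos by (intro sum_nonneg) (simp add: less_imp_le)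
  ultimately obtain l where l: "L \<longlonglongrightarrow> l" using decseq_convergent by blast
  then have "(\<lambda>n. L n - L (Suc n)) \<longlonglongrightarrow> l - l" by (intro tendsto_intros LIMSEQ_Suc)
  then have "\<forall>\<^sub>F n in sequentially. L n - L (Suc n) < lam N b"
    using lam_pos by (intro order_tendstoD(2)[of _ "l - l"]) auto
  moreover have "\<forall>\<^sub>F n in sequentially. n \<ge> N" by (rule eventually_ge_at_top)
  ultimately show ?thesis
  proof eventually_elim
    case (elim n)
    then show ?case using L[of n] const[of n] by auto
  qed
qed

text \<open>Otherwise the letters winning only finitely often would, after finitely many steps, be to the
  left of all other letters on both lines, contradicting admissibility.\<close>

lemma win_frequently: "\<exists>n\<ge>N. win n = a"
proof -
  define A where "A = {a. \<exists>\<^sub>F n in sequentially. win n = a}"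
  have evB: "\<forall>\<^sub>F n in sequentially. win n \<noteq> b" if "b \<notin> A" for b
    using that by (simp add: A_def frequently_def)
  have ev1: "\<forall>\<^sub>F n in sequentially. win n \<in> A"
  proof -
    have "\<forall>\<^sub>F n in sequentially. \<forall>b\<in>-A. win n \<noteq> b"
      by (rule eventually_ball_finite) (use evB in auto)
    then show ?thesis by eventually_elim auto
  qed
  have ev2: "\<forall>\<^sub>F n in sequentially. los n \<in> A"
  proof -
    have "\<forall>\<^sub>F n in sequentially. \<forall>b\<in>-A. los n \<noteq> b"
      by (rule eventually_ball_finite) (use evB los_eventually in auto)
    then show ?thesis by eventually_elim auto
  qed
  \<comment> \<open>A letter outside \<open>A\<close> eventually never loses, so its position is
    nondecreasing and bounded, hence eventually constant.\<close>
  have ev3: "\<forall>\<^sub>F n in sequentially. perm e (Suc n) b = perm e n b" if "b \<notin> A" for e b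
  proof -
    obtain N where N: "\<And>n. n \<ge> N \<Longrightarrow> los n \<in> A" using ev2 by (auto simp: eventually_sequentially)
    define X where "X n = real (perm e (n + N) b)" for n
    have "perm e (n + N) b \<le> perm e (Suc (n + N)) b" for n
      using N[of "n + N"] that by (intro perm_step(1)) auto
    then have "incseq X" by (intro incseq_SucI) (simp add: X_def)
    moreover have "X n \<le> CARD('a)" for n using bij_last(1)[OF perm_bij] by (simp add: X_def)
    ultimately obtain l where l: "X \<longlonglongrightarrow> l" using incseq_convergent by blast
    then have "(\<lambda>n. X (Suc n) - X n) \<longlonglongrightarrow> l - l" by (intro tendsto_intros LIMSEQ_Suc)
    then have "\<forall>\<^sub>F n in sequentially. X (Suc n) - X n < 1"
      by (intro order_tendstoD(2)[of _ "l - l"]) auto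
    then have "\<forall>\<^sub>F n in sequentially. perm e (Suc (n + N)) b = perm e (n + N) b"
    proof eventually_elim
      case (elim n)
      then show ?case using \<open>incseq X\<close>[THEN incseq_SucD, of n] by (simp add: X_def)
    qed
    then show ?thesis using eventually_sequentially_seg[of "\<lambda>n. perm e (Suc n) b = perm e n b" N] by simp
  qed
  have "\<forall>\<^sub>F n in sequentially. \<forall>b\<in>-A. perm True (Suc n) b = perm True n b \<and> perm False (Suc n) b = perm False n b"
    by (rule eventually_ball_finite) (use ev3 in \<open>auto intro: eventually_conj\<close>)
  then have "\<forall>\<^sub>F n in sequentially. win n \<in> A \<and> los n \<in> A \<and> (\<forall>b\<in>-A. \<forall>e. perm e (Suc n) b = perm e n b)"
    using ev1 ev2
  proof eventually_elim
    case (elim n)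
    have "perm e (Suc n) b = perm e n b" if "b \<in> -A" for e b
      using elim(1) that by (cases e) auto
    then show ?case using elim(2,3) by blast
  qed
  then obtain M where M: "\<And>n. n \<ge> M \<Longrightarrow> win n \<in> A" "\<And>n. n \<ge> M \<Longrightarrow> los n \<in> A"
    "\<And>n b e. n \<ge> M \<Longrightarrow> b \<notin> A \<Longrightarrow> perm e (Suc n) b = perm e n b"
    by (auto simp: eventually_sequentially)
  \<comment> \<open>At a step won by \<open>a\<close> every stationary letter lies to the left of
    \<open>a\<close>, and it stays there afterwards.\<close>
  have sep: "\<forall>\<^sub>F n in sequentially. \<forall>b\<in>-A. \<forall>e. perm e n b < perm e n a" if a: "a \<in> A" for a
  proof -
    obtain n where n: "n \<ge> M" "win n = a"
      using a by (auto simp: A_def frequently_sequentially)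
    have "perm e m b < perm e m a" if "m \<ge> n" "b \<notin> A" for m b e
      using that(1)
    proof (induction m rule: dec_induct)
      case base
      have "b \<noteq> los n" "b \<noteq> win n" using M(1,2)[OF n(1)] \<open>b \<notin> A\<close> by auto
      then show ?case using perm_step(2)[of b n e] M(3)[OF n(1) \<open>b \<notin> A\<close>] n(2) by simp
    next
      case (step m)
      have m: "m \<ge> M" using step n(1) by simp
      have "b \<noteq> los m" using M(2)[OF m] \<open>b \<notin> A\<close> by auto
      then show ?case using perm_step(3)[of b m e a] M(3)[OF m \<open>b \<notin> A\<close>] step by simp
    qed
    then show ?thesis by (auto simp: eventually_sequentially)
  qed
  have "\<forall>\<^sub>F n in sequentially. \<forall>a\<in>A. \<forall>b\<in>-A. \<forall>e. perm e n b < perm e n a"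
    by (rule eventually_ball_finite) (use sep in auto)
  then obtain K where K: "\<And>a b e. a \<in> A \<Longrightarrow> b \<notin> A \<Longrightarrow> perm e K b < perm e K a"
    unfolding eventually_sequentially by (metis ComplI order_refl)
  have "{a. perm e K a \<le> card (-A)} = -A" for e
    by (rule perm_initial_segment[OF perm_bij]) (use K in auto)
  from this[of True] this[of False]
  have "{a. top_perm (st K) a \<le> card (-A)} = {a. bot_perm (st K) a \<le> card (-A)}"
    by (simp add: perm_def)
  then have "\<not> (1 \<le> card (-A) \<and> card (-A) < CARD('a))"
    using keane_n[of K] unfolding keane_data_def admissible_def by blast
  moreover have "A \<noteq> {}" using M(1) by blast
  then have "card (-A) < CARD('a)" by (intro psubset_card_mono) auto
  ultimately have "card (-A) = 0" by linarith
  then have "a \<in> A" by auto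
  then show ?thesis by (auto simp: A_def frequently_sequentially)
qed

section \<open>Blocks of the accelerated algorithm\<close>

lemma rv_name_image: "rv_name s ` {k<..m} = win ` {k..<m}"
proof -
  have "{k<..m} = Suc ` {k..<m}"
    unfolding image_Suc_atLeastLessThan by auto
  then show ?thesis by (simp add: image_image rv_name_def del: image_Suc_atLeastLessThan)
qed

text \<open>\<open>GREATEST\<close> is meaningful because every letter wins again, which bounds the
  admissible \<open>m\<close>. By maximality a block together with the one step after it has all
  letters as winners; this is the reason for the \<open>Suc\<close>.\<close>

lemma nseq_Suc_props:
  shows nseq_less_Suc: "nseq s k < nseq s (Suc k)"
    and nseq_round: "win ` {nseq s k..<Suc (nseq s (Suc k))} = UNIV"
proof -
  define P where "P m \<longleftrightarrow> nseq s k \<le> m \<and> card (win ` {nseq s k..<m}) \<le> CARD('a) - 1" for m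
  have G: "nseq s (Suc k) = (GREATEST m. P m)" by (simp add: P_def rv_name_image)
  obtain t where t: "\<And>a. t a \<ge> nseq s k" "\<And>a. win (t a) = a" using win_frequently by metis
  have bd: "m \<le> Max (range t)" if "P m" for m
  proof (rule ccontr)
    assume "\<not> m \<le> Max (range t)"
    then have "t a < m" for a by (meson Max_ge finite finite_imageI linorder_not_le order.trans rangeI)
    then have "a \<in> win ` {nseq s k..<m}" for a using t by (metis atLeastLessThan_iff image_eqI)
    then have "win ` {nseq s k..<m} = UNIV" by auto
    then show False using that card2 unfolding P_def by auto
  qed
  have P1: "P (Suc (nseq s k))" using card2 by (simp add: P_def)
  have "P (nseq s (Suc k))" unfolding G by (rule GreatestI_nat[where P=P, OF P1 bd])
  have le: "m \<le> nseq s (Suc k)" if "P m" for m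
    unfolding G by (rule Greatest_le_nat[where P=P, OF that bd])
  show lt: "nseq s k < nseq s (Suc k)" using le[OF P1] by simp
  have "\<not> P (Suc (nseq s (Suc k)))" using le by fastforce
  then have "CARD('a) \<le> card (win ` {nseq s k..<Suc (nseq s (Suc k))})"
    using lt by (auto simp: P_def)
  then show "win ` {nseq s k..<Suc (nseq s (Suc k))} = UNIV"
    by (intro card_seteq) auto
qed

lemma nseq_strict_mono: "strict_mono (nseq s)"
  using nseq_less_Suc by (simp add: strict_mono_Suc_iff del: nseq.simps)

lemma nseq_le: "k \<le> l \<Longrightarrow> nseq s k \<le> nseq s l"
  using nseq_strict_mono by (simp add: strict_mono_less_eq)

text \<open>The extra step that completes the alphabet belongs to the following block.\<close>

lemma two_blocks_round: "win ` {nseq s k..<nseq s (k + 2)} = UNIV"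
proof -
  have "{nseq s k..<Suc (nseq s (Suc k))} \<subseteq> {nseq s k..<nseq s (k + 2)}"
    using nseq_less_Suc[of "Suc k"] by (auto simp del: nseq.simps)
  then show ?thesis using nseq_round[of k] by blast
qed

end

section \<open>Rauzy--Veech matrices\<close>

lemma mnorm_nonneg: "0 \<le> mnorm A"
  unfolding mnorm_def by (intro sum_nonneg) auto

lemma entry_le_mnorm: "\<bar>A $ i $ j\<bar> \<le> mnorm A"
proof -
  have "\<bar>A $ i $ j\<bar> \<le> (\<Sum>j\<in>UNIV. \<bar>A $ i $ j\<bar>)" by (intro member_le_sum) auto
  also have "\<dots> \<le> mnorm A" unfolding mnorm_def
    by (intro member_le_sum[where f="\<lambda>i. \<Sum>j\<in>UNIV. \<bar>A $ i $ j\<bar>"] sum_nonneg) auto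
  finally show ?thesis .
qed

lemma mnorm_transpose: "mnorm (transpose A) = mnorm A"
  unfolding mnorm_def transpose_def by (simp, rule sum.swap)

lemma mnorm_mult: "mnorm (A ** B) \<le> mnorm A * mnorm B"
proof -
  have "mnorm (A ** B) \<le> (\<Sum>i\<in>UNIV. \<Sum>j\<in>UNIV. \<Sum>k\<in>UNIV. \<bar>A $ i $ k\<bar> * \<bar>B $ k $ j\<bar>)"
    unfolding mnorm_def matrix_matrix_mult_def
    by (auto intro!: sum_mono order.trans[OF sum_abs] simp: abs_mult)
  also have "\<dots> = (\<Sum>i\<in>UNIV. \<Sum>k\<in>UNIV. \<Sum>j\<in>UNIV. \<bar>A $ i $ k\<bar> * \<bar>B $ k $ j\<bar>)"
    by (intro sum.cong refl sum.swap)
  also have "\<dots> = (\<Sum>i\<in>UNIV. \<Sum>k\<in>UNIV. \<bar>A $ i $ k\<bar> * (\<Sum>j\<in>UNIV. \<bar>B $ k $ j\<bar>))"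
    by (simp add: sum_distrib_left)
  also have "\<dots> \<le> (\<Sum>i\<in>UNIV. \<Sum>k\<in>UNIV. \<bar>A $ i $ k\<bar> * mnorm B)"
    unfolding mnorm_def
    by (intro sum_mono mult_left_mono member_le_sum[where f="\<lambda>i. \<Sum>j\<in>UNIV. \<bar>B $ i $ j\<bar>"] sum_nonneg) auto
  also have "\<dots> = mnorm A * mnorm B"
    unfolding mnorm_def by (simp add: sum_distrib_right)
  finally show ?thesis .
qed

lemma norm_mult_vec_le: "norm (A *v (v::real^'a::finite)) \<le> mnorm A * norm v"
proof -
  have "norm (A *v v) \<le> (\<Sum>i\<in>UNIV. \<bar>(A *v v) $ i\<bar>)" by (rule norm_le_l1_cart)
  also have "\<dots> \<le> (\<Sum>i\<in>UNIV. \<Sum>j\<in>UNIV. \<bar>A $ i $ j\<bar> * norm v)"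
    unfolding matrix_vector_mult_def
    by (auto intro!: sum_mono order.trans[OF sum_abs] mult_left_mono component_le_norm_cart simp: abs_mult)
  also have "\<dots> = mnorm A * norm v" by (simp add: mnorm_def sum_distrib_right)
  finally show ?thesis .
qed

section \<open>Products of elementary matrices: entries, positivity, inverse\<close>

context keane_iem
begin

definition W :: "nat \<Rightarrow> nat \<Rightarrow> real^'a^'a" where
  "W n m = mprod (rv_V s) n m"

lemma W_refl: "m \<le> n \<Longrightarrow> W n m = mat 1"
  by (cases m) (auto simp: W_def)

lemma W_Suc: "n \<le> m \<Longrightarrow> W n (Suc m) = W n m ** rv_matrix (st m)"
  by (simp add: W_def rv_V_def)

lemma mult_rv_matrix_entry:
  "(A ** rv_matrix t) $ i $ j = A $ i $ j + (if j = rv_loser t then A $ i $ rv_winner t else 0)"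
proof -
  have "(A ** rv_matrix t) $ i $ j =
    (\<Sum>k\<in>UNIV. (if k = j then A $ i $ k else 0) + (if k = rv_winner t then (if j = rv_loser t then A $ i $ k else 0) else 0))"
    unfolding matrix_matrix_mult_def rv_matrix_def
    by (auto intro!: sum.cong simp: algebra_simps)
  then show ?thesis by (simp add: sum.distrib)
qed

lemma W_Suc_entry:
  "n \<le> m \<Longrightarrow> W n (Suc m) $ i $ j = W n m $ i $ j + (if j = los m then W n m $ i $ win m else 0)"
  by (simp add: W_Suc mult_rv_matrix_entry)

lemma W_mult:
  assumes "n \<le> m" "m \<le> q"
  shows "W n m ** W m q = W n q"
  using assms(2)
proof (induction q rule: dec_induct)
  case base
  then show ?case by (simp add: W_refl)
next
  case (step q)
  then show ?case using assms(1) by (simp add: W_Suc matrix_mul_assoc)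
qed

lemma W_nonneg: "0 \<le> W n m $ i $ j"
proof (cases "n \<le> m")
  case True
  then show ?thesis
    by (induction m arbitrary: i j rule: dec_induct) (auto simp: W_refl mat_def W_Suc_entry)
qed (auto simp: W_refl mat_def)

lemma W_mono:
  assumes "n \<le> m" "m \<le> q"
  shows "W n m $ i $ j \<le> W n q $ i $ j"
  using assms(2)
proof (induction q rule: dec_induct)
  case (step q)
  then show ?case using W_Suc_entry[of n q i j] assms(1) W_nonneg[of n q i "win q"] by auto
qed auto

lemma W_diag: "1 \<le> W n m $ i $ i"
proof (cases "n \<le> m")
  case True
  then show ?thesis using W_mono[of n n m i i] by (simp add: W_refl mat_def)
qed (simp add: W_refl mat_def)

text \<open>The winner's old length is its new length plus that of the loser, so the matrices carry
  lengths backwards.\<close>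

lemma lam_W: "n \<le> m \<Longrightarrow> lam n i = (\<Sum>j\<in>UNIV. W n m $ i $ j * lam m j)"
proof (induction m rule: dec_induct)
  case base
  then show ?case by (simp add: W_refl mat_def if_distrib[where f="\<lambda>x. x * _"] cong: if_cong)
next
  case (step m)
  have "(\<Sum>j\<in>UNIV. W n (Suc m) $ i $ j * lam (Suc m) j) =
    (\<Sum>j\<in>UNIV. W n m $ i $ j * lam m j - (if j = win m then W n m $ i $ win m * lam m (los m) else 0)
      + (if j = los m then W n m $ i $ win m * lam m (los m) else 0))"
    using step win_neq_los[of m] unfolding lam_Suc
    by (intro sum.cong) (auto simp: W_Suc_entry algebra_simps)
  also have "\<dots> = (\<Sum>j\<in>UNIV. W n m $ i $ j * lam m j)"
    by (simp add: sum.distrib sum_subtractf)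
  finally show ?case using step by simp
qed

text \<open>Let \<open>R\<close> be the set of columns with entry at least 1 in row
  \<open>i\<close>, and suppose that it stays constant. The first round supplies a winner outside
  \<open>R\<close>, after which no winner lies in \<open>R\<close>. But in the second round
  \<open>i\<close> wins, and \<open>i\<close> is in \<open>R\<close> by the diagonal entry.\<close>

lemma W_row_grows:
  assumes "n \<le> m" "m \<le> m1" "m1 \<le> m2"
    and round1: "win ` {m..<m1} = UNIV" and round2: "win ` {m1..<m2} = UNIV"
    and "{j. 1 \<le> W n m $ i $ j} \<noteq> UNIV"
  shows "{j. 1 \<le> W n m $ i $ j} \<subset> {j. 1 \<le> W n m2 $ i $ j}"
proof (rule ccontr)
  define R where "R t = {j. 1 \<le> W n t $ i $ j}" for t
  have mono: "R t \<subseteq> R u" if "n \<le> t" "t \<le> u" for t u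
    using W_mono[OF that, of i] by (auto simp: R_def intro: order_trans)
  assume "\<not> {j. 1 \<le> W n m $ i $ j} \<subset> {j. 1 \<le> W n m2 $ i $ j}"
  then have eq: "R m2 = R m" using mono[of m m2] assms by (auto simp: R_def)
  have const: "R t = R m" if "m \<le> t" "t \<le> m2" for t
    using mono[of m t] mono[of t m2] that assms(1) eq by auto
  \<comment> \<open>The loser's column receives the winner's column, which would enlarge
    \<open>R\<close> unless the loser is already in it.\<close>
  have closed: "los t \<in> R m" if "m \<le> t" "t < m2" "win t \<in> R m" for t
  proof -
    have "win t \<in> R t" using const[of t] that by auto
    then have "los t \<in> R (Suc t)"
      using W_Suc_entry[of n t i "los t"] that assms(1) W_nonneg[of n t i "los t"] by (auto simp: R_def)
    then show ?thesis using const[of "Suc t"] that by auto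
  qed
  obtain b where "b \<notin> R m" using assms(6) by (auto simp: R_def)
  moreover have "b \<in> win ` {m..<m1}" using round1 by simp
  ultimately obtain t0 where t0: "m \<le> t0" "t0 < m1" "win t0 \<notin> R m" by auto
  text \<open>A winner outside \<open>R\<close> can only be replaced by a winner in \<open>R\<close> which beats it.\<close>
  have out: "win t \<notin> R m" if "t0 \<le> t" "t < m2" for t
    using that
  proof (induction t rule: dec_induct)
    case base
    then show ?case using t0 by simp
  next
    case (step t)
    then have "win t \<notin> R m" by simp
    then show ?case using win_next[of t] closed[of "Suc t"] step t0 by auto
  qed
  have "i \<in> R m" using W_diag by (simp add: R_def)
  moreover have "i \<in> win ` {m1..<m2}" using round2 by simp
  ultimately obtain t1 where "m1 \<le> t1" "t1 < m2" "win t1 \<in> R m" by auto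
  then show False using out[of t1] t0 by simp
qed

definition Q :: "nat \<Rightarrow> nat \<Rightarrow> real^'a^'a" where "Q k l = W (nseq s k) (nseq s l)"

lemma Zmat_eq: "Zmat s (Suc k) = Q k (Suc k)"
  by (simp add: Zmat_def Q_def W_def del: nseq.simps)

lemma Qmat_eq: "k \<le> l \<Longrightarrow> Qmat s k l = Q k l"
proof (induction l rule: dec_induct)
  case base
  then show ?case by (cases k) (auto simp: Qmat_def Q_def W_refl)
next
  case (step l)
  then have "Qmat s k (Suc l) = Q k l ** Q l (Suc l)" by (simp add: Qmat_def Zmat_eq)
  then show ?case unfolding Q_def using step W_mult nseq_le by (metis le_SucI order_refl)
qed

lemma Q_refl: "Q k k = mat 1" by (simp add: Q_def W_refl)

lemma Q_mult: "k \<le> l \<Longrightarrow> l \<le> m \<Longrightarrow> Q k l ** Q l m = Q k m"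
  unfolding Q_def by (intro W_mult nseq_le)

lemma Q_nonneg: "0 \<le> Q k l $ i $ j" by (simp add: Q_def W_nonneg)

lemma Q_diag: "1 \<le> Q k l $ i $ i" by (simp add: Q_def W_diag)

lemma mnorm_Q: "mnorm (Q k l) = (\<Sum>i\<in>UNIV. \<Sum>j\<in>UNIV. Q k l $ i $ j)"
  by (simp add: mnorm_def Q_nonneg)

lemma mnorm_Q_ge: "real CARD('a) \<le> mnorm (Q k l)"
proof -
  have "(\<Sum>i\<in>(UNIV::'a set). 1) \<le> (\<Sum>i\<in>UNIV. \<Sum>j\<in>UNIV. Q k l $ i $ j)"
  proof (intro sum_mono)
    fix i :: 'a
    have "Q k l $ i $ i \<le> (\<Sum>j\<in>UNIV. Q k l $ i $ j)" by (intro member_le_sum) (auto simp: Q_nonneg)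
    then show "1 \<le> (\<Sum>j\<in>UNIV. Q k l $ i $ j)" using Q_diag[of k l i] by linarith
  qed
  then show ?thesis by (simp add: mnorm_Q)
qed

lemma mnorm_Q_ge_2: "2 \<le> mnorm (Q k l)"
  using mnorm_Q_ge[of k l] card2 by linarith

lemma mnorm_Q_mono: "k \<le> l \<Longrightarrow> l \<le> m \<Longrightarrow> mnorm (Q k l) \<le> mnorm (Q k m)"
  unfolding mnorm_Q unfolding Q_def by (intro sum_mono W_mono nseq_le)

lemma mnorm_Q_antimono:
  assumes "k \<le> l" "l \<le> m"
  shows "mnorm (Q l m) \<le> mnorm (Q k m)"
  unfolding mnorm_Q
proof (intro sum_mono)
  fix i j
  have "1 * Q l m $ i $ j \<le> Q k l $ i $ i * Q l m $ i $ j"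
    by (intro mult_right_mono Q_diag Q_nonneg)
  also have "\<dots> \<le> (\<Sum>t\<in>UNIV. Q k l $ i $ t * Q l m $ t $ j)"
    by (intro member_le_sum[where f="\<lambda>t. Q k l $ i $ t * Q l m $ t $ j"]) (auto simp: Q_nonneg)
  also have "\<dots> = Q k m $ i $ j"
    using Q_mult[OF assms] by (simp add: matrix_matrix_mult_def vec_eq_iff)
  finally show "Q l m $ i $ j \<le> Q k m $ i $ j" by simp
qed

text \<open>Four blocks contain two consecutive rounds and so enlarge the support of row
  \<open>i\<close> until it is full. It starts with the diagonal entry, so
  \<open>4 * CARD('a)\<close> blocks suffice.\<close>

lemma Q_positive:
  assumes "k + 4 * CARD('a) \<le> l"
  shows "1 \<le> Q k l $ i $ j"
proof -
  define R where "R t = {j. 1 \<le> W (nseq s k) (nseq s t) $ i $ j}" for t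
  have grow: "min CARD('a) (Suc m) \<le> card (R (k + 4 * m))" for m
  proof (induction m)
    case 0
    have "i \<in> R k" using W_diag by (simp add: R_def)
    then have "card {i} \<le> card (R k)" by (intro card_mono) auto
    then show ?case by simp
  next
    case (Suc m)
    show ?case
    proof (cases "R (k + 4 * m) = UNIV")
      case True
      have "R (k + 4 * m) \<subseteq> R (k + 4 * Suc m)"
        using W_mono[of "nseq s k" "nseq s (k + 4 * m)" "nseq s (k + 4 * Suc m)" i] nseq_le
        by (auto simp: R_def intro: order_trans simp del: nseq.simps)
      then have "R (k + 4 * Suc m) = UNIV" using True by auto
      then show ?thesis by simp
    next
      case False
      have "R (k + 4 * m) \<subset> R (k + 4 * Suc m)"
        using W_row_grows[of "nseq s k" "nseq s (k + 4 * m)" "nseq s (k + 4 * m + 2)" "nseq s (k + 4 * m + 2 + 2)" i]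
          two_blocks_round[of "k + 4 * m"] two_blocks_round[of "k + 4 * m + 2"] nseq_le False
        by (simp add: R_def add_ac numeral_eq_Suc del: nseq.simps)
      then have "card (R (k + 4 * m)) < card (R (k + 4 * Suc m))" by (intro psubset_card_mono) auto
      then show ?thesis using Suc by linarith
    qed
  qed
  have "CARD('a) \<le> card (R (k + 4 * CARD('a)))" using grow[of "CARD('a)"] by simp
  then have "R (k + 4 * CARD('a)) = UNIV" by (intro card_seteq) auto
  then have "1 \<le> Q k (k + 4 * CARD('a)) $ i $ j" by (auto simp: R_def Q_def)
  also have "\<dots> \<le> Q k l $ i $ j" unfolding Q_def using assms by (intro W_mono nseq_le) auto
  finally show ?thesis .
qed

text \<open>Each step adds the winner's column, whose diagonal entry is at least 1. This bounds the
  number of elementary steps in a block by the norm of its matrix.\<close>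

lemma sum_W_ge:
  assumes "n \<le> m"
  shows "real (m - n) \<le> mnorm (W n m)"
  using assms
proof (induction m rule: dec_induct)
  case base
  then show ?case using mnorm_nonneg by simp
next
  case (step m)
  have nn: "mnorm (W n q) = (\<Sum>i\<in>UNIV. \<Sum>j\<in>UNIV. W n q $ i $ j)" for q
    by (simp add: mnorm_def W_nonneg)
  have "mnorm (W n (Suc m)) = (\<Sum>i\<in>UNIV. \<Sum>j\<in>UNIV. W n m $ i $ j + (if j = los m then W n m $ i $ win m else 0))"
    unfolding nn using step by (intro sum.cong) (auto simp: W_Suc_entry)
  also have "\<dots> = mnorm (W n m) + (\<Sum>i\<in>UNIV. W n m $ i $ win m)"
    by (simp add: sum.distrib nn)
  finally have "mnorm (W n (Suc m)) = mnorm (W n m) + (\<Sum>i\<in>UNIV. W n m $ i $ win m)" .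
  moreover have "W n m $ win m $ win m \<le> (\<Sum>i\<in>UNIV. W n m $ i $ win m)"
    by (intro member_le_sum[where f="\<lambda>i. W n m $ i $ win m"]) (auto simp: W_nonneg)
  ultimately show ?case using W_diag[of n m "win m"] step by simp
qed

lemma mnorm_W_mono:
  assumes "n \<le> m" "m \<le> q"
  shows "mnorm (W n m) \<le> mnorm (W n q)"
  using W_mono[OF assms] by (simp add: mnorm_def W_nonneg sum_mono)

lemma det_W: "det (W n m) = 1"
proof (cases "n \<le> m")
  case True
  then show ?thesis
  proof (induction m rule: dec_induct)
    case base
    then show ?case by (simp add: W_refl)
  next
    case (step m)
    have "rv_matrix (st m) = ((\<chi> k. if k = win m then row (win m) (mat 1) + 1 *s row (los m) (mat 1) else row k (mat 1)) :: real^'a^'a)"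
      using win_neq_los[of m] by (auto simp: rv_matrix_def vec_eq_iff row_def mat_def)
    then have "det (rv_matrix (st m)) = 1"
      using det_row_operation[OF win_neq_los(1)[of m], where c = 1 and A = "mat 1 :: real^'a^'a"] by simp
    then show ?case using step by (simp add: W_Suc det_mul)
  qed
qed (simp add: W_refl)

text \<open>Cramer's rule with determinant 1: the entries of \<open>v\<close> are determinants with
  one column taken from \<open>u\<close>. This is the cost of pulling a vector back to level
  0.\<close>

lemma Q_inverse_bound:
  assumes "transpose (Q k l) *v v = u"
  shows "norm v \<le> real CARD('a) * fact CARD('a) * mnorm (Q k l) ^ CARD('a) * norm u"
proof -
  define A where "A = transpose (Q k l)"
  define N where "N = mnorm (Q k l)"
  have N1: "1 \<le> N" using mnorm_Q_ge_2[of k l] by (simp add: N_def)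
  have d: "det A = 1" by (simp add: A_def det_transpose Q_def det_W)
  have eA: "\<bar>A $ i $ j\<bar> \<le> N" for i j
    using entry_le_mnorm[of A i j] by (simp add: A_def N_def mnorm_transpose)
  have "v = (\<chi> k. det (\<chi> i j. if j = k then u $ i else A $ i $ j) / det A)"
    using cramer[of A v u] assms d by (simp add: A_def)
  then have v: "v $ t = det (\<chi> i j. if j = t then u $ i else A $ i $ j)" for t
    by (simp add: vec_eq_iff d)
  have comp: "\<bar>v $ t\<bar> \<le> fact CARD('a) * (N ^ CARD('a) * norm u)" for t
  proof -
    have "\<bar>v $ t\<bar> \<le> (\<Sum>p | p permutes UNIV. \<bar>of_int (sign p) * (\<Prod>i\<in>UNIV. if p i = t then u $ i else A $ i $ p i)\<bar>)"
      unfolding v det_def by (simp add: sum_abs)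
    also have "\<dots> \<le> (\<Sum>p | p permutes (UNIV::'a set). N ^ CARD('a) * norm u)"
    proof (intro sum_mono)
      fix p assume "p \<in> {p. p permutes (UNIV::'a set)}"
      then have p: "bij p" by (simp add: permutes_bij)
      have "\<bar>of_int (sign p) * (\<Prod>i\<in>UNIV. if p i = t then u $ i else A $ i $ p i)\<bar>
        = (\<Prod>i\<in>UNIV. if p i = t then \<bar>u $ i\<bar> else \<bar>A $ i $ p i\<bar>)"
        by (auto simp: abs_mult sign_def abs_prod intro!: prod.cong)
      also have "\<dots> \<le> (\<Prod>i\<in>UNIV. N * (if p i = t then norm u else 1))"
      proof (intro prod_mono conjI)
        fix i
        \<comment> \<open>The factor coming from \<open>u\<close> is padded with \<open>N\<close> as
          well, so that every factor of the product carries one.\<close>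
        have "1 * \<bar>u $ i\<bar> \<le> N * norm u"
          using N1 component_le_norm_cart[of u i] by (intro mult_mono) auto
        then show "(if p i = t then \<bar>u $ i\<bar> else \<bar>A $ i $ p i\<bar>) \<le> N * (if p i = t then norm u else 1)"
          using eA by auto
      qed auto
      also have "\<dots> = N ^ CARD('a) * (\<Prod>i\<in>UNIV. if p i = t then norm u else 1)"
        by (simp add: prod.distrib)
      also have "(\<Prod>i\<in>UNIV. if p i = t then norm u else 1) = (\<Prod>i\<in>UNIV. if i = inv p t then norm u else 1)"
        using p by (intro prod.cong) (auto simp: bij_def inj_def surj_f_inv_f)
      also have "\<dots> = norm u" by simp
      finally show "\<bar>of_int (sign p) * (\<Prod>i\<in>UNIV. if p i = t then u $ i else A $ i $ p i)\<bar> \<le> N ^ CARD('a) * norm u" .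
    qed
    also have "\<dots> = fact CARD('a) * (N ^ CARD('a) * norm u)"
      by (simp add: card_permutations)
    finally show ?thesis .
  qed
  have "norm v \<le> (\<Sum>t\<in>UNIV. \<bar>v $ t\<bar>)" by (rule norm_le_l1_cart)
  also have "\<dots> \<le> (\<Sum>t\<in>(UNIV::'a set). fact CARD('a) * (N ^ CARD('a) * norm u))"
    by (intro sum_mono comp)
  finally show ?thesis by (simp add: N_def mult_ac)
qed

lemma Q_solve: obtains v where "transpose (Q k l) *v v = u"
proof -
  have "det (transpose (Q k l)) \<noteq> 0" by (simp add: det_transpose Q_def det_W)
  then have "transpose (Q k l) *v (\<chi> t. det (\<chi> i j. if j = t then u $ i else transpose (Q k l) $ i $ j) / det (transpose (Q k l))) = u"
    using cramer by blast
  then show ?thesis using that by blast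
qed

end

section \<open>Growth estimates under the Roth type conditions\<close>

text \<open>Weighted geometric mean of the two bounds, after division by a common constant and by
  \<open>z\<close>.\<close>

lemma powr_interpolate:
  fixes x z N M :: real
  assumes "1 \<le> N" "1 \<le> M" "0 \<le> z" "0 \<le> t" "t \<le> 1" "0 < C1" "0 < C2"
    and 1: "x \<le> C1 * N powr a1 * M powr b1 * z"
    and 2: "x \<le> C2 * N powr a2 * M powr b2 * z"
  shows "x \<le> max C1 C2 * N powr ((1 - t) * a1 + t * a2) * M powr ((1 - t) * b1 + t * b2) * z"
proof (cases "x \<le> 0")
  case True
  have "0 \<le> max C1 C2 * N powr ((1 - t) * a1 + t * a2) * M powr ((1 - t) * b1 + t * b2) * z"
    using assms by (intro mult_nonneg_nonneg) auto
  then show ?thesis using True by linarith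
next
  case False
  define C where "C = max C1 C2"
  have C: "0 < C" "C1 \<le> C" "C2 \<le> C" using assms by (auto simp: C_def)
  have z: "0 < z" using False 1 assms(3) by (cases "z = 0") auto
  define y where "y = x / (C * z)"
  have y: "0 < y" using False z C by (simp add: y_def)
  have "x \<le> C * N powr a1 * M powr b1 * z"
    by (rule order.trans[OF 1]) (use C z in \<open>intro mult_right_mono; simp\<close>)
  then have y1: "y \<le> N powr a1 * M powr b1" using z C by (simp add: y_def field_simps)
  have "x \<le> C * N powr a2 * M powr b2 * z"
    by (rule order.trans[OF 2]) (use C z in \<open>intro mult_right_mono; simp\<close>)
  then have y2: "y \<le> N powr a2 * M powr b2" using z C by (simp add: y_def field_simps)
  have "y = y powr (1 - t) * y powr t" using y by (simp add: powr_add[symmetric])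
  also have "\<dots> \<le> (N powr a1 * M powr b1) powr (1 - t) * (N powr a2 * M powr b2) powr t"
    using y y1 y2 assms by (intro mult_mono powr_mono2) auto
  also have "\<dots> = N powr ((1 - t) * a1 + t * a2) * M powr ((1 - t) * b1 + t * b2)"
    by (simp add: powr_mult powr_powr powr_add mult_ac)
  finally show ?thesis using z C by (simp add: y_def C_def[symmetric] field_simps)
qed

text \<open>\<open>N\<close> at least doubles every \<open>m\<close> indices, so it dominates
  \<open>2 powr (k / m - 1)\<close>; the \<open>- 1\<close> pays for rounding \<open>k / m\<close>
  down.\<close>

lemma summable_powr_geometric:
  fixes N :: "nat \<Rightarrow> real" and m :: nat
  assumes "0 < m" "0 < \<eta>" "\<And>k. 1 \<le> N k" "\<And>k. 2 * N k \<le> N (k + m)"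
  shows "summable (\<lambda>k. N k powr - \<eta>)"
proof -
  have low: "2 ^ j \<le> N (r + j * m)" for r j
  proof (induction j)
    case 0
    then show ?case using assms(3) by simp
  next
    case (Suc j)
    then have "2 ^ Suc j \<le> 2 * N (r + j * m)" by simp
    also have "\<dots> \<le> N (r + j * m + m)" by (rule assms(4))
    finally show ?case by (simp add: algebra_simps)
  qed
  have ge: "2 powr (real k / real m - 1) \<le> N k" for k
  proof -
    have "k = k mod m + k div m * m" by simp
    then have "real k = real (k mod m) + real (k div m) * real m"
      by (metis of_nat_add of_nat_mult)
    moreover have "real (k mod m) \<le> real m" using assms(1) by (simp add: less_imp_le)
    ultimately have "real k \<le> (real (k div m) + 1) * real m" by (simp add: algebra_simps)
    then have "real k / real m - 1 \<le> real (k div m)"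
      using assms(1) by (simp add: field_simps)
    then have "2 powr (real k / real m - 1) \<le> 2 powr real (k div m)" by (intro powr_mono) auto
    also have "\<dots> = 2 ^ (k div m)" by (simp add: powr_realpow)
    also have "\<dots> \<le> N k" using low[of "k div m" "k mod m"] by simp
    finally show ?thesis .
  qed
  define q :: real where "q = 2 powr (- \<eta> / real m)"
  have q: "0 < q" "q < 1" using assms by (auto simp: q_def powr_less_one)
  have "summable (\<lambda>k. 2 powr \<eta> * q ^ k)" using q by (intro summable_mult summable_geometric) auto
  moreover have "norm (N k powr - \<eta>) \<le> 2 powr \<eta> * q ^ k" for k
  proof -
    have "N k powr - \<eta> \<le> (2 powr (real k / real m - 1)) powr - \<eta>"
      using ge[of k] assms(2) by (intro powr_mono2') auto
    also have "\<dots> = 2 powr (\<eta> + (- \<eta> / real m) * real k)"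
      using assms(1) by (simp add: powr_powr field_simps)
    also have "\<dots> = 2 powr \<eta> * q ^ k"
    proof -
      have "q ^ k = q powr real k" using q by (simp add: powr_realpow)
      also have "\<dots> = 2 powr ((- \<eta> / real m) * real k)" by (simp add: q_def powr_powr)
      finally show ?thesis by (simp only: powr_add)
    qed
    finally show ?thesis by simp
  qed
  ultimately show ?thesis by (rule summable_comparison_test'[where N=0])
qed

locale roth_iem = keane_iem +
  assumes ra: "roth_a s" and rb: "roth_b s" and rc: "roth_c s"
begin

definition N :: "nat \<Rightarrow> real" where "N k = mnorm (Q 0 k)"

lemma N_ge: "1 \<le> N k" "2 \<le> N k" "0 < N k"
  using mnorm_Q_ge_2[of 0 k] by (auto simp: N_def)

lemma N_mono: "k \<le> l \<Longrightarrow> N k \<le> N l"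
  unfolding N_def by (intro mnorm_Q_mono) auto

lemma N_powr_mono: "k \<le> l \<Longrightarrow> 0 \<le> a \<Longrightarrow> N k powr a \<le> N l powr a"
  using N_mono N_ge by (intro powr_mono2) (auto simp: less_imp_le)

lemma N_powr_ge1: "0 \<le> a \<Longrightarrow> 1 \<le> N k powr a"
  using N_ge by (simp add: ge_one_powr_ge_zero)

section \<open>Consequences of condition (a): growth, summability, balanced towers\<close>

lemma Z_bound:
  assumes "0 < \<epsilon>"
  obtains C where "0 < C" "\<And>k. mnorm (Q k (Suc k)) \<le> C * N k powr \<epsilon>"
proof -
  obtain C where C: "\<And>k. mnorm (Q k (Suc k)) \<le> C * N k powr \<epsilon>"
    using ra assms unfolding roth_a_def by (auto simp: Zmat_eq Qmat_eq N_def)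
  have "mnorm (Q k (Suc k)) \<le> max C 1 * N k powr \<epsilon>" for k
    by (rule order.trans[OF C]) (intro mult_right_mono; simp)
  then show ?thesis by (intro that[of "max C 1"]) auto
qed

lemma N_Suc_le: "N (Suc k) \<le> N k * mnorm (Q k (Suc k))"
  using mnorm_mult[of "Q 0 k" "Q k (Suc k)"] Q_mult[of 0 k "Suc k"] by (simp add: N_def)

text \<open>Condition (a) makes one block as small as any prescribed power of \<open>N\<close>; a
  fixed number of iterations keeps the loss arbitrarily small.\<close>

lemma N_add_bound:
  assumes "0 < \<epsilon>"
  shows "\<exists>C>0. \<forall>k. N (k + m) \<le> C * N k powr (1 + \<epsilon>)"
  using assms
proof (induction m arbitrary: \<epsilon>)
  case 0
  have "N k \<le> 1 * N k powr (1 + \<epsilon>)" for k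
    using powr_mono[of 1 "1 + \<epsilon>" "N k"] 0 N_ge[of k] by simp
  then show ?case by (intro exI[of _ 1]) auto
next
  case (Suc m)
  \<comment> \<open>Chosen so that
    \<open>(1 + e) * (1 + e) \<le> 1 + 3 * e \<le> 1 + \<epsilon>\<close>; the first inequality
    needs \<open>e \<le> 1\<close>.\<close>
  define e where "e = min 1 (\<epsilon> / 3)"
  have e: "0 < e" "e \<le> 1" "3 * e \<le> \<epsilon>" using Suc.prems by (auto simp: e_def)
  obtain C where C: "0 < C" "\<And>k. N (k + m) \<le> C * N k powr (1 + e)" using Suc.IH[OF e(1)] by blast
  obtain D where D: "0 < D" "\<And>k. mnorm (Q k (Suc k)) \<le> D * N k powr e" using Z_bound[OF e(1)] by blast
  have "N (k + Suc m) \<le> (D * C powr (1 + e)) * N k powr (1 + \<epsilon>)" for k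
  proof -
    have "N (k + Suc m) \<le> N (k + m) * (D * N (k + m) powr e)"
      using N_Suc_le[of "k + m"] D(2)[of "k + m"] N_ge[of "k + m"]
      by (auto intro: order.trans mult_left_mono)
    also have "\<dots> = D * N (k + m) powr (1 + e)"
      using N_ge[of "k + m"] by (simp add: powr_add)
    also have "\<dots> \<le> D * (C * N k powr (1 + e)) powr (1 + e)"
      using C(2)[of k] D(1) e N_ge[of "k + m"] by (intro mult_left_mono powr_mono2) auto
    also have "\<dots> = (D * C powr (1 + e)) * N k powr ((1 + e) * (1 + e))"
      using C(1) by (simp add: powr_mult powr_powr)
    also have "\<dots> \<le> (D * C powr (1 + e)) * N k powr (1 + \<epsilon>)"
    proof (intro mult_left_mono powr_mono)
      have "e * e \<le> e" using e by (simp add: mult_left_le)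
      then show "(1 + e) * (1 + e) \<le> 1 + \<epsilon>" using e(3) by (simp add: algebra_simps)
    qed (use D(1) N_ge in auto)
    finally show ?thesis .
  qed
  then show ?case using D(1) C(1) by (intro exI[of _ "D * C powr (1 + e)"]) auto
qed

text \<open>The height of the Rokhlin tower over piece \<open>j\<close> of level \<open>k\<close>,
  that is, the return time of this piece to the interval of level \<open>k\<close>.\<close>

definition colsum :: "nat \<Rightarrow> 'a \<Rightarrow> real" where "colsum k j = (\<Sum>i\<in>UNIV. Q 0 k $ i $ j)"

lemma Q_0_entry: "k \<le> l \<Longrightarrow> Q 0 l $ i $ j = (\<Sum>t\<in>UNIV. Q 0 k $ i $ t * Q k l $ t $ j)"
  using Q_mult[of 0 k l] by (simp add: matrix_matrix_mult_def vec_eq_iff)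

lemma colsum_mult: "k \<le> l \<Longrightarrow> colsum l j = (\<Sum>t\<in>UNIV. colsum k t * Q k l $ t $ j)"
  unfolding colsum_def
  by (simp add: Q_0_entry[of k l] sum_distrib_right) (rule sum.swap)

lemma N_eq_colsum: "N k = (\<Sum>j\<in>UNIV. colsum k j)"
  unfolding N_def mnorm_Q colsum_def by (rule sum.swap)

lemma colsum_ge1: "1 \<le> colsum k j"
proof -
  have "Q 0 k $ j $ j \<le> colsum k j" unfolding colsum_def
    by (intro member_le_sum[where f="\<lambda>i. Q 0 k $ i $ j"]) (auto simp: Q_nonneg)
  then show ?thesis using Q_diag[of 0 k j] by linarith
qed

text \<open>After a positive block every new tower passes at least once through each old
  one.\<close>

lemma colsum_positive_block: "N k \<le> colsum (k + 4 * CARD('a)) j"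
proof -
  have "N k = (\<Sum>t\<in>UNIV. colsum k t * 1)" by (simp add: N_eq_colsum)
  also have "\<dots> \<le> (\<Sum>t\<in>UNIV. colsum k t * Q k (k + 4 * CARD('a)) $ t $ j)"
    by (intro sum_mono mult_left_mono Q_positive) (auto intro: order.trans[OF _ colsum_ge1])
  also have "\<dots> = colsum (k + 4 * CARD('a)) j" by (simp add: colsum_mult[of k "k + 4 * CARD('a)"])
  finally show ?thesis .
qed

lemma N_double: "2 * N k \<le> N (k + 4 * CARD('a))"
proof -
  have "2 * N k \<le> real CARD('a) * N k" using card2 N_ge[of k] by (intro mult_right_mono) auto
  also have "\<dots> = (\<Sum>j\<in>(UNIV::'a set). N k)" by simp
  also have "\<dots> \<le> N (k + 4 * CARD('a))"
    unfolding N_eq_colsum[of "k + 4 * CARD('a)"] by (intro sum_mono colsum_positive_block)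
  finally show ?thesis .
qed

lemma summable_N: "0 < \<eta> \<Longrightarrow> summable (\<lambda>k. N k powr - \<eta>)"
  by (rule summable_powr_geometric[where m="4 * CARD('a)"]) (use N_double N_ge in auto)

text \<open>By a positive block every height at level \<open>k\<close> is at least
  \<open>N (k - m)\<close>, and (a) bounds \<open>N k\<close> by a constant times the power
  \<open>1 + \<epsilon>\<close> of that; then
  \<open>(1 + \<epsilon>) * (1 - \<epsilon>) \<le> 1\<close> concludes. The levels below
  \<open>m\<close> are absorbed by the constant \<open>N m\<close>.\<close>

lemma colsum_lower:
  assumes "0 < \<epsilon>" "\<epsilon> < 1"
  obtains C where "0 < C" "\<And>k j. N k powr (1 - \<epsilon>) \<le> C * colsum k j"
proof -
  define m where "m = 4 * CARD('a)"
  obtain C where C: "0 < C" "\<And>k. N (k + m) \<le> C * N k powr (1 + \<epsilon>)" using N_add_bound[OF assms(1)] by blast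
  define D where "D = max (C powr (1 - \<epsilon>)) (N m)"
  have D: "0 < D" "C powr (1 - \<epsilon>) \<le> D" "N m \<le> D" using C(1) N_ge[of m] by (auto simp: D_def less_max_iff_disj)
  have "N k powr (1 - \<epsilon>) \<le> D * colsum k j" for k j
  proof (cases "k \<ge> m")
    case True
    then obtain i where i: "k = i + m" by (metis add.commute le_Suc_ex)
    have "N k powr (1 - \<epsilon>) \<le> (C * N i powr (1 + \<epsilon>)) powr (1 - \<epsilon>)"
      using C(2)[of i] N_ge[of k] assms unfolding i by (intro powr_mono2) auto
    also have "\<dots> = C powr (1 - \<epsilon>) * N i powr ((1 + \<epsilon>) * (1 - \<epsilon>))"
      using C(1) by (simp add: powr_mult powr_powr)
    also have "\<dots> \<le> D * N i powr 1"
      using D assms N_ge[of i] by (intro mult_mono powr_mono) (auto simp: algebra_simps)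
    also have "\<dots> \<le> D * colsum k j"
      using colsum_positive_block[of i j] D(1) N_ge[of i] by (auto simp: i m_def)
    finally show ?thesis .
  next
    case False
    have "N k powr (1 - \<epsilon>) \<le> N k powr 1" using assms N_ge by (intro powr_mono) auto
    also have "\<dots> \<le> N m" using N_mono[of k m] N_ge[of k] False by simp
    also have "\<dots> \<le> D * 1" using D by simp
    also have "\<dots> \<le> D * colsum k j" using D(1) colsum_ge1 by (intro mult_left_mono) auto
    finally show ?thesis .
  qed
  then show ?thesis using that[of D] D by blast
qed

text \<open>The towers over the pieces of level \<open>k\<close> fill the whole interval, so height
  times length is at most the total length, and no height is much smaller than
  \<open>N k\<close>.\<close>

lemma lam_bound:
  assumes "0 < \<epsilon>" "\<epsilon> < 1"
  obtains C where "0 < C" "\<And>k j. lam (nseq s k) j \<le> C * N k powr (\<epsilon> - 1)"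
proof -
  obtain C where C: "0 < C" "\<And>k j. N k powr (1 - \<epsilon>) \<le> C * colsum k j" using colsum_lower[OF assms] by blast
  define L where "L = (\<Sum>i\<in>UNIV. lam 0 i)"
  have L: "0 < L" unfolding L_def using lam_pos[of 0] by (intro sum_pos) auto
  have "lam (nseq s k) j \<le> (C * L) * N k powr (\<epsilon> - 1)" for k j
  proof -
    have "lam 0 i = (\<Sum>t\<in>UNIV. Q 0 k $ i $ t * lam (nseq s k) t)" for i
      using lam_W[of 0 "nseq s k" i] by (simp add: Q_def)
    then have "L = (\<Sum>t\<in>UNIV. colsum k t * lam (nseq s k) t)"
      unfolding L_def colsum_def by (simp add: sum_distrib_right) (rule sum.swap)
    also have "\<dots> \<ge> colsum k j * lam (nseq s k) j"
      by (intro member_le_sum[where f="\<lambda>t. colsum k t * lam (nseq s k) t"] mult_nonneg_nonneg)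
        (auto intro: less_imp_le[OF lam_pos] order.trans[OF _ colsum_ge1])
    finally have "C * colsum k j * lam (nseq s k) j \<le> C * L" using C(1) by (simp add: mult.assoc)
    moreover have "N k powr (1 - \<epsilon>) * lam (nseq s k) j \<le> C * colsum k j * lam (nseq s k) j"
      by (intro mult_right_mono C less_imp_le[OF lam_pos])
    ultimately have "N k powr (\<epsilon> - 1) * (N k powr (1 - \<epsilon>) * lam (nseq s k) j) \<le> N k powr (\<epsilon> - 1) * (C * L)"
      by (intro mult_left_mono) auto
    moreover have "N k powr (\<epsilon> - 1) * N k powr (1 - \<epsilon>) = 1"
      using N_ge[of k] by (simp add: powr_add[symmetric])
    ultimately show ?thesis by (simp add: mult.assoc[symmetric]) (simp add: mult_ac)
  qed
  then show ?thesis using that[of "C * L"] C L by simp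
qed

text \<open>\<open>N l\<close> is the sum of the entries of \<open>Q k l\<close> weighted with the
  heights at level \<open>k\<close>, none of which is much smaller than \<open>N k\<close>.\<close>

lemma Q_bound:
  assumes "0 < \<epsilon>" "\<epsilon> < 1"
  obtains C where "0 < C" "\<And>k l. k \<le> l \<Longrightarrow> mnorm (Q k l) \<le> C * N l * N k powr (\<epsilon> - 1)"
proof -
  obtain C where C: "0 < C" "\<And>k j. N k powr (1 - \<epsilon>) \<le> C * colsum k j" using colsum_lower[OF assms] by blast
  have "mnorm (Q k l) \<le> C * N l * N k powr (\<epsilon> - 1)" if "k \<le> l" for k l
  proof -
    have "N k powr (1 - \<epsilon>) * mnorm (Q k l) = (\<Sum>t\<in>UNIV. N k powr (1 - \<epsilon>) * (\<Sum>j\<in>UNIV. Q k l $ t $ j))"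
      by (simp add: mnorm_Q sum_distrib_left)
    also have "\<dots> \<le> (\<Sum>t\<in>UNIV. C * colsum k t * (\<Sum>j\<in>UNIV. Q k l $ t $ j))"
      by (intro sum_mono mult_right_mono C sum_nonneg Q_nonneg)
    also have "\<dots> = C * (\<Sum>t\<in>UNIV. \<Sum>j\<in>UNIV. colsum k t * Q k l $ t $ j)"
      by (simp add: sum_distrib_left mult.assoc)
    also have "(\<Sum>t\<in>UNIV. \<Sum>j\<in>UNIV. colsum k t * Q k l $ t $ j) = N l"
      unfolding N_eq_colsum[of l] colsum_mult[OF that] by (rule sum.swap)
    finally have "N k powr (\<epsilon> - 1) * (N k powr (1 - \<epsilon>) * mnorm (Q k l)) \<le> N k powr (\<epsilon> - 1) * (C * N l)"
      by (intro mult_left_mono) auto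
    moreover have "N k powr (\<epsilon> - 1) * N k powr (1 - \<epsilon>) = 1"
      using N_ge[of k] by (simp add: powr_add[symmetric])
    ultimately show ?thesis by (simp add: mult.assoc[symmetric]) (simp add: mult_ac)
  qed
  then show ?thesis using that[of C] C by simp
qed

section \<open>The cocycle and its action on zero-mean vectors\<close>

definition S :: "nat \<Rightarrow> nat \<Rightarrow> real^'a \<Rightarrow> real^'a" where
  "S k l v = transpose (Q k l) *v v"

lemma Smap_eq: "k \<le> l \<Longrightarrow> Smap s k l v = S k l v"
  by (simp add: Smap_def S_def Qmat_eq)

lemma S_linear: "linear (S k l)"
  unfolding S_def by (rule matrix_vector_mul_linear)

lemma S_refl: "S k k v = v"
  by (simp add: S_def Q_refl transpose_mat)

lemma S_comp: "k \<le> l \<Longrightarrow> l \<le> m \<Longrightarrow> S l m (S k l v) = S k m v"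
  unfolding S_def matrix_vector_mul_assoc matrix_transpose_mul[symmetric] by (simp only: Q_mult)

lemma S_bound: "norm (S k l v) \<le> mnorm (Q k l) * norm v"
  unfolding S_def using norm_mult_vec_le[of "transpose (Q k l)" v] by (simp add: mnorm_transpose)

lemma S_surj: obtains u where "S k l u = v"
  using Q_solve[of k l v] by (auto simp: S_def)

lemma S_inverse_bound:
  obtains C where "0 < C" "\<And>k v. norm v \<le> C * N k powr CARD('a) * norm (S 0 k v)"
proof -
  have "norm v \<le> (real CARD('a) * fact CARD('a)) * N k powr CARD('a) * norm (S 0 k v)" for k v
    using Q_inverse_bound[of 0 k v "S 0 k v"] N_ge[of k]
    by (simp add: S_def powr_realpow N_def)
  then show ?thesis using that[of "real CARD('a) * fact CARD('a)"] by simp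
qed

definition zero_mean :: "nat \<Rightarrow> real^'a \<Rightarrow> bool" where
  "zero_mean k v \<longleftrightarrow> (\<Sum>a\<in>UNIV. lam (nseq s k) a * v $ a) = 0"

text \<open>Vectors are moved by the transposed matrices and lengths by the matrices themselves, so
  their pairing is the same at all levels.\<close>

lemma zero_mean_S:
  assumes "k \<le> l"
  shows "zero_mean l (S k l v) \<longleftrightarrow> zero_mean k v"
proof -
  have "(\<Sum>a\<in>UNIV. lam (nseq s l) a * S k l v $ a) = (\<Sum>a\<in>UNIV. \<Sum>b\<in>UNIV. Q k l $ b $ a * lam (nseq s l) a * v $ b)"
    by (simp add: S_def matrix_vector_mult_def transpose_def sum_distrib_left mult_ac)
  also have "\<dots> = (\<Sum>b\<in>UNIV. (\<Sum>a\<in>UNIV. Q k l $ b $ a * lam (nseq s l) a) * v $ b)"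
    by (subst sum.swap) (simp add: sum_distrib_right)
  also have "\<dots> = (\<Sum>b\<in>UNIV. lam (nseq s k) b * v $ b)"
    using lam_W[OF nseq_le[OF assms]] by (simp add: Q_def)
  finally show ?thesis by (simp add: zero_mean_def)
qed

text \<open>Interpolation between \<open>N l N k powr (-3/4)\<close> and \<open>N l powr (1 - \<theta>) N k powr d\<close>, the latter
  obtained by pulling back to level 0.\<close>

lemma S_zero_mean_bound:
  obtains \<theta> C where "0 < \<theta>" "\<theta> < 1" "0 < C"
    "\<And>k l v. k \<le> l \<Longrightarrow> zero_mean k v \<Longrightarrow> norm (S k l v) \<le> C * N l powr (1 - \<theta>) * N k powr (- 1 / 2) * norm v"
proof -
  obtain \<theta> B where \<theta>: "0 < \<theta>" "0 < B" "\<And>k v. zero_mean 0 v \<Longrightarrow> norm (S 0 k v) \<le> B * N k powr (1 - \<theta>) * norm v"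
    using rb unfolding roth_b_def zero_mean_def by (auto simp: Smap_eq Qmat_eq N_def)
  obtain C1 where C1: "0 < C1" "\<And>k l. k \<le> l \<Longrightarrow> mnorm (Q k l) \<le> C1 * N l * N k powr (1 / 4 - 1)"
    using Q_bound[of "1/4"] by auto
  obtain C2 where C2: "0 < C2" "\<And>k v. norm v \<le> C2 * N k powr CARD('a) * norm (S 0 k v)"
    using S_inverse_bound by blast
  define d where "d = real CARD('a)"
  \<comment> \<open>Small enough for \<open>(1 - t) * (- 3 / 4) + t * d \<le> - 1 / 2\<close>, which
    amounts to \<open>t * (d + 3 / 4) \<le> 1 / 4\<close>.\<close>
  define t where "t = 1 / (4 * (d + 1))"
  have d: "2 \<le> d" using card2 by (simp add: d_def)
  have t: "0 < t" "t < 1" using d by (auto simp: t_def)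
  \<comment> \<open>The minimum with 1 is taken because (b) gives no upper bound for its exponent,
    while a value below 1 is wanted later.\<close>
  define \<theta>' where "\<theta>' = t * min \<theta> 1"
  have \<theta>': "0 < \<theta>'" "\<theta>' < 1"
  proof -
    show "0 < \<theta>'" using t \<theta>(1) by (simp add: \<theta>'_def)
    have "t * min \<theta> 1 \<le> t * 1" using t by (intro mult_left_mono) auto
    then show "\<theta>' < 1" using t unfolding \<theta>'_def by linarith
  qed
  have "norm (S k l v) \<le> max C1 (B * C2) * N l powr (1 - \<theta>') * N k powr (- 1 / 2) * norm v"
    if "k \<le> l" "zero_mean k v" for k l v
  proof -
    have 1: "norm (S k l v) \<le> C1 * N l powr 1 * N k powr (- 3 / 4) * norm v"
    proof -
      have "mnorm (Q k l) * norm v \<le> (C1 * N l * N k powr (1 / 4 - 1)) * norm v"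
        by (intro mult_right_mono C1 that) auto
      then show ?thesis using S_bound[of k l v] N_ge[of l] by simp
    qed
    have 2: "norm (S k l v) \<le> (B * C2) * N l powr (1 - min \<theta> 1) * N k powr d * norm v"
    proof -
      obtain u where u: "S 0 k u = v" using S_surj by blast
      have "zero_mean 0 u" using zero_mean_S[of 0 k u] u that(2) by simp
      have "norm (S k l v) = norm (S 0 l u)" using S_comp[of 0 k l u] that u by simp
      also have "\<dots> \<le> B * N l powr (1 - \<theta>) * norm u" by (rule \<theta>) fact
      also have "\<dots> \<le> B * N l powr (1 - min \<theta> 1) * (C2 * N k powr d * norm v)"
        using C2(2)[of u k] u \<theta>(2) N_ge[of l] unfolding d_def
        by (intro mult_mono powr_mono mult_nonneg_nonneg) auto
      finally show ?thesis by (simp add: mult_ac)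
    qed
    have "norm (S k l v) \<le> max C1 (B * C2) * N l powr ((1 - t) * 1 + t * (1 - min \<theta> 1))
       * N k powr ((1 - t) * (- 3 / 4) + t * d) * norm v"
      by (rule powr_interpolate[OF _ _ _ _ _ _ _ 1 2]) (use N_ge t C1 C2 \<theta> in auto)
    also have "(1 - t) * 1 + t * (1 - min \<theta> 1) = 1 - \<theta>'"
      by (simp add: \<theta>'_def algebra_simps)
    also have "max C1 (B * C2) * N l powr (1 - \<theta>') * N k powr ((1 - t) * (- 3 / 4) + t * d) * norm v
      \<le> max C1 (B * C2) * N l powr (1 - \<theta>') * N k powr (- 1 / 2) * norm v"
    proof (intro mult_right_mono mult_left_mono powr_mono)
      have "t * (d + 3 / 4) \<le> t * (d + 1)" using t by simp
      also have "\<dots> = 1 / 4" using d by (simp add: t_def field_simps)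
      finally show "(1 - t) * (- 3 / 4) + t * d \<le> - 1 / 2" by (simp add: algebra_simps)
    qed (use N_ge C1 in auto)
    finally show ?thesis .
  qed
  then show ?thesis using that[of \<theta>' "max C1 (B * C2)"] \<theta>' C1(1) by auto
qed

section \<open>The stable subspaces\<close>

abbreviation "Gs k \<equiv> Gamma_s s k"

lemma mem_Gs: "v \<in> Gs k \<longleftrightarrow> (\<exists>\<sigma>>0. \<exists>C>0. \<forall>l\<ge>k. norm (S k l v) \<le> C * mnorm (Q k l) powr (- \<sigma>) * norm v)"
  unfolding Gamma_s_def by (auto simp: Smap_eq Qmat_eq mnorm_transpose)

text \<open>For a single nonzero vector the factor \<open>norm v\<close> can be moved into the
  constant. In this form closure under sums only requires the smaller of the two exponents.\<close>

lemma mem_Gs_weak: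
  "v \<in> Gs k \<longleftrightarrow> (\<exists>\<sigma>>0. \<exists>C>0. \<forall>l\<ge>k. norm (S k l v) \<le> C * mnorm (Q k l) powr (- \<sigma>))"
proof
  assume "v \<in> Gs k"
  then obtain \<sigma> C where h: "0 < \<sigma>" "0 < C" "\<And>l. l \<ge> k \<Longrightarrow> norm (S k l v) \<le> C * mnorm (Q k l) powr (- \<sigma>) * norm v"
    by (auto simp: mem_Gs)
  have "norm (S k l v) \<le> (C * (norm v + 1)) * mnorm (Q k l) powr (- \<sigma>)" if "l \<ge> k" for l
  proof -
    have "C * mnorm (Q k l) powr (- \<sigma>) * norm v \<le> C * mnorm (Q k l) powr (- \<sigma>) * (norm v + 1)"
      using h(2) by (intro mult_left_mono) auto
    then show ?thesis using h(3)[OF that] by (simp add: mult_ac)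
  qed
  moreover have "0 < C * (norm v + 1)" using h(2) by (simp add: add_nonneg_pos)
  ultimately show "\<exists>\<sigma>>0. \<exists>C>0. \<forall>l\<ge>k. norm (S k l v) \<le> C * mnorm (Q k l) powr (- \<sigma>)"
    using h(1) by blast
next
  assume "\<exists>\<sigma>>0. \<exists>C>0. \<forall>l\<ge>k. norm (S k l v) \<le> C * mnorm (Q k l) powr (- \<sigma>)"
  then obtain \<sigma> C where h: "0 < \<sigma>" "0 < C" "\<And>l. l \<ge> k \<Longrightarrow> norm (S k l v) \<le> C * mnorm (Q k l) powr (- \<sigma>)"
    by blast
  show "v \<in> Gs k"
  proof (cases "v = 0")
    case True
    then have "norm (S k l v) \<le> 1 * mnorm (Q k l) powr (- 1) * norm v" for l
      by (simp add: S_def)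
    then show ?thesis unfolding mem_Gs by (metis zero_less_one)
  next
    case False
    then have "norm (S k l v) \<le> (C / norm v) * mnorm (Q k l) powr (- \<sigma>) * norm v" if "l \<ge> k" for l
      using h(3)[OF that] by simp
    then show ?thesis unfolding mem_Gs using h False by (metis divide_pos_pos zero_less_norm_iff)
  qed
qed

lemma subspace_Gs: "subspace (Gs k)"
  unfolding subspace_def
proof (intro conjI ballI allI)
  have "norm (S k l 0) \<le> 1 * mnorm (Q k l) powr (- 1)" for l by (simp add: S_def)
  then show "0 \<in> Gs k" unfolding mem_Gs_weak by (metis zero_less_one)
next
  fix x y assume "x \<in> Gs k" "y \<in> Gs k"
  then obtain \<sigma> C \<tau> D where h: "0 < \<sigma>" "0 < C" "\<And>l. l \<ge> k \<Longrightarrow> norm (S k l x) \<le> C * mnorm (Q k l) powr (- \<sigma>)"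
    and g: "0 < \<tau>" "0 < D" "\<And>l. l \<ge> k \<Longrightarrow> norm (S k l y) \<le> D * mnorm (Q k l) powr (- \<tau>)"
    unfolding mem_Gs_weak by metis
  have "norm (S k l (x + y)) \<le> (C + D) * mnorm (Q k l) powr (- min \<sigma> \<tau>)" if "l \<ge> k" for l
  proof -
    have m1: "1 \<le> mnorm (Q k l)" using mnorm_Q_ge_2[of k l] by simp
    have "norm (S k l (x + y)) \<le> norm (S k l x) + norm (S k l y)"
      by (simp add: linear_add[OF S_linear] norm_triangle_ineq)
    also have "\<dots> \<le> C * mnorm (Q k l) powr (- \<sigma>) + D * mnorm (Q k l) powr (- \<tau>)"
      using h(3) g(3) that by (intro add_mono) auto
    also have "\<dots> \<le> C * mnorm (Q k l) powr (- min \<sigma> \<tau>) + D * mnorm (Q k l) powr (- min \<sigma> \<tau>)"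
      using h(2) g(2) m1 by (intro add_mono mult_left_mono powr_mono) auto
    finally show ?thesis by (simp add: algebra_simps)
  qed
  then show "x + y \<in> Gs k" unfolding mem_Gs_weak using h g by (metis add_pos_pos min_less_iff_conj)
next
  fix c x assume "x \<in> Gs k"
  then obtain \<sigma> C where h: "0 < \<sigma>" "0 < C" "\<And>l. l \<ge> k \<Longrightarrow> norm (S k l x) \<le> C * mnorm (Q k l) powr (- \<sigma>)"
    unfolding mem_Gs_weak by blast
  have "norm (S k l (c *\<^sub>R x)) \<le> ((\<bar>c\<bar> + 1) * C) * mnorm (Q k l) powr (- \<sigma>)" if "l \<ge> k" for l
  proof -
    have "norm (S k l (c *\<^sub>R x)) \<le> (\<bar>c\<bar> + 1) * norm (S k l x)"
      by (simp add: linear_scale[OF S_linear] mult_right_mono)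
    also have "\<dots> \<le> (\<bar>c\<bar> + 1) * (C * mnorm (Q k l) powr (- \<sigma>))"
      by (intro mult_left_mono h that) auto
    finally show ?thesis by (simp add: mult_ac)
  qed
  moreover have "0 < (\<bar>c\<bar> + 1) * C" using h(2) by (simp add: add_nonneg_pos)
  ultimately show "c *\<^sub>R x \<in> Gs k" unfolding mem_Gs_weak using h by blast
qed

text \<open>Forward, \<open>Q l m\<close> has norm at most that of \<open>Q k m\<close>. Backward,
  submultiplicativity transfers the decay beyond level \<open>l\<close>, and the finitely many
  earlier levels go into the constant. As \<open>S\<close> is onto, stable vectors can therefore be
  pulled back as well.\<close>

lemma S_Gs_iff:
  assumes "k \<le> l"
  shows "S k l v \<in> Gs l \<longleftrightarrow> v \<in> Gs k"
proof
  assume "v \<in> Gs k"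
  then obtain \<sigma> C where h: "0 < \<sigma>" "0 < C" "\<And>m. m \<ge> k \<Longrightarrow> norm (S k m v) \<le> C * mnorm (Q k m) powr (- \<sigma>)"
    unfolding mem_Gs_weak by blast
  have "norm (S l m (S k l v)) \<le> C * mnorm (Q l m) powr (- \<sigma>)" if "m \<ge> l" for m
  proof -
    have "norm (S l m (S k l v)) \<le> C * mnorm (Q k m) powr (- \<sigma>)"
      using h(3)[of m] assms that S_comp[of k l m v] by simp
    also have "\<dots> \<le> C * mnorm (Q l m) powr (- \<sigma>)"
      using h(1,2) mnorm_Q_antimono[OF assms that] mnorm_Q_ge_2[of l m]
      by (intro mult_left_mono powr_mono2') auto
    finally show ?thesis .
  qed
  then show "S k l v \<in> Gs l" unfolding mem_Gs_weak using h by blast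
next
  assume "S k l v \<in> Gs l"
  then obtain \<sigma> C where h: "0 < \<sigma>" "0 < C" "\<And>m. m \<ge> l \<Longrightarrow> norm (S l m (S k l v)) \<le> C * mnorm (Q l m) powr (- \<sigma>)"
    unfolding mem_Gs_weak by blast
  define B where "B = mnorm (Q k l) powr \<sigma>"
  define D where "D = C * B + (\<Sum>m\<le>l. norm (S k m v) * mnorm (Q k m) powr \<sigma>)"
  have B: "0 < B" using mnorm_Q_ge_2[of k l] by (simp add: B_def)
  have sn: "0 \<le> (\<Sum>m\<le>l. norm (S k m v) * mnorm (Q k m) powr \<sigma>)" by (intro sum_nonneg) auto
  have D: "0 < D" using sn B h(2) by (simp add: D_def add_pos_nonneg)
  have "norm (S k m v) \<le> D * mnorm (Q k m) powr (- \<sigma>)" if "m \<ge> k" for m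
  proof (cases "m \<ge> l")
    case True
    have "norm (S k m v) \<le> C * mnorm (Q l m) powr (- \<sigma>)"
      using h(3)[OF True] S_comp[OF assms True] by simp
    also have "\<dots> \<le> C * (B * mnorm (Q k m) powr (- \<sigma>))"
    proof (intro mult_left_mono)
      have "mnorm (Q k m) \<le> mnorm (Q k l) * mnorm (Q l m)"
        using mnorm_mult[of "Q k l" "Q l m"] Q_mult[OF assms True] by simp
      then have "(mnorm (Q k l) * mnorm (Q l m)) powr (- \<sigma>) \<le> mnorm (Q k m) powr (- \<sigma>)"
        using h(1) mnorm_Q_ge_2[of k m] by (intro powr_mono2') auto
      then have "B * ((mnorm (Q k l) * mnorm (Q l m)) powr (- \<sigma>)) \<le> B * mnorm (Q k m) powr (- \<sigma>)"
        using B by simp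
      moreover have "B * ((mnorm (Q k l) * mnorm (Q l m)) powr (- \<sigma>)) = mnorm (Q l m) powr (- \<sigma>)"
        using mnorm_Q_ge_2[of k l] mnorm_Q_ge_2[of l m]
        by (simp add: B_def powr_mult powr_minus)
      ultimately show "mnorm (Q l m) powr (- \<sigma>) \<le> B * mnorm (Q k m) powr (- \<sigma>)" by simp
    qed (use h in auto)
    also have "\<dots> \<le> D * mnorm (Q k m) powr (- \<sigma>)"
      unfolding mult.assoc[symmetric] using sn by (intro mult_right_mono) (auto simp: D_def)
    finally show ?thesis .
  next
    case False
    have "norm (S k m v) * mnorm (Q k m) powr \<sigma> \<le> (\<Sum>m\<le>l. norm (S k m v) * mnorm (Q k m) powr \<sigma>)"
      using False by (intro member_le_sum[where f="\<lambda>m. norm (S k m v) * mnorm (Q k m) powr \<sigma>"]) auto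
    also have "\<dots> \<le> D" using B h(2) by (simp add: D_def)
    finally have "norm (S k m v) * mnorm (Q k m) powr \<sigma> * mnorm (Q k m) powr (- \<sigma>) \<le> D * mnorm (Q k m) powr (- \<sigma>)"
      by (intro mult_right_mono) auto
    moreover have "mnorm (Q k m) powr \<sigma> * mnorm (Q k m) powr (- \<sigma>) = 1"
      using mnorm_Q_ge_2[of k m] by (simp add: powr_add[symmetric])
    ultimately show ?thesis by (simp add: mult.assoc)
  qed
  then show "v \<in> Gs k" unfolding mem_Gs_weak using h D by blast
qed

text \<open>In the definition of the stable space the constants depend on the vector. For a finite
  orthonormal basis the smallest exponent and the sum of the constants serve all vectors at
  once.\<close>

lemma Gs_0_uniform:
  obtains \<sigma> C where "0 < \<sigma>" "0 < C" "\<And>v l. v \<in> Gs 0 \<Longrightarrow> norm (S 0 l v) \<le> C * N l powr (- \<sigma>) * norm v"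
proof -
  obtain B where B: "B \<subseteq> Gs 0" "pairwise orthogonal B" "\<And>x. x \<in> B \<Longrightarrow> norm x = 1"
    "independent B" "span B = Gs 0"
    using orthonormal_basis_subspace[OF subspace_Gs[of 0]] by metis
  have fin: "finite B" using B(4) by (rule independent_imp_finite)
  have "\<forall>b\<in>B. \<exists>\<sigma> C. 0 < \<sigma> \<and> 0 < C \<and> (\<forall>l. norm (S 0 l b) \<le> C * N l powr (- \<sigma>))"
    using B(1) unfolding mem_Gs_weak[of _ 0] by (auto simp: subset_iff mem_Gs_weak N_def)
  then obtain \<sigma> C where h: "\<And>b. b \<in> B \<Longrightarrow> 0 < \<sigma> b" "\<And>b. b \<in> B \<Longrightarrow> 0 < C b"
    "\<And>b l. b \<in> B \<Longrightarrow> norm (S 0 l b) \<le> C b * N l powr (- \<sigma> b)" by metis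
  \<comment> \<open>The extra element keeps \<open>Min\<close> defined when the basis is
    empty.\<close>
  define \<tau> where "\<tau> = Min (insert 1 (\<sigma> ` B))"
  have \<tau>: "0 < \<tau>" "\<And>b. b \<in> B \<Longrightarrow> \<tau> \<le> \<sigma> b" using fin h(1) by (auto simp: \<tau>_def)
  define D where "D = 1 + (\<Sum>b\<in>B. C b)"
  have D: "0 < D" using h(2) by (simp add: D_def add_pos_nonneg sum_nonneg less_imp_le)
  have "norm (S 0 l v) \<le> D * N l powr (- \<tau>) * norm v" if "v \<in> Gs 0" for v l
  proof -
    have "v = (\<Sum>b\<in>B. (v \<bullet> b) *\<^sub>R b)"
      using orthonormal_basis_expand[OF B(2) B(3) _ fin, of v] that B(5) by simp
    then have "S 0 l v = S 0 l (\<Sum>b\<in>B. (v \<bullet> b) *\<^sub>R b)" by (rule arg_cong)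
    also have "\<dots> = (\<Sum>b\<in>B. (v \<bullet> b) *\<^sub>R S 0 l b)"
      by (simp add: linear_sum[OF S_linear] linear_scale[OF S_linear])
    also have "norm \<dots> \<le> (\<Sum>b\<in>B. \<bar>v \<bullet> b\<bar> * norm (S 0 l b))"
      by (rule order.trans[OF norm_sum]) simp
    finally have "norm (S 0 l v) \<le> (\<Sum>b\<in>B. \<bar>v \<bullet> b\<bar> * norm (S 0 l b))" .
    also have "\<dots> \<le> (\<Sum>b\<in>B. norm v * (C b * N l powr (- \<tau>)))"
    proof (intro sum_mono mult_mono)
      fix b assume b: "b \<in> B"
      show "\<bar>v \<bullet> b\<bar> \<le> norm v" using Cauchy_Schwarz_ineq2[of v b] B(3)[OF b] by simp
      have "C b * N l powr (- \<sigma> b) \<le> C b * N l powr (- \<tau>)"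
        using h(2)[OF b] \<tau>(2)[OF b] N_ge[of l] by (intro mult_left_mono powr_mono) auto
      then show "norm (S 0 l b) \<le> C b * N l powr (- \<tau>)" using h(3)[OF b, of l] by linarith
    qed auto
    also have "\<dots> = (D - 1) * N l powr (- \<tau>) * norm v"
      by (simp add: D_def sum_distrib_left sum_distrib_right mult_ac)
    also have "\<dots> \<le> D * N l powr (- \<tau>) * norm v" by (intro mult_right_mono) auto
    finally show ?thesis .
  qed
  then show ?thesis using that[of \<tau> D] \<tau> D by blast
qed

text \<open>The constant in \<open>roth_c\<close> may have any sign; passing to
  \<open>max C 1\<close> makes it positive, as later products of constants require.\<close>

lemma roth_c_bounds:
  assumes "0 < \<epsilon>"
  obtains C where "0 < C"
    "\<And>k l v. k \<le> l \<Longrightarrow> infdist v (Gs k) \<le> C * N l powr \<epsilon> * infdist (S k l v) (Gs l)"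
    "\<And>k l v. k \<le> l \<Longrightarrow> v \<in> Gs k \<Longrightarrow> norm (S k l v) \<le> C * N l powr \<epsilon> * norm v"
proof -
  obtain C where C0: "\<forall>k l. k \<le> l \<longrightarrow>
      (\<forall>v. infdist v (Gs k) \<le> C * mnorm (Qmat s 0 l) powr \<epsilon> * infdist (Smap s k l v) (Gs l)) \<and>
      (\<forall>v\<in>Gs k. norm (Smap s k l v) \<le> C * mnorm (Qmat s 0 l) powr \<epsilon> * norm v)"
    using rc assms unfolding roth_c_def by blast
  have C: "infdist v (Gs k) \<le> C * N l powr \<epsilon> * infdist (S k l v) (Gs l)"
    "v \<in> Gs k \<Longrightarrow> norm (S k l v) \<le> C * N l powr \<epsilon> * norm v" if "k \<le> l" for k l v
    using C0 that by (auto simp: Smap_eq[OF that, symmetric] N_def Qmat_eq[of 0 l, symmetric])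
  have le: "C * N l powr \<epsilon> * z \<le> max C 1 * N l powr \<epsilon> * z" if "0 \<le> z" for l z
    using that by (intro mult_right_mono) auto
  show ?thesis
  proof (rule that[of "max C 1"])
    show "infdist v (Gs k) \<le> max C 1 * N l powr \<epsilon> * infdist (S k l v) (Gs l)" if "k \<le> l" for k l v
      using C(1)[OF that, of v] le[OF infdist_nonneg] by (rule order.trans)
    show "norm (S k l v) \<le> max C 1 * N l powr \<epsilon> * norm v" if "k \<le> l" "v \<in> Gs k" for k l v
      using C(2)[OF that] le[OF norm_ge_zero] by (rule order.trans)
  qed simp
qed

text \<open>The second half of (c) loses a small power of \<open>N l\<close> but nothing at level
  \<open>k\<close>; the decay from level 0 costs \<open>N k powr d\<close> for the pull-back. The
  interpolation weight \<open>t\<close> satisfies \<open>t * d \<le> \<eta>\<close>, which keeps the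
  loss at level \<open>k\<close> below the prescribed exponent.\<close>

lemma S_Gs_bound:
  assumes "0 < \<eta>"
  obtains \<rho> C where "0 < \<rho>" "0 < C"
    "\<And>k l v. k \<le> l \<Longrightarrow> v \<in> Gs k \<Longrightarrow> norm (S k l v) \<le> C * N l powr (- \<rho>) * N k powr \<eta> * norm v"
proof -
  obtain \<sigma> B where \<sigma>: "0 < \<sigma>" "0 < B" "\<And>v l. v \<in> Gs 0 \<Longrightarrow> norm (S 0 l v) \<le> B * N l powr (- \<sigma>) * norm v"
    using Gs_0_uniform by blast
  obtain C2 where C2: "0 < C2" "\<And>k v. norm v \<le> C2 * N k powr CARD('a) * norm (S 0 k v)"
    using S_inverse_bound by blast
  define d where "d = real CARD('a)"
  have d: "0 < d" using card2 by (simp add: d_def)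
  define t where "t = \<eta> / (d + \<eta>)"
  have t: "0 < t" "t < 1" "t * d \<le> \<eta>"
  proof -
    show "0 < t" "t < 1" using d assms by (auto simp: t_def)
    have "t * d = \<eta> * (d / (d + \<eta>))" by (simp add: t_def)
    also have "\<dots> \<le> \<eta> * 1" using d assms by (intro mult_left_mono) auto
    finally show "t * d \<le> \<eta>" by simp
  qed
  \<comment> \<open>With this value \<open>t * \<sigma> = 2 * \<epsilon>\<close>, so the weighted
    decay exceeds the loss \<open>(1 - t) * \<epsilon>\<close> by at least
    \<open>\<epsilon>\<close>.\<close>
  define \<epsilon> where "\<epsilon> = t * \<sigma> / 2"
  have \<epsilon>: "0 < \<epsilon>" using t \<sigma> by (simp add: \<epsilon>_def)
  obtain C1 where C1: "0 < C1" "\<And>k l v. k \<le> l \<Longrightarrow> v \<in> Gs k \<Longrightarrow> norm (S k l v) \<le> C1 * N l powr \<epsilon> * norm v"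
  proof (rule roth_c_bounds[OF \<epsilon>])
    fix C assume "0 < C" "\<And>k l v. k \<le> l \<Longrightarrow> v \<in> Gs k \<Longrightarrow> norm (S k l v) \<le> C * N l powr \<epsilon> * norm v"
    then show thesis by (rule that)
  qed
  have "norm (S k l v) \<le> max C1 (B * C2) * N l powr (- \<epsilon>) * N k powr \<eta> * norm v"
    if "k \<le> l" "v \<in> Gs k" for k l v
  proof -
    have 1: "norm (S k l v) \<le> C1 * N l powr \<epsilon> * N k powr 0 * norm v"
      using C1(2)[OF that] N_ge[of k] by simp
    have 2: "norm (S k l v) \<le> (B * C2) * N l powr (- \<sigma>) * N k powr d * norm v"
    proof -
      obtain u where u: "S 0 k u = v" using S_surj by blast
      have "u \<in> Gs 0" using S_Gs_iff[of 0 k u] u that(2) by simp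
      have "norm (S k l v) = norm (S 0 l u)" using S_comp[of 0 k l u] that u by simp
      also have "\<dots> \<le> B * N l powr (- \<sigma>) * norm u" by (rule \<sigma>) fact
      also have "\<dots> \<le> B * N l powr (- \<sigma>) * (C2 * N k powr d * norm v)"
        using C2(2)[of u k] u \<sigma>(2) unfolding d_def by (intro mult_left_mono) auto
      finally show ?thesis by (simp add: mult_ac)
    qed
    have "norm (S k l v) \<le> max C1 (B * C2) * N l powr ((1 - t) * \<epsilon> + t * (- \<sigma>))
       * N k powr ((1 - t) * 0 + t * d) * norm v"
      by (rule powr_interpolate[OF _ _ _ _ _ _ _ 1 2]) (use N_ge t C1 C2 \<sigma> in auto)
    also have "\<dots> \<le> max C1 (B * C2) * N l powr (- \<epsilon>) * N k powr \<eta> * norm v"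
    proof (intro mult_right_mono mult_mono powr_mono order.refl)
      have "(1 - t) * \<epsilon> \<le> \<epsilon>" using t \<epsilon> by (simp add: mult_left_le_one_le)
      then show "(1 - t) * \<epsilon> + t * (- \<sigma>) \<le> - \<epsilon>" by (simp add: \<epsilon>_def)
    qed (use N_ge C1 t in auto)
    finally show ?thesis .
  qed
  then show ?thesis using that[of \<epsilon> "max C1 (B * C2)"] \<epsilon> C1(1) by auto
qed

end

section \<open>Cocycles over the accelerated algorithm\<close>

lemma infdist_subspace_add:
  fixes x y :: "'b::euclidean_space"
  assumes "subspace V"
  shows "infdist (x + y) V \<le> infdist x V + infdist y V"
proof -
  have V: "closed V" "V \<noteq> {}" using assms closed_subspace subspace_0 by auto
  obtain p where p: "p \<in> V" "infdist x V = dist x p" using infdist_attains_inf[OF V] by metis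
  obtain q where q: "q \<in> V" "infdist y V = dist y q" using infdist_attains_inf[OF V] by metis
  have "infdist (x + y) V \<le> dist (x + y) (p + q)"
    using assms p q by (intro infdist_le subspace_add)
  also have "\<dots> \<le> dist x p + dist y q" by (rule dist_triangle_add)
  finally show ?thesis using p q by simp
qed

lemma infdist_subspace_le_norm:
  fixes x :: "'b::euclidean_space"
  assumes "subspace V"
  shows "infdist x V \<le> norm x"
  using infdist_le[OF subspace_0[OF assms], of x] by simp

lemma infdist_subspace_add_mem:
  fixes x y :: "'b::euclidean_space"
  assumes "subspace V" "y \<in> V"
  shows "infdist (x + y) V \<le> infdist x V"
  using infdist_subspace_add[OF assms(1), of x y] assms(2) by simp

lemma infdist_subspace_minus:
  fixes x :: "'b::euclidean_space"
  assumes "subspace V"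
  shows "infdist (- x) V \<le> infdist x V"
proof -
  have V: "closed V" "V \<noteq> {}" using assms closed_subspace subspace_0 by auto
  obtain p where p: "p \<in> V" "infdist x V = dist x p" using infdist_attains_inf[OF V] by metis
  have "infdist (- x) V \<le> dist (- x) (- p)" using assms p by (intro infdist_le subspace_neg)
  then show ?thesis using p by (simp add: dist_norm norm_minus_commute)
qed

lemma infdist_subspace_sum:
  fixes f :: "'i \<Rightarrow> 'b::euclidean_space"
  assumes "subspace V" "finite A"
  shows "infdist (\<Sum>i\<in>A. f i) V \<le> (\<Sum>i\<in>A. infdist (f i) V)"
  using assms(2)
proof (induction A rule: finite_induct)
  case empty
  then show ?case using subspace_0[OF assms(1)] by simp
next
  case (insert a A)
  then show ?case using infdist_subspace_add[OF assms(1), of "f a" "sum f A"] by simp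
qed

section \<open>Perturbed orbits of the cocycle\<close>

context roth_iem
begin

text \<open>By (a), \<open>N (Suc k)\<close> is at most a constant times the square of
  \<open>N k\<close>. This is needed because defects of one step are measured at the new
  level.\<close>

lemma N_Suc_powr:
  assumes "0 < \<eta>"
  obtains D where "0 < D" "\<And>k. N k powr (- \<eta>) \<le> D * N (Suc k) powr (- (\<eta> / 2))"
proof -
  obtain C where C: "0 < C" "\<And>k. N (k + 1) \<le> C * N k powr (1 + 1)"
    using N_add_bound[of 1 1] by auto
  have "N k powr (- \<eta>) \<le> C powr (\<eta> / 2) * N (Suc k) powr (- (\<eta> / 2))" for k
  proof -
    have "(C * N k powr 2) powr (- (\<eta> / 2)) \<le> N (Suc k) powr (- (\<eta> / 2))"
      using C(2)[of k] assms N_ge[of "Suc k"] by (intro powr_mono2') auto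
    moreover have "(C * N k powr 2) powr (- (\<eta> / 2)) = C powr (- (\<eta> / 2)) * N k powr (- \<eta>)"
      using C(1) N_ge[of k] by (simp add: powr_mult powr_powr del: powr_numeral)
    ultimately have "C powr (\<eta> / 2) * (C powr (- (\<eta> / 2)) * N k powr (- \<eta>)) \<le> C powr (\<eta> / 2) * N (Suc k) powr (- (\<eta> / 2))"
      by (intro mult_left_mono) auto
    moreover have "C powr (\<eta> / 2) * C powr (- (\<eta> / 2)) = 1"
      using C(1) by (simp add: powr_add[symmetric])
    ultimately show ?thesis by (simp add: mult.assoc[symmetric])
  qed
  then show ?thesis using that[of "C powr (\<eta> / 2)"] C(1) by simp
qed

text \<open>The defect of \<open>c\<close> from being an orbit of the cocycle. The initial value
  counts as the increment at 0, so that \<open>c\<close> is the sum of its transported increments, a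
  discrete variation of constants formula.\<close>

definition increment :: "(nat \<Rightarrow> real^'a) \<Rightarrow> nat \<Rightarrow> real^'a" where
  "increment c k = (case k of 0 \<Rightarrow> c 0 | Suc j \<Rightarrow> c (Suc j) - S j (Suc j) (c j))"

lemma increment_sum: "c k = (\<Sum>j\<le>k. S j k (increment c j))"
proof (induction k)
  case 0
  then show ?case by (simp add: increment_def S_refl)
next
  case (Suc k)
  have "S k (Suc k) (c k) = S k (Suc k) (\<Sum>j\<le>k. S j k (increment c j))"
    using Suc by (rule arg_cong)
  also have "\<dots> = (\<Sum>j\<le>k. S j (Suc k) (increment c j))"
    by (simp add: linear_sum[OF S_linear] S_comp)
  finally show ?case by (simp add: increment_def S_refl)
qed

lemma increment_bound:
  assumes "\<And>k. norm (c (Suc k) - S k (Suc k) (c k)) \<le> K * N (Suc k) powr a"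
  obtains K' where "0 < K'" "\<And>k. norm (increment c k) \<le> K' * N k powr a"
proof -
  define K' where "K' = \<bar>K\<bar> + norm (c 0) * N 0 powr (- a) + 1"
  have p: "0 \<le> norm (c 0) * N 0 powr (- a)" by simp
  have "norm (increment c k) \<le> K' * N k powr a" for k
  proof (cases k)
    case 0
    have "norm (c 0) = norm (c 0) * N 0 powr (- a) * N 0 powr a"
      using N_ge[of 0] by (simp add: powr_add[symmetric])
    also have "\<dots> \<le> K' * N 0 powr a" by (intro mult_right_mono) (auto simp: K'_def)
    finally show ?thesis using 0 by (simp add: increment_def)
  next
    case (Suc j)
    have "K * N (Suc j) powr a \<le> K' * N (Suc j) powr a"
      using p unfolding K'_def by (intro mult_right_mono) (linarith | simp)+
    then show ?thesis using assms[of j] Suc by (simp add: increment_def)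
  qed
  moreover have "0 < K'" using p unfolding K'_def by linarith
  ultimately show ?thesis using that by blast
qed

lemma sum_N_le_suminf: "0 < \<eta> \<Longrightarrow> finite A \<Longrightarrow> (\<Sum>j\<in>A. N j powr - \<eta>) \<le> (\<Sum>j. N j powr - \<eta>)"
  using summable_N by (intro sum_le_suminf) auto

text \<open>The increments have zero mean as well. The gain \<open>N j powr (- 1 / 2)\<close> in
  transporting one from level \<open>j\<close> beats its size \<open>N j powr (1 / 4)\<close>, so
  the sum over \<open>j\<close> is bounded by a convergent series.\<close>

lemma zero_mean_growth:
  assumes zm: "\<And>k. zero_mean k (c k)"
    and inc: "\<And>k. norm (c (Suc k) - S k (Suc k) (c k)) \<le> K * N (Suc k) powr (1 / 4)"
  obtains \<theta> C where "0 < \<theta>" "\<theta> < 1" "0 < C" "\<And>k. norm (c k) \<le> C * N k powr (1 - \<theta>)"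
proof -
  obtain \<theta> C where h: "0 < \<theta>" "\<theta> < 1" "0 < C"
    "\<And>k l v. k \<le> l \<Longrightarrow> zero_mean k v \<Longrightarrow> norm (S k l v) \<le> C * N l powr (1 - \<theta>) * N k powr (- 1 / 2) * norm v"
    using S_zero_mean_bound by blast
  obtain K' where K': "0 < K'" "\<And>k. norm (increment c k) \<le> K' * N k powr (1 / 4)"
    using increment_bound[OF inc] by blast
  have zd: "zero_mean k (x - y)" if "zero_mean k x" "zero_mean k y" for k x y
    using that by (simp add: zero_mean_def right_diff_distrib sum_subtractf)
  have ze: "zero_mean k (increment c k)" for k
    by (cases k) (auto simp: increment_def zm zero_mean_S intro!: zd)
  define M where "M = (\<Sum>j. N j powr - (1 / 4))"
  have "norm (c k) \<le> (C * K' * (M + 1)) * N k powr (1 - \<theta>)" for k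
  proof -
    have "norm (c k) \<le> (\<Sum>j\<le>k. norm (S j k (increment c j)))"
      by (subst increment_sum) (rule norm_sum)
    also have "\<dots> \<le> (\<Sum>j\<le>k. C * N k powr (1 - \<theta>) * N j powr (- 1 / 2) * (K' * N j powr (1 / 4)))"
    proof (intro sum_mono)
      fix j assume j: "j \<in> {..k}"
      have "norm (S j k (increment c j)) \<le> C * N k powr (1 - \<theta>) * N j powr (- 1 / 2) * norm (increment c j)"
        using j ze by (intro h(4)) auto
      also have "\<dots> \<le> C * N k powr (1 - \<theta>) * N j powr (- 1 / 2) * (K' * N j powr (1 / 4))"
        using h(3) by (intro mult_left_mono K') auto
      finally show "norm (S j k (increment c j)) \<le> C * N k powr (1 - \<theta>) * N j powr (- 1 / 2) * (K' * N j powr (1 / 4))" .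
    qed
    also have "\<dots> = (\<Sum>j\<le>k. (C * K' * N k powr (1 - \<theta>)) * (N j powr (- 1 / 2) * N j powr (1 / 4)))"
      by (simp add: mult_ac)
    also have "\<dots> = (C * K' * N k powr (1 - \<theta>)) * (\<Sum>j\<le>k. N j powr - (1 / 4))"
      by (simp add: sum_distrib_left powr_add[symmetric])
    also have "\<dots> \<le> (C * K' * N k powr (1 - \<theta>)) * (M + 1)"
      using h(3) K'(1) sum_N_le_suminf[of "1/4" "{..k}"] by (intro mult_left_mono) (auto simp: M_def)
    finally show ?thesis by (simp add: mult_ac)
  qed
  moreover have "0 \<le> M" unfolding M_def by (intro suminf_nonneg summable_N) auto
  ultimately show ?thesis using that[of \<theta> "C * K' * (M + 1)"] h K' by simp
qed

lemma Gs_nearest: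
  obtains p where "p \<in> Gs k" "infdist x (Gs k) = norm (x - p)"
proof -
  have "closed (Gs k)" "Gs k \<noteq> {}" using subspace_Gs closed_subspace subspace_0 by blast+
  then show ?thesis using infdist_attains_inf[of "Gs k" x] that by (metis dist_norm)
qed

text \<open>The class of \<open>\<xi>\<close> modulo \<open>Gs 0\<close> is the sum of the pull-backs of the classes of the increments.\<close>

lemma quotient_correction:
  assumes \<eta>: "0 < \<eta>" and inc: "\<And>k. norm (c (Suc k) - S k (Suc k) (c k)) \<le> K * N (Suc k) powr (- \<eta>)"
  obtains \<xi> C where "0 < C" "\<And>k. infdist (c k - S 0 k \<xi>) (Gs k) \<le> C * N k powr (- (\<eta> / 4))"
proof -
  obtain K' where K': "0 < K'" "\<And>k. norm (increment c k) \<le> K' * N k powr (- \<eta>)"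
    using increment_bound[OF inc] by blast
  obtain C where C: "0 < C" "\<And>k l v. k \<le> l \<Longrightarrow> infdist v (Gs k) \<le> C * N l powr (\<eta> / 2) * infdist (S k l v) (Gs l)"
    using roth_c_bounds[of "\<eta> / 2"] \<eta> by (metis half_gt_zero)
  have "\<exists>v p. S 0 j v = increment c j \<and> p \<in> Gs 0 \<and> infdist v (Gs 0) = norm (v - p)" for j
  proof -
    obtain v where v: "S 0 j v = increment c j" using S_surj by blast
    obtain p where "p \<in> Gs 0" "infdist v (Gs 0) = norm (v - p)" using Gs_nearest .
    then show ?thesis using v by blast
  qed
  then obtain v p where vp: "\<And>j. S 0 j (v j) = increment c j" "\<And>j. p j \<in> Gs 0"
    "\<And>j. infdist (v j) (Gs 0) = norm (v j - p j)" by metis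
  \<comment> \<open>The representative of smallest norm of the class of \<open>v j\<close> modulo
    \<open>Gs 0\<close>: its norm is the quotient norm, which (c) bounds through the
    increment.\<close>
  define u where "u j = v j - p j" for j
  have est: "C * N j powr (\<eta> / 2) * z \<le> (C * K') * N j powr - (\<eta> / 2)" if "z \<le> K' * N j powr (- \<eta>)" for j z
  proof -
    have "C * N j powr (\<eta> / 2) * z \<le> C * N j powr (\<eta> / 2) * (K' * N j powr (- \<eta>))"
      using C(1) that by (intro mult_left_mono) auto
    also have "\<dots> = (C * K') * (N j powr (\<eta> / 2) * N j powr (- \<eta>))" by simp
    also have "\<dots> = (C * K') * N j powr - (\<eta> / 2)" by (simp add: powr_add[symmetric])
    finally show ?thesis .
  qed
  have nu: "norm (u j) \<le> (C * K') * N j powr - (\<eta> / 2)" for j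
  proof -
    have "norm (u j) \<le> C * N j powr (\<eta> / 2) * infdist (increment c j) (Gs j)"
      using C(2)[of 0 j "v j"] vp by (simp add: u_def)
    also have "\<dots> \<le> (C * K') * N j powr - (\<eta> / 2)"
      using infdist_subspace_le_norm[OF subspace_Gs, of "increment c j" j] K'(2)[of j] by (intro est) simp
    finally show ?thesis .
  qed
  have "summable u"
  proof (rule summable_norm_cancel)
    have "summable (\<lambda>j. (C * K') * N j powr - (\<eta> / 2))" using \<eta> by (intro summable_mult summable_N) auto
    then show "summable (\<lambda>j. norm (u j))" by (rule summable_comparison_test'[where N=0]) (use nu in auto)
  qed
  define \<xi> where "\<xi> = suminf u"
  define M where "M = (\<Sum>j. N j powr - (\<eta> / 4))"
  have M: "0 \<le> M" unfolding M_def using \<eta> by (intro suminf_nonneg summable_N) auto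
  \<comment> \<open>The terms with \<open>j > k\<close> are what is left of
    \<open>c k - S 0 k \<xi>\<close> modulo \<open>Gs k\<close>. Pushed on to level
    \<open>j\<close>, such a term is the increment up to a stable vector, and (c) carries the bound
    back to level \<open>k\<close>. Half of the remaining exponent gives decay in \<open>k\<close>,
    the other half summability in \<open>j\<close>.\<close>
  have e: "infdist (S 0 k (u j)) (Gs k) \<le> (C * K') * N k powr - (\<eta> / 4) * N j powr - (\<eta> / 4)" if "k \<le> j" for k j
  proof -
    have "S k j (S 0 k (u j)) = increment c j + - S 0 j (p j)"
      using that by (simp add: S_comp u_def linear_diff[OF S_linear] vp)
    moreover have "- S 0 j (p j) \<in> Gs j" using S_Gs_iff[of 0 j "p j"] vp(2) subspace_neg[OF subspace_Gs] by simp
    ultimately have "infdist (S k j (S 0 k (u j))) (Gs j) \<le> infdist (increment c j) (Gs j)"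
      using infdist_subspace_add_mem[OF subspace_Gs] by metis
    also have "\<dots> \<le> K' * N j powr (- \<eta>)"
      using infdist_subspace_le_norm[OF subspace_Gs, of "increment c j" j] K'(2)[of j] by simp
    finally have "infdist (S 0 k (u j)) (Gs k) \<le> (C * K') * N j powr - (\<eta> / 2)"
      using C(2)[OF that, of "S 0 k (u j)"] est by (blast intro: order.trans)
    also have "\<dots> = (C * K') * (N j powr - (\<eta> / 4) * N j powr - (\<eta> / 4))" by (simp add: powr_add[symmetric])
    also have "\<dots> \<le> (C * K') * (N k powr - (\<eta> / 4) * N j powr - (\<eta> / 4))"
      using C(1) K'(1) N_ge[of k] N_mono[OF that] \<eta>
      by (intro mult_left_mono mult_right_mono powr_mono2') auto
    finally show ?thesis by (simp add: mult.assoc)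
  qed
  have "infdist (c k - S 0 k \<xi>) (Gs k) \<le> (C * K' * (M + 1)) * N k powr (- (\<eta> / 4))" for k
  proof -
    have ck: "c k = S 0 k (\<Sum>j\<le>k. v j)"
      by (subst increment_sum) (simp add: linear_sum[OF S_linear] vp(1)[symmetric] S_comp)
    have fin: "infdist (c k - S 0 k (\<Sum>j<n. u j)) (Gs k) \<le> (C * K' * (M + 1)) * N k powr (- (\<eta> / 4))" if "n > k" for n
    proof -
      have "{..<n} = {..k} \<union> {k<..<n}" using that by auto
      then have "(\<Sum>j<n. u j) = (\<Sum>j\<le>k. u j) + (\<Sum>j\<in>{k<..<n}. u j)"
        by (simp add: sum.union_disjoint disjoint_iff)
      moreover have "(\<Sum>j\<le>k. v j) - (\<Sum>j\<le>k. u j) = (\<Sum>j\<le>k. p j)" by (simp add: u_def sum_subtractf)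
      ultimately have "(\<Sum>j\<le>k. v j) - (\<Sum>j<n. u j) = - (\<Sum>j\<in>{k<..<n}. u j) + (\<Sum>j\<le>k. p j)"
        by (simp add: algebra_simps)
      then have "c k - S 0 k (\<Sum>j<n. u j) = S 0 k (- (\<Sum>j\<in>{k<..<n}. u j) + (\<Sum>j\<le>k. p j))"
        by (simp add: ck linear_diff[OF S_linear, symmetric])
      also have "\<dots> = - (\<Sum>j\<in>{k<..<n}. S 0 k (u j)) + S 0 k (\<Sum>j\<le>k. p j)"
        by (simp only: linear_add[OF S_linear] linear_neg[OF S_linear] linear_sum[OF S_linear])
      finally have eq: "c k - S 0 k (\<Sum>j<n. u j) = - (\<Sum>j\<in>{k<..<n}. S 0 k (u j)) + S 0 k (\<Sum>j\<le>k. p j)" .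
      have "(\<Sum>j\<le>k. p j) \<in> Gs 0" using vp(2) by (intro subspace_sum[OF subspace_Gs])
      then have "S 0 k (\<Sum>j\<le>k. p j) \<in> Gs k" using S_Gs_iff by simp
      then have "infdist (c k - S 0 k (\<Sum>j<n. u j)) (Gs k) \<le> infdist (- (\<Sum>j\<in>{k<..<n}. S 0 k (u j))) (Gs k)"
        unfolding eq by (rule infdist_subspace_add_mem[OF subspace_Gs])
      also have "\<dots> \<le> infdist (\<Sum>j\<in>{k<..<n}. S 0 k (u j)) (Gs k)" by (rule infdist_subspace_minus[OF subspace_Gs])
      also have "\<dots> \<le> (\<Sum>j\<in>{k<..<n}. infdist (S 0 k (u j)) (Gs k))"
        by (rule infdist_subspace_sum[OF subspace_Gs]) simp
      also have "\<dots> \<le> (\<Sum>j\<in>{k<..<n}. (C * K') * N k powr - (\<eta> / 4) * N j powr - (\<eta> / 4))"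
        by (intro sum_mono e) auto
      also have "\<dots> = (C * K') * N k powr - (\<eta> / 4) * (\<Sum>j\<in>{k<..<n}. N j powr - (\<eta> / 4))"
        by (simp add: sum_distrib_left)
      also have "\<dots> \<le> (C * K') * N k powr - (\<eta> / 4) * (M + 1)"
        using C(1) K'(1) \<eta> sum_N_le_suminf[of "\<eta> / 4" "{k<..<n}"] by (intro mult_left_mono) (auto simp: M_def)
      finally show ?thesis by (simp add: mult_ac)
    qed
    have "(\<lambda>n. c k - S 0 k (\<Sum>j<n. u j)) \<longlonglongrightarrow> c k - S 0 k \<xi>"
    proof (intro tendsto_intros)
      have "isCont (S 0 k) \<xi>" using linear_continuous_at[of "S 0 k"] S_linear linear_conv_bounded_linear by blast
      then show "(\<lambda>n. S 0 k (\<Sum>j<n. u j)) \<longlonglongrightarrow> S 0 k \<xi>"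
        using summable_LIMSEQ[OF \<open>summable u\<close>] isCont_tendsto_compose unfolding \<xi>_def by blast
    qed
    then have "(\<lambda>n. infdist (c k - S 0 k (\<Sum>j<n. u j)) (Gs k)) \<longlonglongrightarrow> infdist (c k - S 0 k \<xi>) (Gs k)"
      by (rule tendsto_infdist)
    then show ?thesis
      by (rule tendsto_upperbound) (use fin in \<open>auto simp: eventually_sequentially intro!: exI[of _ "Suc k"]\<close>)
  qed
  then show ?thesis using that[of "C * K' * (M + 1)" \<xi>] C(1) K'(1) M by simp
qed

text \<open>After \<open>quotient_correction\<close> the remainder \<open>b\<close> is close to the
  stable spaces. Its nearest points \<open>q k\<close> there have small increments again, now stable
  ones, so \<open>S_Gs_bound\<close> makes them decay and \<open>\<xi>\<close> needs no further
  change.\<close>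

lemma correction:
  assumes \<eta>: "0 < \<eta>" and inc: "\<And>k. norm (c (Suc k) - S k (Suc k) (c k)) \<le> K * N (Suc k) powr (- \<eta>)"
  obtains \<xi> \<rho> C where "0 < \<rho>" "0 < C" "\<And>k. norm (c k - S 0 k \<xi>) \<le> C * N k powr (- \<rho>)"
proof -
  obtain \<xi> A where A: "0 < A" "\<And>k. infdist (c k - S 0 k \<xi>) (Gs k) \<le> A * N k powr (- (\<eta> / 4))"
    using quotient_correction[OF assms] by blast
  define b where "b k = c k - S 0 k \<xi>" for k
  define \<eta>1 where "\<eta>1 = \<eta> / 4"
  have \<eta>1: "0 < \<eta>1" "\<eta>1 \<le> \<eta>" using \<eta> by (auto simp: \<eta>1_def)
  have "\<exists>p. p \<in> Gs k \<and> infdist (b k) (Gs k) = norm (b k - p)" for k using Gs_nearest by metis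
  then obtain q where q: "\<And>k. q k \<in> Gs k" "\<And>k. infdist (b k) (Gs k) = norm (b k - q k)" by metis
  have bq: "norm (b k - q k) \<le> A * N k powr (- \<eta>1)" for k
    using A(2)[of k] q(2)[of k] by (simp add: b_def \<eta>1_def)
  obtain D where D: "0 < D" "\<And>k. mnorm (Q k (Suc k)) \<le> D * N k powr (\<eta>1 / 2)"
    using Z_bound[of "\<eta>1 / 2"] \<eta>1 by (metis half_gt_zero)
  obtain E where E: "0 < E" "\<And>k. N k powr (- (\<eta>1 / 2)) \<le> E * N (Suc k) powr (- (\<eta>1 / 2 / 2))"
    using N_Suc_powr[of "\<eta>1 / 2"] \<eta>1 by (metis half_gt_zero)
  \<comment> \<open>One halving pays for the norm of the block, the other for measuring at level
    \<open>Suc k\<close>.\<close>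
  define \<eta>2 where "\<eta>2 = \<eta>1 / 2 / 2"
  have \<eta>2: "0 < \<eta>2" "\<eta>2 \<le> \<eta>1" using \<eta>1 by (auto simp: \<eta>2_def)
  have qinc: "norm (q (Suc k) - S k (Suc k) (q k)) \<le> (A + \<bar>K\<bar> + D * A * E) * N (Suc k) powr (- \<eta>2)" for k
  proof -
    have "b (Suc k) - S k (Suc k) (b k) = c (Suc k) - S k (Suc k) (c k)"
      by (simp add: b_def linear_diff[OF S_linear] S_comp)
    then have "q (Suc k) - S k (Suc k) (q k) =
      - (b (Suc k) - q (Suc k)) + (c (Suc k) - S k (Suc k) (c k)) + S k (Suc k) (b k - q k)"
      by (simp add: linear_diff[OF S_linear] algebra_simps)
    then have "norm (q (Suc k) - S k (Suc k) (q k)) \<le>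
      norm (b (Suc k) - q (Suc k)) + norm (c (Suc k) - S k (Suc k) (c k)) + norm (S k (Suc k) (b k - q k))"
      by (metis (no_types, lifting) norm_minus_cancel norm_triangle_ineq norm_triangle_mono order_refl)
    moreover have "norm (b (Suc k) - q (Suc k)) \<le> A * N (Suc k) powr (- \<eta>2)"
      using bq[of "Suc k"] powr_mono[of "- \<eta>1" "- \<eta>2" "N (Suc k)"] \<eta>2 N_ge[of "Suc k"] A(1)
      by (meson neg_le_iff_le mult_left_mono less_imp_le order_trans)
    moreover have "norm (c (Suc k) - S k (Suc k) (c k)) \<le> \<bar>K\<bar> * N (Suc k) powr (- \<eta>2)"
    proof -
      have "K * N (Suc k) powr (- \<eta>) \<le> \<bar>K\<bar> * N (Suc k) powr (- \<eta>2)"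
        using \<eta>1 \<eta>2 N_ge[of "Suc k"] by (intro mult_mono powr_mono) auto
      then show ?thesis using inc[of k] by linarith
    qed
    moreover have "norm (S k (Suc k) (b k - q k)) \<le> D * A * E * N (Suc k) powr (- \<eta>2)"
    proof -
      have "norm (S k (Suc k) (b k - q k)) \<le> (D * N k powr (\<eta>1 / 2)) * (A * N k powr (- \<eta>1))"
        using D A(1) bq[of k] by (intro order.trans[OF S_bound] mult_mono) auto
      also have "\<dots> = D * A * (N k powr (\<eta>1 / 2) * N k powr (- \<eta>1))" by simp
      also have "\<dots> = D * A * N k powr (- (\<eta>1 / 2))" by (simp add: powr_add[symmetric])
      also have "\<dots> \<le> D * A * (E * N (Suc k) powr (- \<eta>2))"
        unfolding \<eta>2_def using D A by (intro mult_left_mono E) auto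
      finally show ?thesis by (simp add: mult_ac)
    qed
    ultimately show ?thesis by (simp add: distrib_right)
  qed
  obtain K' where K': "0 < K'" "\<And>k. norm (increment q k) \<le> K' * N k powr (- \<eta>2)"
    using increment_bound[OF qinc] by blast
  have qG: "increment q k \<in> Gs k" for k
    by (cases k) (auto simp: increment_def q S_Gs_iff intro!: subspace_diff[OF subspace_Gs])
  obtain \<rho> C where C: "0 < \<rho>" "0 < C"
    "\<And>k l v. k \<le> l \<Longrightarrow> v \<in> Gs k \<Longrightarrow> norm (S k l v) \<le> C * N l powr (- \<rho>) * N k powr (\<eta>2 / 2) * norm v"
    using S_Gs_bound[of "\<eta>2 / 2"] \<eta>2 by (metis half_gt_zero)
  define M where "M = (\<Sum>j. N j powr - (\<eta>2 / 2))"
  have M: "0 \<le> M" unfolding M_def using \<eta>2 by (intro suminf_nonneg summable_N) auto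
  have qk: "norm (q k) \<le> (C * K' * M) * N k powr (- \<rho>)" for k
  proof -
    have "norm (q k) \<le> (\<Sum>j\<le>k. norm (S j k (increment q j)))"
      by (subst increment_sum) (rule norm_sum)
    also have "\<dots> \<le> (\<Sum>j\<le>k. C * N k powr (- \<rho>) * N j powr (\<eta>2 / 2) * (K' * N j powr (- \<eta>2)))"
    proof (intro sum_mono)
      fix j assume j: "j \<in> {..k}"
      have "norm (S j k (increment q j)) \<le> C * N k powr (- \<rho>) * N j powr (\<eta>2 / 2) * norm (increment q j)"
        using j qG by (intro C) auto
      also have "\<dots> \<le> C * N k powr (- \<rho>) * N j powr (\<eta>2 / 2) * (K' * N j powr (- \<eta>2))"
        using C by (intro mult_left_mono K') auto
      finally show "norm (S j k (increment q j)) \<le> C * N k powr (- \<rho>) * N j powr (\<eta>2 / 2) * (K' * N j powr (- \<eta>2))" .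
    qed
    also have "\<dots> = (\<Sum>j\<le>k. (C * K' * N k powr (- \<rho>)) * (N j powr (\<eta>2 / 2) * N j powr (- \<eta>2)))"
      by (simp add: mult_ac)
    also have "\<dots> = (C * K' * N k powr (- \<rho>)) * (\<Sum>j\<le>k. N j powr - (\<eta>2 / 2))"
      by (simp add: sum_distrib_left powr_add[symmetric])
    also have "\<dots> \<le> (C * K' * N k powr (- \<rho>)) * M"
      unfolding M_def using C K'(1) \<eta>2 by (intro mult_left_mono sum_N_le_suminf) auto
    finally show ?thesis by (simp add: mult_ac)
  qed
  define r where "r = min \<rho> \<eta>1"
  have "norm (c k - S 0 k \<xi>) \<le> (A + C * K' * M) * N k powr (- r)" for k
  proof -
    have "norm (b k) \<le> norm (b k - q k) + norm (q k)" by (metis add.commute diff_add_cancel norm_triangle_ineq)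
    also have "\<dots> \<le> A * N k powr (- r) + (C * K' * M) * N k powr (- r)"
    proof (intro add_mono)
      show "norm (b k - q k) \<le> A * N k powr (- r)"
        by (rule order.trans[OF bq]) (use A N_ge[of k] in \<open>auto simp: r_def intro!: mult_left_mono powr_mono\<close>)
      show "norm (q k) \<le> C * K' * M * N k powr (- r)"
        by (rule order.trans[OF qk]) (use C K' M N_ge[of k] in \<open>auto simp: r_def intro!: mult_left_mono powr_mono\<close>)
    qed
    finally show ?thesis by (simp add: b_def distrib_right)
  qed
  moreover have "0 < r" using C \<eta>1 by (simp add: r_def)
  moreover have "0 < A + C * K' * M" using A C K' M by (simp add: add_pos_nonneg)
  ultimately show ?thesis using that by blast
qed

end

section \<open>Absolute continuity and bounded variation\<close>

text \<open>The open intervals are disjoint even where the closed ones share end points.\<close>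

lemma sum_nonoverlapping_lengths_le:
  fixes a b :: "'i \<Rightarrow> real"
  assumes fin: "finite A" and U: "U \<in> lmeasurable"
    and sub: "\<And>i. i \<in> A \<Longrightarrow> a i \<le> b i \<and> {a i..b i} \<subseteq> U"
    and disj: "\<And>i j. i \<in> A \<Longrightarrow> j \<in> A \<Longrightarrow> i \<noteq> j \<Longrightarrow> b i \<le> a j \<or> b j \<le> a i"
  shows "(\<Sum>i\<in>A. b i - a i) \<le> measure lebesgue U"
proof -
  have "disjoint_family_on (\<lambda>i. {a i<..<b i}) A"
    unfolding disjoint_family_on_def using disj by fastforce
  then have "measure lebesgue (\<Union>i\<in>A. {a i<..<b i}) = (\<Sum>i\<in>A. measure lebesgue {a i<..<b i})"
    using fin sub by (intro measure_finite_Union) auto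
  also have "\<dots> = (\<Sum>i\<in>A. b i - a i)" using sub by (intro sum.cong) auto
  finally have "(\<Sum>i\<in>A. b i - a i) = measure lebesgue (\<Union>i\<in>A. {a i<..<b i})" by simp
  also have "\<dots> \<le> measure lebesgue U"
    using sub U fin by (intro measure_mono_fmeasurable) (auto simp: subset_iff)
  finally show ?thesis .
qed

text \<open>The fundamental theorem by a gauge. At tags outside the exceptional null set
  \<open>Z\<close> the gauge enforces the differentiability estimate. At tags in \<open>Z\<close>,
  where the integrand is set to 0, it forces the intervals into an open set of measure below
  \<open>\<delta>\<close>, and absolute continuity bounds the increments of \<open>F\<close>
  there.\<close>

lemma abs_continuous_on_has_integral:
  fixes F f :: "real \<Rightarrow> real"
  assumes ac: "abs_continuous_on F J" and J: "{x..y} \<subseteq> J" "x \<le> y"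
    and der: "AE t in lebesgue. t \<in> J \<longrightarrow> (F has_real_derivative f t) (at t within J)"
  shows "(f has_integral (F y - F x)) {x..y}"
proof -
  obtain Z where Z: "Z \<in> null_sets lebesgue"
    "\<And>t. t \<in> J \<Longrightarrow> t \<notin> Z \<Longrightarrow> (F has_real_derivative f t) (at t within J)"
    using der unfolding eventually_ae_filter by fastforce
  have negZ: "negligible Z" using Z(1) by (simp add: negligible_iff_null_sets)
  define g where "g t = (if t \<in> Z then 0 else f t)" for t
  have "(g has_integral (F y - F x)) {x..y}"
    unfolding has_integral_real
  proof (intro allI impI)
    fix e :: real assume e: "0 < e"
    obtain \<delta> where \<delta>1: "0 < \<delta>" "\<forall>(n::nat) a b. (\<forall>i<n. a i \<in> J \<and> b i \<in> J \<and> a i \<le> b i) \<and>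
        (\<forall>i<n. \<forall>j<n. i \<noteq> j \<longrightarrow> b i \<le> a j \<or> b j \<le> a i) \<and>
        (\<Sum>i<n. b i - a i) < \<delta> \<longrightarrow> (\<Sum>i<n. \<bar>F (b i) - F (a i)\<bar>) < e / 2"
      using ac[unfolded abs_continuous_on_def, rule_format, of "e / 2"] e by auto
    have \<delta>: "0 < \<delta>" "(\<Sum>i<n. \<bar>F (b i) - F (a i)\<bar>) < e / 2"
      if "\<forall>i<n. a i \<in> J \<and> b i \<in> J \<and> a i \<le> b i"
        "\<forall>i<n. \<forall>j<n. i \<noteq> j \<longrightarrow> b i \<le> a j \<or> b j \<le> a i"
        "(\<Sum>i<n. b i - a i) < \<delta>" for n :: nat and a b
      using \<delta>1(1) \<delta>1(2)[rule_format, of n a b] that by blast+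
    obtain U where U: "open U" "Z \<subseteq> U" "U \<in> lmeasurable" "measure lebesgue U < \<delta>"
    proof -
      obtain U where U: "open U" "Z \<subseteq> U" "U - Z \<in> lmeasurable" "emeasure lebesgue (U - Z) < ennreal \<delta>"
        using sets_lebesgue_outer_open[of Z \<delta>] negligible_imp_sets[OF negZ] \<delta>1(1) by blast
      have "measure lebesgue (U - Z) < \<delta>"
        using U(3,4) \<delta>1(1) by (simp add: emeasure_eq_measure2 ennreal_less_iff)
      moreover have UZ: "(U - Z) \<union> Z = U" using U(2) by auto
      moreover have "U \<in> lmeasurable"
        using fmeasurable.Un[OF U(3) negligible_imp_measurable[OF negZ]] UZ by simp
      moreover have "measure lebesgue U \<le> measure lebesgue (U - Z) + measure lebesgue Z"
        using measure_Un_le[of "U - Z" lebesgue Z] U(3) negligible_imp_sets[OF negZ] UZ by (simp add: fmeasurableD)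
      ultimately show ?thesis using that U(1,2) negligible_imp_measure0[OF negZ] by auto
    qed
    define \<eta> where "\<eta> = e / (2 * (y - x + 1))"
    have \<eta>: "0 < \<eta>" "\<eta> * (y - x) < e / 2"
    proof -
      show "0 < \<eta>" using e J(2) by (simp add: \<eta>_def)
      then have "\<eta> * (y - x) < \<eta> * (y - x + 1)" by simp
      also have "\<dots> = e / 2"
      proof -
        have "e / (2 * c) * c = e / 2" if "0 < c" for c :: real using that by simp
        from this[of "y - x + 1"] show ?thesis using J(2) unfolding \<eta>_def by linarith
      qed
      finally show "\<eta> * (y - x) < e / 2" .
    qed
    have "\<exists>r>0. t \<in> J \<longrightarrow> t \<notin> Z \<longrightarrow> (\<forall>u\<in>J. \<bar>u - t\<bar> < r \<longrightarrow> \<bar>F u - F t - f t * (u - t)\<bar> \<le> \<eta> * \<bar>u - t\<bar>)" for t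
    proof (cases "t \<in> J \<and> t \<notin> Z")
      case True
      then have "(F has_derivative (*) (f t)) (at t within J)"
        using Z(2) by (simp add: has_field_derivative_def)
      then show ?thesis using \<eta>(1) unfolding has_derivative_within_alt by auto
    next
      case False
      then show ?thesis by (intro exI[of _ 1]) auto
    qed
    then obtain r where r: "\<And>t. 0 < r t"
      "\<And>t u. t \<in> J \<Longrightarrow> t \<notin> Z \<Longrightarrow> u \<in> J \<Longrightarrow> \<bar>u - t\<bar> < r t \<Longrightarrow> \<bar>F u - F t - f t * (u - t)\<bar> \<le> \<eta> * \<bar>u - t\<bar>"
      by metis
    define \<gamma> where "\<gamma> t = (if t \<in> Z then U else ball t (r t))" for t
    have gauge: "gauge \<gamma>" using U r(1) by (auto simp: gauge_def \<gamma>_def)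
    have main: "norm ((\<Sum>(t, K)\<in>D. measure lborel K *\<^sub>R g t) - (F y - F x)) < e"
      if D: "D tagged_division_of {x..y}" and fine: "\<gamma> fine D" for D
    proof -
      have finD: "finite D" using D by auto
      have K: "K = {Inf K..Sup K} \<and> Inf K \<le> t \<and> t \<le> Sup K \<and> K \<subseteq> J \<and> K \<subseteq> \<gamma> t \<and> Inf K \<in> K \<and> Sup K \<in> K \<and> t \<in> K"
        if tK: "(t, K) \<in> D" for t K
      proof -
        obtain u v where uv: "K = {u..v}" using tagged_division_ofD(4)[OF D tK] by (auto simp: box_real)
        have t: "t \<in> K" "K \<subseteq> {x..y}" using tagged_division_ofD(2,3)[OF D tK] by auto
        then have "Inf K = u" "Sup K = v" using uv by auto
        moreover have "K \<subseteq> \<gamma> t" using fine tK by (auto simp: fine_def)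
        ultimately show ?thesis using uv t J(1) by auto
      qed
      have cont: "measure lborel K = Sup K - Inf K" if "(t, K) \<in> D" for t K
      proof -
        have "measure lborel {Inf K..Sup K} = Sup K - Inf K" using K[OF that] by (intro content_real) auto
        then show ?thesis using K[OF that] by simp
      qed
      define D1 where "D1 = {p \<in> D. fst p \<notin> Z}"
      define D2 where "D2 = {p \<in> D. fst p \<in> Z}"
      define h where "h p = F (Sup (snd p)) - F (Inf (snd p))" for p :: "real \<times> real set"
      have Dsplit: "D = D1 \<union> D2" "D1 \<inter> D2 = {}" "finite D1" "finite D2" using finD by (auto simp: D1_def D2_def)
      have tel: "(\<Sum>p\<in>D. h p) = F y - F x"
        using additive_tagged_division_1[OF J(2) D, of F] by (simp add: h_def case_prod_beta)
      have "(\<Sum>(t, K)\<in>D. measure lborel K *\<^sub>R g t) - (F y - F x) = (\<Sum>p\<in>D. measure lborel (snd p) * g (fst p) - h p)"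
        by (simp add: tel[symmetric] sum_subtractf case_prod_beta)
      also have "\<dots> = (\<Sum>p\<in>D1. measure lborel (snd p) * g (fst p) - h p) + (\<Sum>p\<in>D2. measure lborel (snd p) * g (fst p) - h p)"
        using Dsplit by (metis (no_types, lifting) sum.union_disjoint)
      finally have eq: "(\<Sum>(t, K)\<in>D. measure lborel K *\<^sub>R g t) - (F y - F x) = \<dots>" .
      have "\<bar>\<Sum>p\<in>D1. measure lborel (snd p) * g (fst p) - h p\<bar> \<le> (\<Sum>p\<in>D1. \<eta> * measure lborel (snd p))"
      proof (rule order.trans[OF sum_abs], rule sum_mono)
        fix p assume "p \<in> D1"
        then obtain t K' where p: "p = (t, K')" "(t, K') \<in> D" "t \<notin> Z" by (cases p) (auto simp: D1_def)
        note k = K[OF p(2)]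
        define u where "u = Inf K'" define v where "v = Sup K'"
        have bd: "\<bar>F w - F t - f t * (w - t)\<bar> \<le> \<eta> * \<bar>w - t\<bar>" if "w \<in> K'" for w
        proof (rule r(2))
          have "w \<in> ball t (r t)" using k p(3) that by (auto simp: \<gamma>_def)
          then show "\<bar>w - t\<bar> < r t" by (simp add: dist_real_def abs_minus_commute)
        qed (use k p(3) that in auto)
        have uv: "u \<in> K'" "v \<in> K'" "u \<le> t" "t \<le> v" using k unfolding u_def v_def by blast+
        have "\<bar>F v - F t - f t * (v - t)\<bar> \<le> \<eta> * (v - t)" "\<bar>F u - F t - f t * (u - t)\<bar> \<le> \<eta> * (t - u)"
          using bd[OF uv(2)] bd[OF uv(1)] uv(3,4) by simp_all
        \<comment> \<open>Straddle estimate: the tag lies between the end points, so the two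
          one-sided errors add up to \<open>\<eta>\<close> times the length.\<close>
        then have "\<bar>- (F v - F t - f t * (v - t)) + (F u - F t - f t * (u - t))\<bar> \<le> \<eta> * (v - t) + \<eta> * (t - u)"
          by linarith
        moreover have "- (F v - F t - f t * (v - t)) + (F u - F t - f t * (u - t)) = (v - u) * f t - (F v - F u)"
          by (simp add: algebra_simps)
        moreover have "\<eta> * (v - t) + \<eta> * (t - u) = \<eta> * (v - u)" by (simp add: algebra_simps)
        moreover have "measure lborel (snd p) = v - u" "g (fst p) = f t" "h p = F v - F u"
          using p cont[OF p(2)] by (auto simp: h_def g_def u_def v_def)
        ultimately show "\<bar>measure lborel (snd p) * g (fst p) - h p\<bar> \<le> \<eta> * measure lborel (snd p)" by simp
      qed
      also have "\<dots> \<le> (\<Sum>p\<in>D. \<eta> * measure lborel (snd p))"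
        using finD \<eta>(1) by (intro sum_mono2) (auto simp: D1_def)
      also have "\<dots> = \<eta> * (y - x)"
        using additive_content_tagged_division[of D x y] D J(2)
        by (simp add: sum_distrib_left[symmetric] case_prod_beta box_real)
      finally have 1: "\<bar>\<Sum>p\<in>D1. measure lborel (snd p) * g (fst p) - h p\<bar> < e / 2" using \<eta>(2) by simp
      \<comment> \<open>Degenerate intervals contribute nothing and have to be dropped: one of them
        may sit inside another interval of the division, which would violate the non-overlap
        condition in absolute continuity.\<close>
      define D3 where "D3 = {p \<in> D2. Inf (snd p) < Sup (snd p)}"
      have fin3: "finite D3" using Dsplit by (simp add: D3_def)
      have sep: "Sup (snd p) \<le> Inf (snd q) \<or> Sup (snd q) \<le> Inf (snd p)"
        if pq: "p \<in> D3" "q \<in> D3" "p \<noteq> q" for p q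
      proof -
        obtain t K1 where p: "p = (t, K1)" by (cases p)
        obtain t' K2 where q: "q = (t', K2)" by (cases q)
        have in_D: "(t, K1) \<in> D" "(t', K2) \<in> D" using pq p q by (auto simp: D3_def D2_def)
        have "interior K1 \<inter> interior K2 = {}"
          using tagged_division_ofD(5)[OF D in_D] pq(3) p q by auto
        then have "{Inf K1<..<Sup K1} \<inter> {Inf K2<..<Sup K2} = {}"
        proof -
          have "{Inf k<..<Sup k} \<subseteq> interior k" if "(r, k) \<in> D" for r k
          proof (rule interior_maximal)
            have "k = {Inf k..Sup k}" using K[OF that] by blast
            then show "{Inf k<..<Sup k} \<subseteq> k" by force
          qed simp
          then show ?thesis using in_D \<open>interior K1 \<inter> interior K2 = {}\<close> by blast
        qed
        then have "(max (Inf K1) (Inf K2) + min (Sup K1) (Sup K2)) / 2 \<notin> {Inf K1<..<Sup K1} \<inter> {Inf K2<..<Sup K2}"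
          by simp
        then show ?thesis using pq p q by (auto simp: D3_def max_def min_def split: if_splits)
      qed
      have "(\<Sum>p\<in>D3. Sup (snd p) - Inf (snd p)) \<le> measure lebesgue U"
      proof (rule sum_nonoverlapping_lengths_le[OF fin3 U(3)])
        fix p assume "p \<in> D3"
        then obtain t K1 where p: "p = (t, K1)" "(t, K1) \<in> D" "t \<in> Z" by (cases p) (auto simp: D3_def D2_def)
        then show "Inf (snd p) \<le> Sup (snd p) \<and> {Inf (snd p)..Sup (snd p)} \<subseteq> U"
          using K[OF p(2)] by (auto simp: \<gamma>_def)
      qed (use sep in auto)
      then have len: "(\<Sum>p\<in>D3. Sup (snd p) - Inf (snd p)) < \<delta>" using U(4) by simp
      obtain n where enum: "bij_betw n {0..<card D3} D3" using ex_bij_betw_nat_finite[OF fin3] by blast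
      then have enum': "bij_betw n {..<card D3} D3" by (simp add: atLeast0LessThan)
      have "(\<Sum>i<card D3. \<bar>F (Sup (snd (n i))) - F (Inf (snd (n i)))\<bar>) < e / 2"
      proof (rule \<delta>(2))
        show "\<forall>i<card D3. Inf (snd (n i)) \<in> J \<and> Sup (snd (n i)) \<in> J \<and> Inf (snd (n i)) \<le> Sup (snd (n i))"
        proof (intro allI impI)
          fix i assume "i < card D3"
          then have "n i \<in> D3" using enum' by (auto simp: bij_betw_def)
          then obtain t K1 where p: "n i = (t, K1)" "(t, K1) \<in> D" by (cases "n i") (auto simp: D3_def D2_def)
          then show "Inf (snd (n i)) \<in> J \<and> Sup (snd (n i)) \<in> J \<and> Inf (snd (n i)) \<le> Sup (snd (n i))"
            using K[OF p(2)] by auto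
        qed
        show "\<forall>i<card D3. \<forall>j<card D3. i \<noteq> j \<longrightarrow> Sup (snd (n i)) \<le> Inf (snd (n j)) \<or> Sup (snd (n j)) \<le> Inf (snd (n i))"
        proof (intro allI impI)
          fix i j assume ij: "i < card D3" "j < card D3" "i \<noteq> j"
          then have "n i \<in> D3" "n j \<in> D3" "n i \<noteq> n j" using enum' by (auto simp: bij_betw_def inj_on_def)
          then show "Sup (snd (n i)) \<le> Inf (snd (n j)) \<or> Sup (snd (n j)) \<le> Inf (snd (n i))" by (rule sep)
        qed
        show "(\<Sum>i<card D3. Sup (snd (n i)) - Inf (snd (n i))) < \<delta>"
          using len sum.reindex_bij_betw[OF enum', of "\<lambda>p. Sup (snd p) - Inf (snd p)"] by simp
      qed
      then have 3: "(\<Sum>p\<in>D3. \<bar>h p\<bar>) < e / 2"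
        using sum.reindex_bij_betw[OF enum', of "\<lambda>p. \<bar>h p\<bar>"] by (simp add: h_def)
      have "(\<Sum>p\<in>D2. measure lborel (snd p) * g (fst p) - h p) = (\<Sum>p\<in>D2. - h p)"
        by (intro sum.cong) (auto simp: D2_def g_def)
      also have "\<dots> = (\<Sum>p\<in>D3. - h p)"
      proof (intro sum.mono_neutral_right)
        show "\<forall>p\<in>D2 - D3. - h p = 0"
        proof
          fix p assume p: "p \<in> D2 - D3"
          then obtain t K1 where "p = (t, K1)" "(t, K1) \<in> D" by (cases p) (auto simp: D2_def)
          then have "Inf (snd p) \<le> Sup (snd p)" using K[of t K1] by auto
          then have "Inf (snd p) = Sup (snd p)" using p by (auto simp: D3_def)
          then show "- h p = 0" by (simp add: h_def)
        qed
      qed (use Dsplit in \<open>auto simp: D3_def\<close>)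
      finally have "\<bar>\<Sum>p\<in>D2. measure lborel (snd p) * g (fst p) - h p\<bar> \<le> (\<Sum>p\<in>D3. \<bar>h p\<bar>)"
        using sum_abs[of "\<lambda>p. - h p" D3] by simp
      then show ?thesis using 1 3 unfolding eq real_norm_def by linarith
    qed
    show "\<exists>\<gamma>. gauge \<gamma> \<and> (\<forall>D. D tagged_division_of {x..y} \<and> \<gamma> fine D \<longrightarrow>
        norm ((\<Sum>(x, K)\<in>D. measure lborel K *\<^sub>R g x) - (F y - F x)) < e)"
    proof (rule exI[of _ \<gamma>], intro conjI allI impI)
      fix D assume "D tagged_division_of {x..y} \<and> \<gamma> fine D"
      then show "norm ((\<Sum>(x, K)\<in>D. measure lborel K *\<^sub>R g x) - (F y - F x)) < e"
        using main[of D] by (simp only: simp_thms)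
    qed (rule gauge)
  qed
  then show ?thesis
    by (rule has_integral_spike[OF negZ, rotated]) (auto simp: g_def)
qed

text \<open>The majorant is the variation of \<open>f\<close> to the left of a point.\<close>

lemma bounded_variation_on_majorant:
  assumes "bounded_variation_on f J"
  obtains g B where "\<And>x. x \<in> J \<Longrightarrow> 0 \<le> g x \<and> g x \<le> B"
    "\<And>x y. x \<in> J \<Longrightarrow> y \<in> J \<Longrightarrow> x \<le> y \<Longrightarrow> \<bar>f y - f x\<bar> \<le> g y - g x"
proof -
  obtain B where B: "\<And>(n::nat) p. (\<forall>i\<le>n. p i \<in> J) \<Longrightarrow> (\<forall>i<n. p i \<le> p (Suc i)) \<Longrightarrow>
      (\<Sum>i<n. \<bar>f (p (Suc i)) - f (p i)\<bar>) \<le> B"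
    using assms unfolding bounded_variation_on_def by blast
  define P where "P x = {(\<Sum>i<n. \<bar>f (p (Suc i)) - f (p i)\<bar>) |(n::nat) p.
     (\<forall>i\<le>n. p i \<in> J) \<and> (\<forall>i<n. p i \<le> p (Suc i)) \<and> p n \<le> x}" for x
  define g where "g x = Sup (P x)" for x
  have bdd: "bdd_above (P x)" for x
    using B by (intro bdd_aboveI[of _ B]) (auto simp: P_def)
  have P0: "0 \<in> P x" if "x \<in> J" for x
    using that by (auto simp: P_def intro!: exI[of _ "0::nat"] exI[of _ "\<lambda>_. x"])
  have b: "0 \<le> g x \<and> g x \<le> B" if "x \<in> J" for x
  proof
    show "0 \<le> g x" unfolding g_def using P0[OF that] bdd by (intro cSup_upper)
    show "g x \<le> B" unfolding g_def using P0[OF that] B by (intro cSup_least) (auto simp: P_def)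
  qed
  moreover have "\<bar>f y - f x\<bar> \<le> g y - g x" if x: "x \<in> J" and y: "y \<in> J" and xy: "x \<le> y" for x y
  proof -
    have "z \<le> g y - \<bar>f y - f x\<bar>" if z: "z \<in> P x" for z
    proof -
      obtain n p where np: "z = (\<Sum>i<n. \<bar>f (p (Suc i)) - f (p i)\<bar>)" "\<And>i. i \<le> n \<Longrightarrow> p i \<in> J"
        "\<And>i. i < n \<Longrightarrow> p i \<le> p (Suc i)" "p n \<le> x" using z by (auto simp: P_def)
      \<comment> \<open>Appending \<open>x\<close> and \<open>y\<close> to a chain that ends at or
        before \<open>x\<close> adds at least \<open>\<bar>f y - f x\<bar>\<close> to its
        variation.\<close>
      define q where "q i = (if i \<le> n then p i else if i = Suc n then x else y)" for i
      have "(\<Sum>i<Suc (Suc n). \<bar>f (q (Suc i)) - f (q i)\<bar>) = z + \<bar>f x - f (p n)\<bar> + \<bar>f y - f x\<bar>"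
        unfolding np(1) by (simp add: q_def)
      moreover have "(\<Sum>i<Suc (Suc n). \<bar>f (q (Suc i)) - f (q i)\<bar>) \<in> P y"
        unfolding P_def
        by (rule CollectI, rule exI[of _ "Suc (Suc n)"], rule exI[of _ q])
          (use np(2-4) x y xy in \<open>auto simp: q_def le_Suc_eq less_Suc_eq\<close>)
      then have "(\<Sum>i<Suc (Suc n). \<bar>f (q (Suc i)) - f (q i)\<bar>) \<le> g y"
        unfolding g_def using bdd by (intro cSup_upper)
      ultimately show ?thesis by linarith
    qed
    then have "g x \<le> g y - \<bar>f y - f x\<bar>" unfolding g_def[of x] using P0[OF x] by (intro cSup_least) auto
    then show ?thesis by linarith
  qed
  ultimately show ?thesis using that by blast
qed

section \<open>Special Birkhoff sums\<close>

context keane_iem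
begin

text \<open>Special Birkhoff sums in normalised coordinates: \<open>special_sum F n a\<close> lives on \<open>[0, lam n a)\<close>, the
  piece \<open>a\<close> of level \<open>n\<close> translated to the origin.\<close>

primrec special_sum :: "('a \<Rightarrow> real \<Rightarrow> real) \<Rightarrow> nat \<Rightarrow> 'a \<Rightarrow> real \<Rightarrow> real" where
  "special_sum F 0 = F"
| "special_sum F (Suc n) = (\<lambda>a y. special_sum F n a y +
     (if a = los n then special_sum F n (win n) (y + (lam n (win n) - lam n (los n))) else 0))"

lemma lam_Suc_less:
  assumes "y < lam (Suc n) a"
  shows "y < lam n a" "a = los n \<Longrightarrow> y + (lam n (win n) - lam n (los n)) < lam n (win n)"
    "a = win n \<Longrightarrow> y < lam n (win n) - lam n (los n)"
  using assms lam_pos[of n "los n"] win_neq_los[of n] by (auto simp: lam_Suc split: if_splits)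

lemma transpose_W_Suc:
  "n \<le> m \<Longrightarrow> (transpose (W n (Suc m)) *v c) $ a =
     (transpose (W n m) *v c) $ a + (if a = los m then (transpose (W n m) *v c) $ win m else 0)"
  by (auto simp: matrix_vector_mult_def transpose_def W_Suc_entry distrib_right sum.distrib
      simp del: transpose_matrix_vector)

lemma special_sum_diff_const:
  "special_sum (\<lambda>a y. F a y - c $ a) n a y = special_sum F n a y - (transpose (W 0 n) *v c) $ a"
proof (induction n arbitrary: a y)
  case 0
  then show ?case by (simp add: W_refl transpose_mat del: transpose_matrix_vector)
next
  case (Suc n)
  then show ?case by (simp add: transpose_W_Suc del: transpose_matrix_vector)
qed

text \<open>The value on piece \<open>a\<close> of level \<open>m\<close> is a sum of
  level-\<open>n\<close> values, and the column sum of \<open>W n m\<close> counts its terms. The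
  bound by the column sum is the one that passes through the induction. With \<open>c = 0\<close> it
  bounds special sums between two accelerated levels.\<close>

lemma special_sum_approx:
  assumes "\<And>a y. 0 \<le> y \<Longrightarrow> y < lam n a \<Longrightarrow> \<bar>special_sum F n a y - c $ a\<bar> \<le> M"
    and "n \<le> m" "0 \<le> y" "y < lam m a" "0 \<le> M"
  shows "\<bar>special_sum F m a y - (transpose (W n m) *v c) $ a\<bar> \<le> M * mnorm (W n m)"
proof -
  have "\<bar>special_sum F m a y - (transpose (W n m) *v c) $ a\<bar> \<le> M * (\<Sum>i\<in>UNIV. W n m $ i $ a)"
    using assms(2-4)
  proof (induction m arbitrary: a y rule: dec_induct)
    case base
    moreover have "transpose (W n n) *v c = c"
      by (simp add: W_refl transpose_mat del: transpose_matrix_vector)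
    moreover have "(\<Sum>i\<in>UNIV. W n n $ i $ a) = 1" by (simp add: W_refl mat_def)
    ultimately show ?case using assms(1)[of y a] by (simp del: transpose_matrix_vector)
  next
    case (step m)
    note l = lam_Suc_less[OF step.prems(2)]
    have 1: "\<bar>special_sum F m a y - (transpose (W n m) *v c) $ a\<bar> \<le> M * (\<Sum>i\<in>UNIV. W n m $ i $ a)"
      using l step by (intro step.IH) auto
    show ?case
    proof (cases "a = los m")
      case True
      define y' where "y' = y + (lam m (win m) - lam m (los m))"
      have "\<bar>special_sum F m (win m) y' - (transpose (W n m) *v c) $ win m\<bar> \<le> M * (\<Sum>i\<in>UNIV. W n m $ i $ win m)"
        using l(2)[OF True] step.prems lam_los_less[of m] by (intro step.IH) (auto simp: y'_def)
      moreover have "(\<Sum>i\<in>UNIV. W n (Suc m) $ i $ a) = (\<Sum>i\<in>UNIV. W n m $ i $ a) + (\<Sum>i\<in>UNIV. W n m $ i $ win m)"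
        using True step.hyps by (simp add: W_Suc_entry sum.distrib)
      moreover have "special_sum F (Suc m) a y = special_sum F m a y + special_sum F m (win m) y'"
        using True by (simp add: y'_def)
      moreover have "(transpose (W n (Suc m)) *v c) $ a = (transpose (W n m) *v c) $ a + (transpose (W n m) *v c) $ win m"
        using True step.hyps by (simp add: transpose_W_Suc del: transpose_matrix_vector)
      ultimately show ?thesis using 1 by (simp add: distrib_left del: transpose_matrix_vector special_sum.simps)
    next
      case False
      have "(\<Sum>i\<in>UNIV. W n (Suc m) $ i $ a) = (\<Sum>i\<in>UNIV. W n m $ i $ a)"
        using False step.hyps by (simp add: W_Suc_entry)
      then show ?thesis using 1 False step.hyps by (simp add: transpose_W_Suc del: transpose_matrix_vector)
    qed
  qed
  also have "\<dots> \<le> M * mnorm (W n m)"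
  proof (intro mult_left_mono)
    have "(\<Sum>i\<in>UNIV. W n m $ i $ a) \<le> (\<Sum>i\<in>UNIV. \<Sum>j\<in>UNIV. \<bar>W n m $ i $ j\<bar>)"
    proof (rule sum_mono)
      fix i
      have "\<bar>W n m $ i $ a\<bar> \<le> (\<Sum>j\<in>UNIV. \<bar>W n m $ i $ j\<bar>)" by (intro member_le_sum) auto
      then show "W n m $ i $ a \<le> (\<Sum>j\<in>UNIV. \<bar>W n m $ i $ j\<bar>)" by linarith
    qed
    then show "(\<Sum>i\<in>UNIV. W n m $ i $ a) \<le> mnorm (W n m)" by (simp add: mnorm_def)
  qed (rule assms)
  finally show ?thesis .
qed

text \<open>A monotone majorant with a range on each piece replaces suprema over partitions: cutting
  and translating pieces then acts on the ranges alone, and their sum controls the variation on all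
  pieces together.\<close>

definition oscillates_within :: "nat \<Rightarrow> ('a \<Rightarrow> real \<Rightarrow> real) \<Rightarrow> real \<Rightarrow> bool" where
  "oscillates_within n G V \<longleftrightarrow> (\<exists>g lo hi.
     (\<forall>a x y. 0 \<le> x \<longrightarrow> x \<le> y \<longrightarrow> y < lam n a \<longrightarrow> \<bar>G a y - G a x\<bar> \<le> g a y - g a x) \<and>
     (\<forall>a x. 0 \<le> x \<longrightarrow> x < lam n a \<longrightarrow> lo a \<le> g a x \<and> g a x \<le> (hi a :: real)) \<and>
     (\<Sum>a\<in>UNIV. hi a - lo a) \<le> V)"

lemma oscillates_withinE:
  assumes "oscillates_within n G V"
  obtains g lo hi where "\<And>a x y. 0 \<le> x \<Longrightarrow> x \<le> y \<Longrightarrow> y < lam n a \<Longrightarrow> \<bar>G a y - G a x\<bar> \<le> g a y - g a x"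
    "\<And>a x. 0 \<le> x \<Longrightarrow> x < lam n a \<Longrightarrow> lo a \<le> g a x \<and> g a x \<le> hi a"
    "(\<Sum>a\<in>UNIV. hi a - lo a) \<le> V"
proof -
  obtain g lo hi where h: "\<forall>a x y. 0 \<le> x \<longrightarrow> x \<le> y \<longrightarrow> y < lam n a \<longrightarrow> \<bar>G a y - G a x\<bar> \<le> g a y - g a x"
     "\<forall>a x. 0 \<le> x \<longrightarrow> x < lam n a \<longrightarrow> lo a \<le> g a x \<and> g a x \<le> hi a"
     "(\<Sum>a\<in>UNIV. hi a - lo a) \<le> V"
    using assms unfolding oscillates_within_def by (elim exE conjE) (rule that; assumption)
  show ?thesis by (rule that[OF h(1)[rule_format] h(2)[rule_format] h(3)])
qed

text \<open>A step cuts the winner's majorant in two: the lower part of its range stays with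
  \<open>w\<close>, the upper part is added to the range of \<open>l\<close>. The sum of all ranges
  is unchanged, so the bound does not depend on the level.\<close>

lemma oscillates_within_special_sum:
  assumes "oscillates_within 0 G V"
  shows "oscillates_within n (special_sum G n) V"
proof (induction n)
  case 0
  then show ?case using assms by simp
next
  case (Suc n)
  define w l t where "w = win n" and "l = los n" and "t = lam n w - lam n l"
  define H where "H = special_sum G n"
  have wl: "w \<noteq> l" using win_neq_los by (simp add: w_def l_def)
  have t: "0 < t" "t < lam n w" using lam_los_less[of n] lam_pos by (auto simp: t_def w_def l_def)
  obtain g lo hi where g: "\<And>a x y. 0 \<le> x \<Longrightarrow> x \<le> y \<Longrightarrow> y < lam n a \<Longrightarrow> \<bar>H a y - H a x\<bar> \<le> g a y - g a x"
    and b: "\<And>a x. 0 \<le> x \<Longrightarrow> x < lam n a \<Longrightarrow> lo a \<le> g a x \<and> g a x \<le> hi a"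
    and V: "(\<Sum>a\<in>UNIV. hi a - lo a) \<le> V"
    using Suc unfolding H_def[symmetric] by (rule oscillates_withinE) (rule that)
  \<comment> \<open>The value of the majorant at the point where the winner's piece is cut.\<close>
  define m where "m = g w t"
  define g' where "g' a x = (if a = l then g l x + g w (x + t) else g a x)" for a x
  define lo' where "lo' a = (if a = l then lo l + m else lo a)" for a
  define hi' where "hi' a = (if a = l then hi l + hi w else if a = w then m else hi a)" for a
  have mono: "g w x \<le> g w y" if "0 \<le> x" "x \<le> y" "y < lam n w" for x y
    using g[OF that] by linarith
  have eq: "special_sum G (Suc n) a x = H a x + (if a = l then H w (x + t) else 0)" for a x
    by (simp add: H_def l_def w_def t_def)
  note ls = lam_Suc_less[of _ n, folded w_def l_def, folded t_def]
  have "\<bar>special_sum G (Suc n) a y - special_sum G (Suc n) a x\<bar> \<le> g' a y - g' a x"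
    if "0 \<le> x" "x \<le> y" "y < lam (Suc n) a" for a x y
  proof (cases "a = l")
    case True
    have "\<bar>H w (y + t) - H w (x + t)\<bar> \<le> g w (y + t) - g w (x + t)"
      using that t ls(2)[OF that(3) True] by (intro g) auto
    moreover have "\<bar>H a y - H a x\<bar> \<le> g a y - g a x" using that ls(1)[OF that(3)] by (intro g) auto
    ultimately show ?thesis using True unfolding eq by (simp add: g'_def)
  next
    case False
    have "\<bar>H a y - H a x\<bar> \<le> g a y - g a x" using that ls(1)[OF that(3)] by (intro g) auto
    then show ?thesis using False unfolding eq by (simp add: g'_def)
  qed
  moreover have "lo' a \<le> g' a x \<and> g' a x \<le> hi' a" if "0 \<le> x" "x < lam (Suc n) a" for a x
  proof -
    have 1: "lo a \<le> g a x \<and> g a x \<le> hi a" using that ls(1) by (intro b) auto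
    show ?thesis
    proof (cases "a = l")
      case True
      have "x + t < lam n w" using ls(2)[OF that(2) True] .
      then have "m \<le> g w (x + t) \<and> g w (x + t) \<le> hi w"
        using mono[of t "x + t"] b[of "x + t" w] that t by (auto simp: m_def)
      then show ?thesis using 1 True by (auto simp: lo'_def hi'_def g'_def)
    next
      case False
      have "a = w \<Longrightarrow> g w x \<le> m"
        using mono[of x t] that t ls(3)[OF that(2)] unfolding m_def by auto
      then show ?thesis using 1 False by (auto simp: lo'_def hi'_def g'_def)
    qed
  qed
  moreover have "(\<Sum>a\<in>UNIV. hi' a - lo' a) \<le> V"
  proof -
    have "(\<Sum>a\<in>UNIV. hi' a - lo' a) = (\<Sum>a\<in>UNIV. (hi a - lo a) + (if a = l then hi w - m else 0) + (if a = w then m - hi w else 0))"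
      using wl by (intro sum.cong) (auto simp: hi'_def lo'_def)
    then show ?thesis using V by (simp add: sum.distrib)
  qed
  ultimately show ?case unfolding oscillates_within_def by blast
qed

lemma oscillates_withinD:
  assumes "oscillates_within n G V" "0 \<le> x" "x < lam n a" "0 \<le> y" "y < lam n a"
  shows "\<bar>G a x - G a y\<bar> \<le> V"
proof -
  obtain g lo hi where g: "\<And>a x y. 0 \<le> x \<Longrightarrow> x \<le> y \<Longrightarrow> y < lam n a \<Longrightarrow> \<bar>G a y - G a x\<bar> \<le> g a y - g a x"
    and b: "\<And>a x. 0 \<le> x \<Longrightarrow> x < lam n a \<Longrightarrow> lo a \<le> g a x \<and> g a x \<le> hi a"
    and V: "(\<Sum>a\<in>UNIV. hi a - lo a) \<le> V"
    using assms(1) by (rule oscillates_withinE) (rule that)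
  have nn: "0 \<le> hi c - lo c" for c using b[of 0 c] lam_pos[of n c] by force
  have "hi a - lo a \<le> V"
    using member_le_sum[of a UNIV "\<lambda>a. hi a - lo a"] nn V by auto
  then show ?thesis
    using g[of x y a] g[of y x a] b[of x a] b[of y a] assms(2-5) by (cases "x \<le> y") auto
qed

lemma special_sum_has_integral:
  assumes "\<And>a x y. 0 \<le> x \<Longrightarrow> x \<le> y \<Longrightarrow> y < lam 0 a \<Longrightarrow> (G a has_integral (F a y - F a x)) {x..y}"
    and "0 \<le> x" "x \<le> y" "y < lam n a"
  shows "(special_sum G n a has_integral (special_sum F n a y - special_sum F n a x)) {x..y}"
  using assms(2-4)
proof (induction n arbitrary: a x y)
  case 0
  then show ?case using assms(1) by simp
next
  case (Suc n)
  note ls = lam_Suc_less[OF Suc.prems(3)]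
  have 1: "(special_sum G n a has_integral (special_sum F n a y - special_sum F n a x)) {x..y}"
    using Suc.prems ls by (intro Suc.IH) auto
  show ?case
  proof (cases "a = los n")
    case True
    define t where "t = lam n (win n) - lam n (los n)"
    have "(special_sum G n (win n) has_integral (special_sum F n (win n) (y + t) - special_sum F n (win n) (x + t))) {x + t..y + t}"
      using Suc.prems ls(2)[OF True] lam_los_less[of n] by (intro Suc.IH) (auto simp: t_def)
    then have "((\<lambda>z. special_sum G n (win n) (z + t)) has_integral (special_sum F n (win n) (y + t) - special_sum F n (win n) (x + t))) {x..y}"
      unfolding has_integral_shift_Icc_real[symmetric] by (simp add: o_def add.commute)
    from has_integral_add[OF 1 this] show ?thesis using True by (simp add: t_def algebra_simps)
  next
    case False
    then show ?thesis using 1 by simp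
  qed
qed

text \<open>The integral over the part cut off the winner reappears, translated, in the integral of
  the loser, so the sum over the letters is preserved.\<close>

lemma special_sum_integral:
  assumes "\<And>a. G a integrable_on {0..lam 0 a}" "(\<Sum>a\<in>UNIV. integral {0..lam 0 a} (G a)) = 0"
  shows "(\<forall>a. special_sum G n a integrable_on {0..lam n a}) \<and>
    (\<Sum>a\<in>UNIV. integral {0..lam n a} (special_sum G n a)) = 0"
proof (induction n)
  case 0
  then show ?case using assms by simp
next
  case (Suc n)
  define w l t where "w = win n" and "l = los n" and "t = lam n w - lam n l"
  define H where "H = special_sum G n"
  have wl: "w \<noteq> l" using win_neq_los by (simp add: w_def l_def)
  have t: "0 < t" "t < lam n w" using lam_los_less[of n] lam_pos by (auto simp: t_def w_def l_def)
  have lam': "lam (Suc n) a = (if a = w then t else lam n a)" for a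
    by (auto simp: lam_Suc w_def l_def t_def)
  have eq: "special_sum G (Suc n) a = (\<lambda>x. H a x + (if a = l then H w (x + t) else 0))" for a
    by (auto simp: H_def l_def w_def t_def)
  have int: "H a integrable_on {0..lam n a}" for a using Suc by (simp add: H_def)
  have left: "H w integrable_on {0..t}" using integrable_on_subinterval[OF int[of w], of 0 t] t by auto
  have right: "H w integrable_on {t..lam n w}" using integrable_on_subinterval[OF int[of w], of t "lam n w"] t by auto
  have comb: "integral {0..t} (H w) + integral {t..lam n w} (H w) = integral {0..lam n w} (H w)"
    using t by (intro Henstock_Kurzweil_Integration.integral_combine int) auto
  have sh: "{0 + t..lam n l + t} = {t..lam n w}" by (simp add: t_def)
  have shift: "((\<lambda>x. H w (x + t)) has_integral integral {t..lam n w} (H w)) {0..lam n l}"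
    using integrable_integral[OF right] unfolding sh[symmetric] has_integral_shift_Icc_real[symmetric]
    by (simp add: o_def add.commute)
  have "special_sum G (Suc n) a integrable_on {0..lam (Suc n) a} \<and>
     integral {0..lam (Suc n) a} (special_sum G (Suc n) a) = integral {0..lam n a} (H a)
     + (if a = l then integral {t..lam n w} (H w) else 0) - (if a = w then integral {t..lam n w} (H w) else 0)" for a
  proof (cases "a = l")
    case True
    have "((\<lambda>x. H l x + H w (x + t)) has_integral (integral {0..lam n l} (H l) + integral {t..lam n w} (H w))) {0..lam n l}"
      by (intro has_integral_add shift integrable_integral int)
    then show ?thesis using True wl unfolding eq lam' by (auto simp: integral_unique)
  next
    case False
    then show ?thesis using left int comb unfolding eq lam' by auto
  qed
  moreover have "(\<Sum>a\<in>UNIV. integral {0..lam n a} (H a)) = 0" using Suc by (simp add: H_def)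
  ultimately show ?case by (simp add: sum.distrib sum_subtractf del: special_sum.simps)
qed

end

section \<open>Decay of special Birkhoff sums\<close>

declare nseq.simps(2) [simp del]

lemma (in keane_iem) special_sum_mean:
  assumes osc: "oscillates_within n H V" and int: "H a integrable_on {0..lam n a}"
    and y: "0 \<le> y" "y < lam n a"
  shows "\<bar>H a y - integral {0..lam n a} (H a) / lam n a\<bar> \<le> V"
proof -
  define L where "L = lam n a"
  define A where "A = integral {0..L} (H a)"
  have L: "0 < L" by (simp add: L_def lam_pos)
  have V: "0 \<le> V" using oscillates_withinD[OF osc y y] by simp
  have "((\<lambda>x. H a x - H a y) has_integral (A - L * H a y)) {0..L}"
    using has_integral_diff[OF integrable_integral[OF int] has_integral_const_real[of "H a y" 0 "lam n a"]] L
    by (simp add: A_def L_def lam_pos less_imp_le)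
  then have "norm (A - L * H a y) \<le> V * Henstock_Kurzweil_Integration.content {0..L}"
    \<comment> \<open>The oscillation bound covers only the half-open piece, hence the exceptional
      point \<open>L\<close>.\<close>
    by (rule has_integral_bound_real[OF V, of "{L}", rotated])
      (use oscillates_withinD[OF osc _ _ y] in \<open>auto simp: L_def\<close>)
  then have "\<bar>A - L * H a y\<bar> \<le> V * L" using L by simp
  then have "\<bar>A - L * H a y\<bar> / L \<le> V" using L by (simp add: field_simps)
  moreover have "A / L - H a y = (A - L * H a y) / L" using L by (simp add: field_simps)
  ultimately have "\<bar>A / L - H a y\<bar> \<le> V" using L by (simp only: abs_divide abs_of_pos)
  then show ?thesis unfolding A_def L_def by (simp only: abs_minus_commute)
qed

lemma norm_le_card_bound:
  fixes v :: "real^'a::finite"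
  assumes "\<And>a. \<bar>v $ a\<bar> \<le> B"
  shows "norm v \<le> real CARD('a) * B"
proof -
  have "norm v \<le> (\<Sum>a\<in>UNIV. \<bar>v $ a\<bar>)" by (rule norm_le_l1_cart)
  also have "\<dots> \<le> (\<Sum>a\<in>(UNIV::'a set). B)" by (intro sum_mono assms)
  finally show ?thesis by simp
qed

context roth_iem
begin

text \<open>The special Birkhoff sums stay within a bounded distance of their means on the pieces. These
  means have zero total integral, hence grow at most like \<open>N powr (1 - \<theta>)\<close>.\<close>

lemma special_sum_derivative_bound:
  assumes osc: "oscillates_within 0 G V"
    and int: "\<And>a. G a integrable_on {0..lam 0 a}" "(\<Sum>a\<in>UNIV. integral {0..lam 0 a} (G a)) = 0"
  obtains \<theta> C where "0 < \<theta>" "\<theta> < 1" "0 < C"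
    "\<And>k a y. 0 \<le> y \<Longrightarrow> y < lam (nseq s k) a \<Longrightarrow> \<bar>special_sum G (nseq s k) a y\<bar> \<le> C * N k powr (1 - \<theta>)"
proof -
  define c :: "nat \<Rightarrow> real^'a" where
    "c k = (\<chi> a. integral {0..lam (nseq s k) a} (special_sum G (nseq s k) a) / lam (nseq s k) a)" for k
  note oscn = oscillates_within_special_sum[OF osc]
  note intn = special_sum_integral[OF int]
  have V: "0 \<le> V" using oscillates_withinD[OF osc order.refl lam_pos order.refl lam_pos] by simp
  have near: "\<bar>special_sum G (nseq s k) a y - c k $ a\<bar> \<le> V" if "0 \<le> y" "y < lam (nseq s k) a" for k a y
    using special_sum_mean[OF oscn _ that] intn by (simp add: c_def)
  have zm: "zero_mean k (c k)" for k
    using intn[of "nseq s k"] lam_pos[of "nseq s k"] by (simp add: zero_mean_def c_def less_imp_neq[THEN not_sym])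
  \<comment> \<open>\<open>1 / 4\<close> is the exponent that \<open>zero_mean_growth\<close> admits
    for the increments.\<close>
  obtain D where D: "0 < D" "\<And>k. mnorm (Q k (Suc k)) \<le> D * N k powr (1 / 4)"
    using Z_bound[of "1/4"] by auto
  have inc: "norm (c (Suc k) - S k (Suc k) (c k)) \<le> (real CARD('a) * (2 * V * D)) * N (Suc k) powr (1 / 4)" for k
  proof -
    have "\<bar>(c (Suc k) - S k (Suc k) (c k)) $ a\<bar> \<le> 2 * V * D * N (Suc k) powr (1 / 4)" for a
    proof -
      \<comment> \<open>Both vectors are compared with the special sum at the left end of the piece;
        transporting the error \<open>V\<close> costs the norm of the block.\<close>
      have 1: "\<bar>special_sum G (nseq s (Suc k)) a 0 - S k (Suc k) (c k) $ a\<bar> \<le> V * mnorm (Q k (Suc k))"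
        unfolding S_def Q_def
        by (rule special_sum_approx[OF near]) (auto simp: lam_pos V nseq_le)
      have 2: "\<bar>special_sum G (nseq s (Suc k)) a 0 - c (Suc k) $ a\<bar> \<le> V"
        by (rule near) (auto simp: lam_pos)
      have "V * 1 \<le> V * mnorm (Q k (Suc k))"
        using V mnorm_Q_ge_2[of k "Suc k"] by (intro mult_left_mono) auto
      then have "\<bar>(c (Suc k) - S k (Suc k) (c k)) $ a\<bar> \<le> 2 * V * mnorm (Q k (Suc k))"
        using 1 2 by simp
      also have "\<dots> \<le> 2 * V * (D * N (Suc k) powr (1 / 4))"
      proof (intro mult_left_mono)
        have "D * N k powr (1 / 4) \<le> D * N (Suc k) powr (1 / 4)"
          using D(1) by (intro mult_left_mono N_powr_mono) auto
        then show "mnorm (Q k (Suc k)) \<le> D * N (Suc k) powr (1 / 4)" using D(2)[of k] by linarith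
      qed (use V in auto)
      finally show ?thesis by (simp add: mult_ac)
    qed
    from norm_le_card_bound[OF this] show ?thesis by (simp add: mult_ac)
  qed
  obtain \<theta> C where \<theta>: "0 < \<theta>" "\<theta> < 1" "0 < C" "\<And>k. norm (c k) \<le> C * N k powr (1 - \<theta>)"
    using zero_mean_growth[OF zm inc] by blast
  have "\<bar>special_sum G (nseq s k) a y\<bar> \<le> (C + V) * N k powr (1 - \<theta>)"
    if "0 \<le> y" "y < lam (nseq s k) a" for k a y
  proof -
    have "V * 1 \<le> V * N k powr (1 - \<theta>)" using V \<theta> by (intro mult_left_mono N_powr_ge1) auto
    moreover have "\<bar>c k $ a\<bar> \<le> C * N k powr (1 - \<theta>)"
      using component_le_norm_cart[of "c k" a] \<theta>(4)[of k] by linarith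
    ultimately show ?thesis using near[OF that] by (simp add: distrib_right)
  qed
  then show ?thesis using that[of \<theta> "C + V"] \<theta> V by simp
qed

text \<open>On a piece the special sums of \<open>F\<close> vary by at most the bound on those of
  the derivative times the length of the piece, which decays. Their values at the left ends are
  therefore almost an orbit of the cocycle, and \<open>correction\<close> applies to them.\<close>

lemma special_sum_decay:
  assumes FG: "\<And>a x y. 0 \<le> x \<Longrightarrow> x \<le> y \<Longrightarrow> y < lam 0 a \<Longrightarrow> (G a has_integral (F a y - F a x)) {x..y}"
    and osc: "oscillates_within 0 G V"
    and int: "\<And>a. G a integrable_on {0..lam 0 a}" "(\<Sum>a\<in>UNIV. integral {0..lam 0 a} (G a)) = 0"
  obtains \<xi> \<rho> C where "0 < \<rho>" "0 < C"
    "\<And>k a y. 0 \<le> y \<Longrightarrow> y < lam (nseq s k) a \<Longrightarrow>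
       \<bar>special_sum (\<lambda>a y. F a y - \<xi> $ a) (nseq s k) a y\<bar> \<le> C * N k powr (- \<rho>)"
proof -
  obtain \<theta> C where \<theta>: "0 < \<theta>" "\<theta> < 1" "0 < C"
    "\<And>k a y. 0 \<le> y \<Longrightarrow> y < lam (nseq s k) a \<Longrightarrow> \<bar>special_sum G (nseq s k) a y\<bar> \<le> C * N k powr (1 - \<theta>)"
    using special_sum_derivative_bound[OF osc int] by blast
  \<comment> \<open>Then \<open>N k powr (1 - \<theta>)\<close> times the length bound
    \<open>N k powr (\<delta> - 1)\<close> is \<open>N k powr (- \<delta>)\<close>.\<close>
  define \<delta> where "\<delta> = \<theta> / 2"
  have \<delta>: "0 < \<delta>" "\<delta> < 1" using \<theta> by (auto simp: \<delta>_def)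
  obtain B where B: "0 < B" "\<And>k a. lam (nseq s k) a \<le> B * N k powr (\<delta> - 1)" using lam_bound[OF \<delta>] by blast
  define b :: "nat \<Rightarrow> real^'a" where "b k = (\<chi> a. special_sum F (nseq s k) a 0)" for k
  have near: "\<bar>special_sum F (nseq s k) a y - b k $ a\<bar> \<le> (C * B) * N k powr (- \<delta>)"
    if "0 \<le> y" "y < lam (nseq s k) a" for k a y
  proof -
    have "(special_sum G (nseq s k) a has_integral (special_sum F (nseq s k) a y - special_sum F (nseq s k) a 0)) {0..y}"
      using that by (intro special_sum_has_integral FG) auto
    then have "norm (special_sum F (nseq s k) a y - special_sum F (nseq s k) a 0)
      \<le> (C * N k powr (1 - \<theta>)) * Henstock_Kurzweil_Integration.content {0..y}"
      by (rule has_integral_bound_real[of _ "{}", rotated 2]) (use \<theta> that in auto)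
    also have "\<dots> \<le> (C * N k powr (1 - \<theta>)) * (B * N k powr (\<delta> - 1))"
      using that \<theta>(3) B(2)[of k a] by (intro mult_left_mono) auto
    also have "\<dots> = (C * B) * (N k powr (1 - \<theta>) * N k powr (\<delta> - 1))" by simp
    also have "\<dots> = (C * B) * N k powr (- \<delta>)" by (simp add: powr_add[symmetric] \<delta>_def)
    finally show ?thesis by (simp add: b_def)
  qed
  obtain D where D: "0 < D" "\<And>k. mnorm (Q k (Suc k)) \<le> D * N k powr (\<delta> / 2)"
    using Z_bound[of "\<delta> / 2"] \<delta> by (metis half_gt_zero)
  obtain E where E: "0 < E" "\<And>k. N k powr (- (\<delta> / 2)) \<le> E * N (Suc k) powr (- (\<delta> / 2 / 2))"
    using N_Suc_powr[of "\<delta> / 2"] \<delta> by (metis half_gt_zero)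
  define \<eta> where "\<eta> = \<delta> / 2 / 2"
  have \<eta>: "0 < \<eta>" using \<delta> by (simp add: \<eta>_def)
  have inc: "norm (b (Suc k) - S k (Suc k) (b k)) \<le> (real CARD('a) * (C * B * D * E)) * N (Suc k) powr (- \<eta>)" for k
  proof -
    have "\<bar>(b (Suc k) - S k (Suc k) (b k)) $ a\<bar> \<le> C * B * D * E * N (Suc k) powr (- \<eta>)" for a
    proof -
      have "\<bar>(b (Suc k) - S k (Suc k) (b k)) $ a\<bar> = \<bar>special_sum F (nseq s (Suc k)) a 0 - S k (Suc k) (b k) $ a\<bar>"
        by (simp add: b_def)
      also have "\<dots> \<le> ((C * B) * N k powr (- \<delta>)) * mnorm (Q k (Suc k))"
        unfolding S_def Q_def
        by (rule special_sum_approx[OF near]) (use \<theta> B in \<open>auto simp: lam_pos nseq_le\<close>)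
      also have "\<dots> \<le> ((C * B) * N k powr (- \<delta>)) * (D * N k powr (\<delta> / 2))"
        using \<theta> B D by (intro mult_left_mono) auto
      also have "\<dots> = (C * B * D) * (N k powr (- \<delta>) * N k powr (\<delta> / 2))" by simp
      also have "\<dots> = (C * B * D) * N k powr (- (\<delta> / 2))" by (simp add: powr_add[symmetric])
      also have "\<dots> \<le> (C * B * D) * (E * N (Suc k) powr (- \<eta>))"
        unfolding \<eta>_def using \<theta> B D by (intro mult_left_mono E) auto
      finally show ?thesis by (simp add: mult_ac)
    qed
    from norm_le_card_bound[OF this] show ?thesis by (simp add: mult_ac)
  qed
  obtain \<xi> \<rho> A where A: "0 < \<rho>" "0 < A" "\<And>k. norm (b k - S 0 k \<xi>) \<le> A * N k powr (- \<rho>)"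
    by (rule correction[OF \<eta> inc]) (rule that)
  define r where "r = min \<rho> \<delta>"
  have "\<bar>special_sum (\<lambda>a y. F a y - \<xi> $ a) (nseq s k) a y\<bar> \<le> (C * B + A) * N k powr (- r)"
    if "0 \<le> y" "y < lam (nseq s k) a" for k a y
  proof -
    have "special_sum (\<lambda>a y. F a y - \<xi> $ a) (nseq s k) a y =
      (special_sum F (nseq s k) a y - b k $ a) + (b k - S 0 k \<xi>) $ a"
      by (simp add: special_sum_diff_const S_def Q_def del: transpose_matrix_vector)
    moreover have "\<bar>(b k - S 0 k \<xi>) $ a\<bar> \<le> A * N k powr (- \<rho>)"
      using component_le_norm_cart[of "b k - S 0 k \<xi>" a] A(3)[of k] by linarith
    moreover have "A * N k powr (- \<rho>) \<le> A * N k powr (- r)"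
      using A N_ge[of k] by (intro mult_left_mono powr_mono) (auto simp: r_def)
    moreover have "(C * B) * N k powr (- \<delta>) \<le> (C * B) * N k powr (- r)"
      using \<theta> B N_ge[of k] by (intro mult_left_mono powr_mono) (auto simp: r_def)
    ultimately show ?thesis using near[OF that] unfolding distrib_right by linarith
  qed
  moreover have "0 < r" using A \<delta> by (simp add: r_def)
  moreover have "0 < C * B + A" using \<theta> B A by (simp add: add_pos_pos)
  ultimately show ?thesis using that by blast
qed

end

section \<open>From special to ordinary Birkhoff sums\<close>

context keane_iem
begin

text \<open>Moves the special sums from normalised coordinates back to the interval of level
  \<open>n\<close>, where the orbits of the induced map live.\<close>

definition level_fun :: "('a \<Rightarrow> real \<Rightarrow> real) \<Rightarrow> nat \<Rightarrow> real \<Rightarrow> real" where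
  "level_fun F n x = (let a = (SOME a. x \<in> piece (top_perm (st n)) (lam n) a)
     in special_sum F n a (x - left_end (top_perm (st n)) (lam n) a))"

abbreviation level_sum :: "('a \<Rightarrow> real \<Rightarrow> real) \<Rightarrow> nat \<Rightarrow> nat \<Rightarrow> real \<Rightarrow> real" where
  "level_sum F n \<equiv> birkhoff_sum (iem_of (st n)) (level_fun F n)"

lemma level_fun_eq:
  assumes "0 \<le> y" "y < lam n a"
  shows "level_fun F n (left_end (top_perm (st n)) (lam n) a + y) = special_sum F n a y"
proof -
  note k = keane_dataD[OF keane_n[of n]]
  have "left_end (top_perm (st n)) (lam n) a + y \<in> piece (top_perm (st n)) (lam n) a"
    using assms by (simp add: piece_def)
  then have "(SOME b. left_end (top_perm (st n)) (lam n) a + y \<in> piece (top_perm (st n)) (lam n) b) = a"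
    using piece_unique[OF k(3,5)] by (intro some_equality) blast+
  then show ?thesis by (simp add: level_fun_def)
qed

lemma level_fun_bound:
  assumes "\<And>a y. 0 \<le> y \<Longrightarrow> y < lam n a \<Longrightarrow> \<bar>special_sum F n a y\<bar> \<le> M"
    and "x \<in> {0..<total_length (lam n)}"
  shows "\<bar>level_fun F n x\<bar> \<le> M"
proof -
  obtain a y where "x = left_end (top_perm (st n)) (lam n) a + y" "0 \<le> y" "y < lam n a"
    using piece_cases[OF keane_dataD(1)[OF keane_n] assms(2)] .
  then show ?thesis using level_fun_eq assms(1) by simp
qed

text \<open>The recursion for \<open>special_sum\<close> adds the values at the two points listed in
  \<open>iem_of_step\<close>, in whichever order they are visited; this matches normalised
  coordinates with actual orbits.\<close>

lemma birkhoff_sum_next_level: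
  assumes "\<And>a y. 0 \<le> y \<Longrightarrow> y < lam n a \<Longrightarrow> \<bar>special_sum F n a y\<bar> \<le> M"
    and "x \<in> {0..<total_length (lam n)}"
  shows "\<exists>x'\<in>{0..<total_length (lam (Suc n))}. \<exists>j'\<le>j.
    \<bar>level_sum F n j x\<bar> \<le>
      2 * M + \<bar>level_sum F (Suc n) j' x'\<bar>"
  unfolding st_Suc
proof (rule birkhoff_sum_rv_step[OF card2 keane_n])
  let ?E = "left_end (top_perm (rv_step (st n))) (lens (rv_step (st n)))"
  note g = rv_step_geometry[OF card2 keane_n[of n]]
  note e' = level_fun_eq[of _ "Suc n", unfolded st_Suc]
  show "level_fun F (Suc n) (?E a + y) =
      level_fun F n (?E a + y)"
    if "a \<noteq> los n" "0 \<le> y" "y < lens (rv_step (st n)) a" for a y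
    using that lam_Suc_less(1)[of y n a] e'[OF that(2,3), of F] level_fun_eq[of y n a F]
    by (simp add: st_Suc g(2))
  show "level_fun F (Suc n) (?E (los n) + y) =
      level_fun F n (?E (los n) + y) +
      level_fun F n (iem_of (st n) (?E (los n) + y))"
    if y: "0 \<le> y" "y < lam n (los n)" for y
  proof -
    define t where "t = lam n (win n) - lam n (los n)"
    have l: "lens (rv_step (st n)) (los n) = lam n (los n)"
      using lam_Suc[of n] win_neq_los[of n] by (simp add: st_Suc)
    have 1: "level_fun F n (left_end (top_perm (st n)) (lam n) (los n) + y) = special_sum F n (los n) y"
      by (rule level_fun_eq[OF y])
    have 2: "level_fun F n (left_end (top_perm (st n)) (lam n) (win n) + (y + lam n (win n) - lam n (los n))) = special_sum F n (win n) (y + t)"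
      using level_fun_eq[of "y + t" n "win n" F] y lam_los_less[of n] by (simp add: t_def add_diff_eq)
    have 3: "level_fun F (Suc n) (?E (los n) + y)
      = special_sum F n (los n) y + special_sum F n (win n) (y + t)"
      using e'[of y "los n" F] y l by (simp add: t_def)
    from iem_of_step(3)[OF card2 keane_n y] show ?thesis
    proof (elim disjE conjE)
      assume h: "?E (los n) = left_end (top_perm (st n)) (lam n) (los n)"
        "iem_of (st n) (?E (los n) + y) =
         left_end (top_perm (st n)) (lam n) (win n) + (y + lam n (win n) - lam n (los n))"
      show ?thesis unfolding 3 h(2) 2 unfolding h(1) 1 ..
    next
      assume h: "?E (los n) + y =
         left_end (top_perm (st n)) (lam n) (win n) + (y + lam n (win n) - lam n (los n))"
        "iem_of (st n) (?E (los n) + y) =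
         left_end (top_perm (st n)) (lam n) (los n) + y"
      show ?thesis unfolding 3 h(2) 1 unfolding h(1) 2 by simp
    qed
  qed
  show "\<bar>level_fun F n x\<bar> \<le> M" if "x \<in> {0..<total_length (lam n)}" for x
    using level_fun_bound[OF assms(1) that] .
  show "x \<in> {0..<total_length (lam n)}" by fact
qed

lemma birkhoff_sum_levels:
  assumes "\<And>i a y. n \<le> i \<Longrightarrow> i < m \<Longrightarrow> 0 \<le> y \<Longrightarrow> y < lam i a \<Longrightarrow> \<bar>special_sum F i a y\<bar> \<le> M"
    and "n \<le> m" "x \<in> {0..<total_length (lam n)}"
  shows "\<exists>x'\<in>{0..<total_length (lam m)}. \<exists>j'\<le>j.
    \<bar>level_sum F n j x\<bar> \<le>
      2 * M * real (m - n) + \<bar>level_sum F m j' x'\<bar>"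
  using assms(2,1)
proof (induction m rule: dec_induct)
  case base
  then show ?case using assms(3) by auto
next
  case (step m)
  obtain x' j' where h: "x' \<in> {0..<total_length (lam m)}" "j' \<le> j"
    "\<bar>level_sum F n j x\<bar> \<le>
      2 * M * real (m - n) + \<bar>level_sum F m j' x'\<bar>"
    using step.IH step.prems less_SucI by blast
  have "\<bar>special_sum F m a y\<bar> \<le> M" if "0 \<le> y" "y < lam m a" for a y
    using step.prems[of m y a] step.hyps that by simp
  from birkhoff_sum_next_level[OF this h(1), of j'] obtain x'' j'' where
    g: "x'' \<in> {0..<total_length (lam (Suc m))}" "j'' \<le> j'"
    "\<bar>level_sum F m j' x'\<bar> \<le>
      2 * M + \<bar>level_sum F (Suc m) j'' x''\<bar>"
    by blast
  have "real (Suc m - n) = real (m - n) + 1" using step.hyps by simp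
  then have "\<bar>level_sum F n j x\<bar> \<le>
      2 * M * real (Suc m - n) + \<bar>level_sum F (Suc m) j'' x''\<bar>"
    using h(3) g(3) by (simp add: algebra_simps)
  then show ?case using g(1,2) h(2) le_trans by blast
qed

end

context roth_iem
begin

text \<open>A block costs twice the number of its elementary steps times a bound for the
  intermediate special sums. Both are controlled by the block norm \<open>z\<close>, so the cost is
  of order \<open>z * z * N k powr (- \<rho>)\<close>, and these costs are summable by (a).\<close>

lemma bounded_birkhoff_sums:
  assumes \<rho>: "0 < \<rho>" "0 < C" and dec: "\<And>k a y. 0 \<le> y \<Longrightarrow> y < lam (nseq s k) a \<Longrightarrow>
       \<bar>special_sum F (nseq s k) a y\<bar> \<le> C * N k powr (- \<rho>)"
  obtains B where "\<And>j x. x \<in> {0..<total_length (lens s)} \<Longrightarrow> \<bar>birkhoff_sum (iem_of s) (level_fun F 0) j x\<bar> \<le> B"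
proof -
  \<comment> \<open>\<open>\<rho> / 4\<close> because the block norm enters squared and half of the
    decay has to remain.\<close>
  obtain D where D: "0 < D" "\<And>k. mnorm (Q k (Suc k)) \<le> D * N k powr (\<rho> / 4)"
    using Z_bound[of "\<rho> / 4"] \<rho> by auto
  define A where "A = 2 * C * D * D"
  have A: "0 < A" using \<rho> D by (simp add: A_def)
  have block: "\<exists>x'\<in>{0..<total_length (lam (nseq s (Suc k)))}. \<exists>j'\<le>j.
    \<bar>level_sum F (nseq s k) j x\<bar> \<le>
      A * N k powr - (\<rho> / 2) + \<bar>level_sum F (nseq s (Suc k)) j' x'\<bar>"
    if x: "x \<in> {0..<total_length (lam (nseq s k))}" for k j x
  proof -
    define z where "z = mnorm (Q k (Suc k))"
    have z: "0 \<le> z" "z \<le> D * N k powr (\<rho> / 4)" using D mnorm_nonneg by (auto simp: z_def)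
    have CN: "0 \<le> C * N k powr (- \<rho>)" using \<rho> by simp
    have b: "\<bar>special_sum F i a y\<bar> \<le> C * N k powr (- \<rho>) * z"
      if i: "nseq s k \<le> i" "i < nseq s (Suc k)" and y: "0 \<le> y" "y < lam i a" for i a y
    proof -
      \<comment> \<open>Comparison with the zero vector, so that only the transported bound is
        left.\<close>
      have "\<bar>special_sum F i a y - (transpose (W (nseq s k) i) *v 0) $ a\<bar> \<le> C * N k powr (- \<rho>) * mnorm (W (nseq s k) i)"
        by (rule special_sum_approx) (use i y dec CN in auto)
      also have "\<dots> \<le> C * N k powr (- \<rho>) * z"
        unfolding z_def Q_def using i CN by (intro mult_left_mono mnorm_W_mono) auto
      finally show ?thesis by simp
    qed
    have "2 * (C * N k powr (- \<rho>) * z) * real (nseq s (Suc k) - nseq s k) \<le> 2 * (C * N k powr (- \<rho>) * z) * z"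
      unfolding z_def Q_def using \<rho> mnorm_nonneg by (intro mult_left_mono sum_W_ge nseq_le mult_nonneg_nonneg) auto
    also have "\<dots> = 2 * (C * N k powr (- \<rho>)) * (z * z)" by simp
    also have "\<dots> \<le> 2 * (C * N k powr (- \<rho>)) * ((D * N k powr (\<rho> / 4)) * (D * N k powr (\<rho> / 4)))"
      using z CN by (intro mult_left_mono mult_mono) auto
    also have "\<dots> = A * (N k powr (- \<rho>) * N k powr (\<rho> / 4) * N k powr (\<rho> / 4))" by (simp add: A_def)
    also have "\<dots> = A * N k powr - (\<rho> / 2)" by (simp add: powr_add[symmetric])
    finally have le: "2 * (C * N k powr (- \<rho>) * z) * real (nseq s (Suc k) - nseq s k) \<le> A * N k powr - (\<rho> / 2)" .
    from birkhoff_sum_levels[OF b nseq_le[of k "Suc k"] x, of j]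
    obtain x' j' where "x' \<in> {0..<total_length (lam (nseq s (Suc k)))}" "j' \<le> j"
      "\<bar>level_sum F (nseq s k) j x\<bar> \<le>
      2 * (C * N k powr (- \<rho>) * z) * real (nseq s (Suc k) - nseq s k) +
      \<bar>level_sum F (nseq s (Suc k)) j' x'\<bar>" by auto
    then show ?thesis using le by (meson add_right_mono order_trans)
  qed
  define M where "M = (\<Sum>k. N k powr - (\<rho> / 2))"
  have iter: "\<exists>x'\<in>{0..<total_length (lam (nseq s k))}. \<exists>j'\<le>j.
    \<bar>birkhoff_sum (iem_of s) (level_fun F 0) j x\<bar> \<le>
      A * (\<Sum>i<k. N i powr - (\<rho> / 2)) + \<bar>level_sum F (nseq s k) j' x'\<bar>"
    if x: "x \<in> {0..<total_length (lens s)}" for k j x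
  proof (induction k)
    case 0
    then show ?case using x by auto
  next
    case (Suc k)
    then obtain x' j' where h: "x' \<in> {0..<total_length (lam (nseq s k))}" "j' \<le> j"
      "\<bar>birkhoff_sum (iem_of s) (level_fun F 0) j x\<bar> \<le>
      A * (\<Sum>i<k. N i powr - (\<rho> / 2)) + \<bar>level_sum F (nseq s k) j' x'\<bar>" by blast
    from block[OF h(1), of j'] obtain x'' j'' where g: "x'' \<in> {0..<total_length (lam (nseq s (Suc k)))}" "j'' \<le> j'"
      "\<bar>level_sum F (nseq s k) j' x'\<bar> \<le>
      A * N k powr - (\<rho> / 2) + \<bar>level_sum F (nseq s (Suc k)) j'' x''\<bar>" by blast
    have "A * (\<Sum>i<Suc k. N i powr - (\<rho> / 2)) = A * (\<Sum>i<k. N i powr - (\<rho> / 2)) + A * N k powr - (\<rho> / 2)"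
      by (simp add: distrib_left)
    then have "\<bar>birkhoff_sum (iem_of s) (level_fun F 0) j x\<bar> \<le>
      A * (\<Sum>i<Suc k. N i powr - (\<rho> / 2)) + \<bar>level_sum F (nseq s (Suc k)) j'' x''\<bar>"
      using h(3) g(3) by linarith
    then show ?case using g(1,2) h(2) le_trans by blast
  qed
  have "\<bar>birkhoff_sum (iem_of s) (level_fun F 0) j x\<bar> \<le> A * M"
    if x: "x \<in> {0..<total_length (lens s)}" for j x
  proof -
    \<comment> \<open>Here \<open>j\<close> is fixed while the level grows: at most \<open>j\<close>
      terms remain at level \<open>k\<close>, each bounded by a quantity that tends to 0.\<close>
    have fin: "\<bar>birkhoff_sum (iem_of s) (level_fun F 0) j x\<bar> \<le> A * M + real j * (C * N k powr - \<rho>)" for k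
    proof -
      obtain x' j' where h: "x' \<in> {0..<total_length (lam (nseq s k))}" "j' \<le> j"
        "\<bar>birkhoff_sum (iem_of s) (level_fun F 0) j x\<bar> \<le>
        A * (\<Sum>i<k. N i powr - (\<rho> / 2)) + \<bar>level_sum F (nseq s k) j' x'\<bar>"
        using iter[OF x] by blast
      have "\<bar>level_fun F (nseq s k) ((iem_of (st (nseq s k)) ^^ i) x')\<bar> \<le> C * N k powr - \<rho>" for i
      proof (rule level_fun_bound[OF dec])
        show "(iem_of (st (nseq s k)) ^^ i) x' \<in> {0..<total_length (lam (nseq s k))}"
        proof (induction i)
          case (Suc i)
          then show ?case using iem_mem[OF keane_dataD(1,5)[OF keane_n]] by simp
        qed (use h in simp)
      qed
      then have "\<bar>level_sum F (nseq s k) j' x'\<bar> \<le> (\<Sum>i<j'. C * N k powr - \<rho>)"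
        unfolding birkhoff_sum_def by (intro order.trans[OF sum_abs] sum_mono)
      also have "\<dots> \<le> real j * (C * N k powr - \<rho>)"
        using h(2) \<rho>(2) by (simp add: mult_right_mono)
      finally have 1: "\<bar>level_sum F (nseq s k) j' x'\<bar> \<le> real j * (C * N k powr - \<rho>)" .
      have "A * (\<Sum>i<k. N i powr - (\<rho> / 2)) \<le> A * M"
        unfolding M_def using A \<rho> by (intro mult_left_mono sum_N_le_suminf) auto
      then show ?thesis using h(3) 1 by linarith
    qed
    have "(\<lambda>k. A * M + real j * (C * N k powr - \<rho>)) \<longlonglongrightarrow> A * M + real j * (C * 0)"
      by (intro tendsto_intros summable_LIMSEQ_zero summable_N \<rho>)
    then show ?thesis using fin by (intro LIMSEQ_le_const[of _ "A * M"]) auto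
  qed
  then show ?thesis using that by blast
qed

end

section \<open>The cohomological equation\<close>

lemma has_integral_Ico_iff:
  fixes f :: "real \<Rightarrow> real"
  shows "(f has_integral I) {a..<b} \<longleftrightarrow> (f has_integral I) {a..b}"
proof (rule has_integral_spike_set_eq)
  show "negligible {x \<in> {a..<b} - {a..b}. f x \<noteq> 0}"
    by (rule negligible_subset[of "{}"]) auto
  show "negligible {x \<in> {a..b} - {a..<b}. f x \<noteq> 0}"
    by (rule negligible_subset[of "{b}"]) auto
qed

lemma has_integral_pieces:
  fixes p :: "'a::finite \<Rightarrow> nat" and f :: "real \<Rightarrow> real"
  assumes bij: "bij_betw p UNIV {1..CARD('a)}" and pos: "\<forall>a. 0 < lam a"
    and int: "\<And>a. (f has_integral J a) {left_end p lam a..left_end p lam a + lam a}"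
  shows "(f has_integral (\<Sum>a\<in>UNIV. J a)) {0..total_length lam}"
proof -
  note q = bij_last[OF bij]
  have "(f has_integral (\<Sum>a | p a \<le> k. J a)) {0..(\<Sum>a | p a \<le> k. lam a)}" if "k \<le> CARD('a)" for k
    using that
  proof (induction k)
    case 0
    have "{a. p a \<le> 0} = {}" using q(2) by (auto simp: Suc_le_eq)
    then show ?case unfolding \<open>{a. p a \<le> 0} = {}\<close> by (simp add: has_integral_refl)
  next
    case (Suc k)
    have "Suc k \<in> p ` UNIV" using bij Suc.prems by (auto simp: bij_betw_def)
    then obtain b where b: "p b = Suc k" by (metis imageE)
    have eq: "{a. p a \<le> Suc k} = insert b {a. p a \<le> k}"
      using b q(3) by (auto simp: inj_def le_Suc_eq)
    have nb: "b \<notin> {a. p a \<le> k}" using b by simp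
    have lb: "left_end p lam b = (\<Sum>a | p a \<le> k. lam a)"
      by (simp add: left_end_def b less_Suc_eq_le)
    have "(f has_integral ((\<Sum>a | p a \<le> k. J a) + J b)) {0..(\<Sum>a | p a \<le> k. lam a) + lam b}"
    proof (rule has_integral_combine)
      show "0 \<le> (\<Sum>a | p a \<le> k. lam a)" using pos by (intro sum_nonneg) (auto intro: less_imp_le)
      show "(\<Sum>a | p a \<le> k. lam a) \<le> (\<Sum>a | p a \<le> k. lam a) + lam b" using pos by (simp add: less_imp_le)
      show "(f has_integral (\<Sum>a | p a \<le> k. J a)) {0..(\<Sum>a | p a \<le> k. lam a)}" using Suc by simp
      show "(f has_integral J b) {(\<Sum>a | p a \<le> k. lam a)..(\<Sum>a | p a \<le> k. lam a) + lam b}"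
        using int[of b] lb by simp
    qed
    then show ?case using nb by (simp add: eq add.commute)
  qed
  from this[of "CARD('a)"] have "(f has_integral (\<Sum>a | p a \<le> CARD('a). J a)) {0..(\<Sum>a | p a \<le> CARD('a). lam a)}"
    by simp
  moreover have "{a. p a \<le> CARD('a)} = UNIV" using q(1) by auto
  ultimately show ?thesis by (simp add: total_length_def)
qed

lemma integrable_on_piece:
  fixes p :: "'a::finite \<Rightarrow> nat" and f :: "real \<Rightarrow> real"
  assumes pos: "\<forall>a. 0 < lam a" and int: "f integrable_on {0..total_length lam}"
  shows "f integrable_on {left_end p lam a..left_end p lam a + lam a}"
  by (rule integrable_on_subinterval[OF int])
    (use left_end_nonneg[OF pos, of p a] left_end_add_le_total[OF pos, of p a] in auto)

text \<open>Used on both lines: equality of the two decompositions expresses that the exchange map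
  preserves integrals.\<close>

lemma sum_integral_pieces:
  fixes p :: "'a::finite \<Rightarrow> nat" and f :: "real \<Rightarrow> real"
  assumes bij: "bij_betw p UNIV {1..CARD('a)}" and pos: "\<forall>a. 0 < lam a"
    and int: "f integrable_on {0..total_length lam}"
  shows "(\<Sum>a\<in>UNIV. integral {left_end p lam a..left_end p lam a + lam a} f) = integral {0..total_length lam} f"
  by (rule integral_unique[symmetric], rule has_integral_pieces[OF bij pos], rule integrable_integral,
      rule integrable_on_piece[OF pos int])

lemma antiderivative_poly:
  fixes P :: "real poly"
  obtains R where "pderiv R = P" "degree R \<le> Suc (degree P)"
proof -
  define R where "R = (\<Sum>i\<le>degree P. monom (coeff P i / real (Suc i)) (Suc i))"
  have "pderiv R = (\<Sum>i\<le>degree P. pderiv (monom (coeff P i / real (Suc i)) (Suc i)))"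
    unfolding R_def using higher_pderiv_sum[of 1] by simp
  also have "\<dots> = (\<Sum>i\<le>degree P. monom (coeff P i) i)"
    by (intro sum.cong refl) (simp add: pderiv_monom del: of_nat_Suc)
  also have "\<dots> = P" by (rule poly_as_sum_of_monoms)
  finally have "pderiv R = P" .
  moreover have "degree R \<le> Suc (degree P)"
    unfolding R_def by (intro degree_sum_le) (auto intro: order.trans[OF degree_monom_le])
  ultimately show ?thesis using that by blast
qed

section \<open>From bounded Birkhoff sums to a coboundary\<close>

lemma birkhoff_sum_cong:
  assumes "\<And>x. x \<in> I \<Longrightarrow> T x = T' x \<and> f x = f' x \<and> T x \<in> I" "x \<in> I"
  shows "birkhoff_sum T f n x = birkhoff_sum T' f' n x"
  using assms(2)
proof (induction n arbitrary: x)
  case (Suc n)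
  have "T x = T' x" "f x = f' x" "T' x \<in> I" using assms(1)[OF Suc.prems] by auto
  then show ?case using Suc.IH[of "T' x"] by (simp add: birkhoff_sum_Suc)
qed simp

text \<open>\<open>\<Psi>\<close> is minus the upper limit of the Birkhoff sums: it satisfies the equation everywhere without any
  continuity argument, and it is Borel, which is needed to integrate it later.\<close>

lemma bounded_birkhoff_sums_coboundary:
  fixes T f :: "real \<Rightarrow> real"
  assumes T: "T \<in> borel_measurable borel" and f: "f \<in> borel_measurable borel"
    and inv: "\<And>x. x \<in> I \<Longrightarrow> T x \<in> I"
    and B: "\<And>n x. x \<in> I \<Longrightarrow> \<bar>birkhoff_sum T f n x\<bar> \<le> B"
  obtains \<Psi> where "\<Psi> \<in> borel_measurable borel" "\<And>x. x \<in> I \<Longrightarrow> \<bar>\<Psi> x\<bar> \<le> B"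
    "\<And>x. x \<in> I \<Longrightarrow> f x = \<Psi> (T x) - \<Psi> x"
proof -
  have meas: "birkhoff_sum T f n \<in> borel_measurable borel" for n
  proof (induction n)
    case 0
    then show ?case by (simp add: birkhoff_sum_def)
  next
    case (Suc n)
    have "birkhoff_sum T f (Suc n) = (\<lambda>x. f x + birkhoff_sum T f n (T x))"
      by (rule ext) (rule birkhoff_sum_Suc)
    then show ?case using f measurable_compose[OF T Suc] by simp
  qed
  define u where "u x = limsup (\<lambda>n. ereal (birkhoff_sum T f n x))" for x
  define \<Psi> where "\<Psi> x = - real_of_ereal (u x)" for x
  have "\<Psi> \<in> borel_measurable borel" unfolding \<Psi>_def u_def using meas by measurable
  moreover have fin: "\<exists>v. u x = ereal v \<and> \<bar>v\<bar> \<le> B" if x: "x \<in> I" for x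
  proof -
    have b: "birkhoff_sum T f n x \<le> B" "- B \<le> birkhoff_sum T f n x" for n
      using B[OF x, of n] by auto
    have "u x \<le> ereal B" unfolding u_def by (rule Limsup_bounded) (simp add: b)
    moreover have "ereal (- B) \<le> u x" unfolding u_def by (rule le_Limsup) (simp_all add: b)
    ultimately show ?thesis by (cases "u x") auto
  qed
  moreover have "f x = \<Psi> (T x) - \<Psi> x" if x: "x \<in> I" for x
  proof -
    have "u x = limsup (\<lambda>n. ereal (birkhoff_sum T f (n + 1) x))"
      unfolding u_def by (rule limsup_shift[symmetric])
    also have "\<dots> = limsup (\<lambda>n. ereal (f x) + ereal (birkhoff_sum T f n (T x)))"
      by (simp add: birkhoff_sum_Suc)
    also have "\<dots> = ereal (f x) + u (T x)"
      unfolding u_def by (rule ereal_limsup_lim_add) auto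
    finally have "u x = ereal (f x) + u (T x)" .
    then show ?thesis using fin[OF x] fin[OF inv[OF x]] by (auto simp: \<Psi>_def)
  qed
  ultimately show ?thesis using that[of \<Psi>] by (force simp: \<Psi>_def)
qed

lemma bounded_borel_integrable_on:
  fixes f :: "real \<Rightarrow> real"
  assumes "f \<in> borel_measurable borel" "\<And>x. x \<in> {0..<L} \<Longrightarrow> \<bar>f x\<bar> \<le> B"
  shows "f integrable_on {0..L}"
proof -
  \<comment> \<open>The right end point, where no bound is assumed, gets the value 0.\<close>
  define h where "h x = (if x \<in> {0..<L} then f x else 0)" for x
  have h: "h \<in> borel_measurable borel" unfolding h_def using assms(1) by measurable
  have "h integrable_on {0..L}"
  proof (rule measurable_bounded_by_integrable_imp_integrable)
    show "h \<in> borel_measurable (lebesgue_on {0..L})"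
      by (intro measurable_restrict_space1 measurable_completion) (simp add: h)
    show "(\<lambda>x. \<bar>B\<bar>) integrable_on {0..L}" by (rule integrable_const_ivl)
    show "norm (h x) \<le> \<bar>B\<bar>" if "x \<in> {0..L}" for x using assms(2)[of x] by (auto simp: h_def)
  qed simp
  then show ?thesis
    by (rule integrable_spike[of _ _ "{L}"]) (auto simp: h_def)
qed

section \<open>The case \<open>r = 1\<close>\<close>

lemma roth_type_imp_roth_iem:
  fixes p0 p1 :: "'a::finite \<Rightarrow> nat"
  assumes "CARD('a) \<ge> 2" "admissible p0 p1" "\<forall>a. lam a > 0" "roth_type p0 p1 lam"
  shows "roth_iem (p0, p1, lam)"
  using assms unfolding roth_type_def
  by unfold_locales (auto simp: keane_data_def)

text \<open>The condition of \<open>BV_star\<close> with its witness exposed, so that the sequence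
  of derivatives can be shifted by one in the induction on \<open>r\<close>.\<close>

definition BV_derivatives ::
  "('a::finite \<Rightarrow> nat) \<Rightarrow> ('a \<Rightarrow> real) \<Rightarrow> nat \<Rightarrow> (real \<Rightarrow> real) \<Rightarrow> (nat \<Rightarrow> real \<Rightarrow> real) \<Rightarrow> bool" where
  "BV_derivatives p lam r \<Phi> D \<longleftrightarrow>
      (\<forall>x\<in>{0..<total_length lam}. D 0 x = \<Phi> x) \<and>
      (\<forall>a. (\<forall>l. l + 1 < r \<longrightarrow> (\<forall>x\<in>piece p lam a.
                 (D l has_real_derivative D (l + 1) x) (at x within piece p lam a))) \<and>
           abs_continuous_on (D (r - 1)) (piece p lam a) \<and>
           (AE x in lebesgue. x \<in> piece p lam a \<longrightarrow>
                 (D (r - 1) has_real_derivative D r x) (at x within piece p lam a)) \<and>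
           bounded_variation_on (D r) (piece p lam a)) \<and>
      (\<forall>l. 0 < l \<and> l \<le> r \<longrightarrow> (D l has_integral 0) {0..<total_length lam})"

lemma BV_star_iff: "BV_star p lam r \<Phi> \<longleftrightarrow> (\<exists>D. BV_derivatives p lam r \<Phi> D)"
  by (simp only: BV_star_def BV_derivatives_def)

lemma BV_derivativesD:
  assumes "BV_derivatives p lam r \<Phi> D"
  shows "x \<in> {0..<total_length lam} \<Longrightarrow> D 0 x = \<Phi> x"
    "l + 1 < r \<Longrightarrow> x \<in> piece p lam a \<Longrightarrow> (D l has_real_derivative D (l + 1) x) (at x within piece p lam a)"
    "abs_continuous_on (D (r - 1)) (piece p lam a)"
    "AE x in lebesgue. x \<in> piece p lam a \<longrightarrow> (D (r - 1) has_real_derivative D r x) (at x within piece p lam a)"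
    "bounded_variation_on (D r) (piece p lam a)"
    "0 < l \<Longrightarrow> l \<le> r \<Longrightarrow> (D l has_integral 0) {0..<total_length lam}"
  using assms unfolding BV_derivatives_def by blast+

lemma abs_continuous_on_imp_continuous_on:
  assumes "abs_continuous_on F J"
  shows "continuous_on J F"
  unfolding continuous_on_iff
proof (intro ballI allI impI)
  fix x e :: real assume x: "x \<in> J" and e: "0 < e"
  obtain d where d: "0 < d" "\<forall>(n::nat) a b. (\<forall>i<n. a i \<in> J \<and> b i \<in> J \<and> a i \<le> b i) \<and>
      (\<forall>i<n. \<forall>j<n. i \<noteq> j \<longrightarrow> b i \<le> a j \<or> b j \<le> a i) \<and>
      (\<Sum>i<n. b i - a i) < d \<longrightarrow> (\<Sum>i<n. \<bar>F (b i) - F (a i)\<bar>) < e"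
    using assms[unfolded abs_continuous_on_def, rule_format, OF e] by blast
  have "dist (F y) (F x) < e" if "y \<in> J" "dist y x < d" for y
  proof (cases "x \<le> y")
    case True
    then show ?thesis using d(2)[rule_format, of 1 "\<lambda>_. x" "\<lambda>_. y"] that x by (auto simp: dist_real_def)
  next
    case False
    then show ?thesis using d(2)[rule_format, of 1 "\<lambda>_. y" "\<lambda>_. x"] that x by (auto simp: dist_real_def)
  qed
  then show "\<exists>d>0. \<forall>y\<in>J. dist y x < d \<longrightarrow> dist (F y) (F x) < e" using d(1) by blast
qed

lemma piece_borel: "piece p lam a \<in> sets borel"
  by (simp add: piece_def)

lemma sum_piece_indicator:
  fixes p :: "'a::finite \<Rightarrow> nat" and h :: "'a \<Rightarrow> real"
  assumes "inj p" "\<forall>a. 0 < lam a" "x \<in> piece p lam a"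
  shows "(\<Sum>b\<in>UNIV. indicator (piece p lam b) x * h b) = h a"
proof -
  have "x \<in> piece p lam b \<longleftrightarrow> b = a" for b
    using piece_unique[OF assms(1,2,3), of b] assms(3) by blast
  then have "(\<Sum>b\<in>UNIV. indicator (piece p lam b) x * h b) = (\<Sum>b\<in>UNIV. if b = a then h b else 0)"
    by (intro sum.cong) (simp_all add: indicator_def)
  then show ?thesis by simp
qed

text \<open>Integrability of \<open>\<Psi>\<close> is recorded because the induction on
  \<open>r\<close> starts by integrating it.\<close>

lemma cohomological_base:
  fixes p0 p1 :: "'a::finite \<Rightarrow> nat"
  assumes card: "CARD('a) \<ge> 2" and adm: "admissible p0 p1" and pos: "\<forall>a. lam a > 0"
    and roth: "roth_type p0 p1 lam" and BV: "BV_star p0 lam 1 \<Phi>"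
  obtains c :: "'a \<Rightarrow> real" and \<Psi> B where
    "\<And>x. x \<in> {0..<total_length lam} \<Longrightarrow> \<bar>\<Psi> x\<bar> \<le> B" "\<Psi> integrable_on {0..total_length lam}"
    "\<And>a x. x \<in> piece p0 lam a \<Longrightarrow> \<Phi> x = c a + \<Psi> (iem p0 p1 lam x) - \<Psi> x"
proof -
  define s where "s = (p0, p1, lam)"
  have s: "top_perm s = p0" "bot_perm s = p1" "lens s = lam" by (auto simp: s_def)
  interpret roth_iem s unfolding s_def by (rule roth_type_imp_roth_iem) fact+
  have bij: "bij_betw p0 UNIV {1..CARD('a)}" "bij_betw p1 UNIV {1..CARD('a)}"
    using adm by (auto simp: admissible_def)
  have inj: "inj p0" using bij_last(3)[OF bij(1)] .
  define E where "E a = left_end p0 lam a" for a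
  define L where "L = total_length lam"
  obtain D where D: "BV_derivatives p0 lam 1 \<Phi> D" using BV by (auto simp: BV_star_iff)
  note D' = BV_derivativesD[OF D]
  define D0 D1 where "D0 = D 0" and "D1 = D 1"
  have D: "\<And>x. x \<in> {0..<L} \<Longrightarrow> D0 x = \<Phi> x"
    "\<And>a. abs_continuous_on D0 (piece p0 lam a)"
    "\<And>a. AE x in lebesgue. x \<in> piece p0 lam a \<longrightarrow> (D0 has_real_derivative D1 x) (at x within piece p0 lam a)"
    "\<And>a. bounded_variation_on D1 (piece p0 lam a)"
    "(D1 has_integral 0) {0..<L}"
    using D'(1) D'(3-5)[unfolded diff_self_eq_0] D'(6)[of 1] by (simp_all add: D0_def D1_def L_def)
  define F where "F a y = D0 (E a + y)" for a y
  define G where "G a = (\<lambda>y. D1 (E a + y))" for a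
  have in_piece: "E a + y \<in> piece p0 lam a \<longleftrightarrow> 0 \<le> y \<and> y < lam a" for a y
    by (auto simp: E_def piece_def)
  have FG: "(G a has_integral (F a y - F a x)) {x..y}" if "0 \<le> x" "x \<le> y" "y < lam a" for a x y
  proof -
    have "(D1 has_integral (D0 (E a + y) - D0 (E a + x))) {E a + x..E a + y}"
      by (rule abs_continuous_on_has_integral[OF D(2) _ _ D(3)[of a]])
        (use that in \<open>auto simp: E_def piece_def\<close>)
    then have "((D1 \<circ> (+) (E a)) has_integral (D0 (E a + y) - D0 (E a + x))) {x..y}"
      unfolding has_integral_shift_Icc_real by (simp add: add.commute)
    then show ?thesis by (simp add: F_def G_def o_def)
  qed
  have osc: "\<exists>V. oscillates_within 0 G V"
  proof -
    have "\<exists>g B. (\<forall>x\<in>piece p0 lam a. 0 \<le> g x \<and> g x \<le> B) \<and>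
      (\<forall>x\<in>piece p0 lam a. \<forall>y\<in>piece p0 lam a. x \<le> y \<longrightarrow> \<bar>D1 y - D1 x\<bar> \<le> g y - g x)" for a
      using bounded_variation_on_majorant[OF D(4)[of a]] by metis
    then obtain g B where gB: "\<And>a x. x \<in> piece p0 lam a \<Longrightarrow> 0 \<le> g a x \<and> g a x \<le> B a"
      "\<And>a x y. x \<in> piece p0 lam a \<Longrightarrow> y \<in> piece p0 lam a \<Longrightarrow> x \<le> y \<Longrightarrow> \<bar>D1 y - D1 x\<bar> \<le> g a y - g a x"
      by metis
    have "oscillates_within 0 G (\<Sum>a\<in>UNIV. B a - 0)"
      unfolding oscillates_within_def
    proof (rule exI[of _ "\<lambda>a x. g a (E a + x)"], rule exI[of _ "\<lambda>_. 0"], rule exI[of _ B], intro conjI allI impI)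
      fix a x y assume "0 \<le> x" "x \<le> y" "y < lens (st 0) a"
      then show "\<bar>G a y - G a x\<bar> \<le> g a (E a + y) - g a (E a + x)"
        unfolding G_def by (intro gB(2)) (auto simp: in_piece s)
    next
      fix a x assume "0 \<le> x" "x < lens (st 0) a"
      then have "E a + x \<in> piece p0 lam a" by (auto simp: in_piece s)
      then show "0 \<le> g a (E a + x)" "g a (E a + x) \<le> B a" using gB(1) by auto
    qed simp
    then show ?thesis by blast
  qed
  then obtain V where osc: "oscillates_within 0 G V" by blast
  have D1int: "D1 integrable_on {0..total_length lam}" "integral {0..total_length lam} D1 = 0"
    using D(5) unfolding has_integral_Ico_iff L_def by (auto simp: integral_unique)
  have Gint: "(G a has_integral (integral {E a..E a + lam a} D1)) {0..lam a}" for a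
  proof -
    have "(D1 has_integral (integral {E a..E a + lam a} D1)) {0 + E a..lam a + E a}"
      using integrable_integral[OF integrable_on_piece[OF pos D1int(1), of p0 a]] by (simp add: E_def add.commute)
    then have "((D1 \<circ> (+) (E a)) has_integral (integral {E a..E a + lam a} D1)) {0..lam a}"
      unfolding has_integral_shift_Icc_real .
    then show ?thesis by (simp add: G_def o_def)
  qed
  have int: "G a integrable_on {0..lens (st 0) a}" for a using Gint[of a] by (auto simp: s)
  have sum0: "(\<Sum>a\<in>UNIV. integral {0..lens (st 0) a} (G a)) = 0"
    using sum_integral_pieces[OF bij(1) pos D1int(1)] D1int(2) by (simp add: s integral_unique[OF Gint] E_def)
  obtain \<xi> \<rho> C where C: "0 < \<rho>" "0 < C"
    "\<And>k a y. 0 \<le> y \<Longrightarrow> y < lens (st (nseq s k)) a \<Longrightarrow>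
       \<bar>special_sum (\<lambda>a y. F a y - \<xi> $ a) (nseq s k) a y\<bar> \<le> C * N k powr (- \<rho>)"
  proof (rule special_sum_decay[OF _ osc int sum0])
    show "(G a has_integral (F a y - F a x)) {x..y}" if "0 \<le> x" "x \<le> y" "y < lens (st 0) a" for a x y
      using FG that by (simp add: s)
  qed (rule that)
  obtain B where B: "\<And>j x. x \<in> {0..<total_length (lens s)} \<Longrightarrow>
     \<bar>birkhoff_sum (iem_of s) (level_fun (\<lambda>a y. F a y - \<xi> $ a) 0) j x\<bar> \<le> B"
    by (rule bounded_birkhoff_sums[OF C]; (assumption | rule that))
  \<comment> \<open>Versions of the map and of the corrected function on the whole line: as finite
    sums over indicators of pieces they are Borel, and they agree with the originals on the
    interval.\<close>
  define T where "T x = (\<Sum>a\<in>UNIV. indicator (piece p0 lam a) x * (x - E a + left_end p1 lam a))" for x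
  define f where "f x = (\<Sum>a\<in>UNIV. indicator (piece p0 lam a) x * (D0 x - \<xi> $ a))" for x
  have Tf: "T x = iem p0 p1 lam x" "f x = \<Phi> x - \<xi> $ a" "level_fun (\<lambda>a y. F a y - \<xi> $ a) 0 x = f x"
    if x: "x \<in> piece p0 lam a" for x a
  proof -
    have xI: "x \<in> {0..<L}" using x piece_subset[OF pos] unfolding L_def by blast
    show "T x = iem p0 p1 lam x"
      unfolding T_def iem_eq[OF inj pos x] sum_piece_indicator[OF inj pos x] by (simp add: E_def)
    show f: "f x = \<Phi> x - \<xi> $ a"
      unfolding f_def sum_piece_indicator[OF inj pos x] using D(1)[OF xI] by simp
    have "level_fun (\<lambda>a y. F a y - \<xi> $ a) 0 (left_end (top_perm (st 0)) (lens (st 0)) a + (x - E a)) =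
      special_sum (\<lambda>a y. F a y - \<xi> $ a) 0 a (x - E a)"
      by (rule level_fun_eq) (use x in \<open>auto simp: s E_def piece_def\<close>)
    then show "level_fun (\<lambda>a y. F a y - \<xi> $ a) 0 x = f x"
      unfolding f using D(1)[OF xI] by (simp add: s E_def[symmetric] F_def)
  qed
  have cover: "\<exists>a. x \<in> piece p0 lam a" if "x \<in> {0..<L}" for x
    using piece_exists[OF bij(1), of x lam] that by (auto simp: L_def)
  have TI: "T x \<in> {0..<L}" if "x \<in> {0..<L}" for x
    using cover[OF that] Tf(1) iem_mem[OF bij(1) pos, of x p1] that by (auto simp: L_def)
  have Tm: "T \<in> borel_measurable borel"
    unfolding T_def by (intro borel_measurable_sum borel_measurable_times borel_measurable_indicator piece_borel) auto
  have fm: "f \<in> borel_measurable borel"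
    unfolding f_def
  proof (intro borel_measurable_sum)
    fix a
    have "continuous_on (piece p0 lam a) (\<lambda>x. D0 x - \<xi> $ a)"
      by (intro continuous_intros abs_continuous_on_imp_continuous_on D)
    from borel_measurable_continuous_on_indicator[OF piece_borel this]
    show "(\<lambda>x. indicator (piece p0 lam a) x * (D0 x - \<xi> $ a)) \<in> borel_measurable borel" by simp
  qed
  have BT: "\<bar>birkhoff_sum T f n x\<bar> \<le> B" if x: "x \<in> {0..<L}" for n x
  proof -
    have "birkhoff_sum T f n x = birkhoff_sum (iem_of s) (level_fun (\<lambda>a y. F a y - \<xi> $ a) 0) n x"
    proof (rule birkhoff_sum_cong[OF _ x])
      fix y assume y: "y \<in> {0..<L}"
      then obtain a where "y \<in> piece p0 lam a" using cover by blast
      then show "T y = iem_of s y \<and> f y = level_fun (\<lambda>a y. F a y - \<xi> $ a) 0 y \<and> T y \<in> {0..<L}"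
        using Tf TI[OF y] by (simp add: s)
    qed
    then show ?thesis using B[of x n] x by (simp add: s L_def)
  qed
  obtain \<Psi> where \<Psi>: "\<Psi> \<in> borel_measurable borel" "\<And>x. x \<in> {0..<L} \<Longrightarrow> \<bar>\<Psi> x\<bar> \<le> B"
    "\<And>x. x \<in> {0..<L} \<Longrightarrow> f x = \<Psi> (T x) - \<Psi> x"
    using bounded_birkhoff_sums_coboundary[OF Tm fm TI BT] by blast
  have "\<Phi> x = \<xi> $ a + \<Psi> (iem p0 p1 lam x) - \<Psi> x" if x: "x \<in> piece p0 lam a" for a x
  proof -
    have "x \<in> {0..<L}" using x piece_subset[OF pos] unfolding L_def by blast
    then show ?thesis using \<Psi>(3)[of x] Tf(1,2)[OF x] by simp
  qed
  then show ?thesis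
    using that[of \<Psi> B "\<lambda>a. \<xi> $ a"] \<Psi>(2) bounded_borel_integrable_on[OF \<Psi>(1,2)] by (auto simp: L_def)
qed

section \<open>The induction on \<open>r\<close>\<close>

lemma Gamma_star_piecewise_const:
  fixes p0 :: "'a::finite \<Rightarrow> nat"
  assumes "\<And>a x. x \<in> piece p0 lam a \<Longrightarrow> g x = c a"
  shows "Gamma_star p0 lam 1 g"
  unfolding Gamma_star_def
proof
  show "Gamma_poly p0 lam 1 g"
    unfolding Gamma_poly_def by (rule exI[of _ "\<lambda>a. [:c a:]"]) (simp add: assms)
  show "BV_star p0 lam 1 g"
    unfolding BV_star_def
  proof (rule exI[of _ "\<lambda>l. if l = 0 then g else (\<lambda>_. 0)"], intro conjI allI ballI impI)
    fix a
    show "abs_continuous_on (if 1 - 1 = (0::nat) then g else (\<lambda>_. 0)) (piece p0 lam a)"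
      unfolding abs_continuous_on_def
    proof (intro allI impI)
      fix e :: real assume "0 < e"
      have "(\<Sum>i<n. \<bar>g (y i) - g (x i)\<bar>) = 0"
        if "\<forall>i<n. x i \<in> piece p0 lam a \<and> y i \<in> piece p0 lam a \<and> x i \<le> y i" for n :: nat and x y :: "nat \<Rightarrow> real"
        using that assms by (intro sum.neutral) auto
      then show "\<exists>d>0. \<forall>(n::nat) x y. (\<forall>i<n. x i \<in> piece p0 lam a \<and> y i \<in> piece p0 lam a \<and> x i \<le> y i) \<and>
         (\<forall>i<n. \<forall>j<n. i \<noteq> j \<longrightarrow> y i \<le> x j \<or> y j \<le> x i) \<and> (\<Sum>i<n. y i - x i) < d \<longrightarrow>
         (\<Sum>i<n. \<bar>(if 1 - 1 = (0::nat) then g else (\<lambda>_. 0)) (y i) - (if 1 - 1 = (0::nat) then g else (\<lambda>_. 0)) (x i)\<bar>) < e"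
        using \<open>0 < e\<close> by (intro exI[of _ 1]) auto
    qed
    have "(g has_real_derivative 0) (at x within piece p0 lam a)" if "x \<in> piece p0 lam a" for x
      by (rule has_field_derivative_transform_within[of "\<lambda>_. c a", OF _ zero_less_one that])
        (auto simp: assms)
    then show "AE x in lebesgue. x \<in> piece p0 lam a \<longrightarrow>
        ((if 1 - 1 = (0::nat) then g else (\<lambda>_. 0)) has_real_derivative (if 1 = (0::nat) then g else (\<lambda>_. 0)) x) (at x within piece p0 lam a)"
      by simp
    show "bounded_variation_on (if 1 = (0::nat) then g else (\<lambda>_. 0)) (piece p0 lam a)"
      unfolding bounded_variation_on_def by (intro exI[of _ 0]) auto
  qed auto
qed

text \<open>The derivatives of \<open>g\<close> are those of \<open>g'\<close> shifted by one index.
  The only new mean-value condition is the one of order 1, which is \<open>mean\<close>.\<close>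

lemma Gamma_star_antiderivative:
  fixes p :: "'a::finite \<Rightarrow> nat"
  assumes pos: "\<forall>a. 0 < lam a" and r: "1 \<le> r" and G: "Gamma_star p lam r g'"
    and mean: "(g' has_integral 0) {0..<total_length lam}"
    and R: "\<And>a. degree (R a) < Suc r" "\<And>a x. x \<in> piece p lam a \<Longrightarrow> poly (pderiv (R a)) x = g' x"
    and g: "\<And>a x. x \<in> piece p lam a \<Longrightarrow> g x = poly (R a) x"
  shows "Gamma_star p lam (Suc r) g"
  unfolding Gamma_star_def
proof
  show "Gamma_poly p lam (Suc r) g"
    unfolding Gamma_poly_def using R g by (intro exI[of _ R]) auto
  obtain D where D: "BV_derivatives p lam r g' D" using G by (auto simp: Gamma_star_def BV_star_iff)
  note d = BV_derivativesD[OF D]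
  define D' where "D' l = (case l of 0 \<Rightarrow> g | Suc m \<Rightarrow> D m)" for l
  have D': "D' 0 = g" "\<And>m. D' (Suc m) = D m" by (auto simp: D'_def)
  have "BV_derivatives p lam (Suc r) g D'"
    unfolding BV_derivatives_def
  proof (intro conjI allI ballI impI)
    fix x show "D' 0 x = g x" by (simp add: D')
  next
    fix a l x assume l: "l + 1 < Suc r" and x: "x \<in> piece p lam a"
    show "(D' l has_real_derivative D' (l + 1) x) (at x within piece p lam a)"
    proof (cases l)
      case 0
      have "x \<in> {0..<total_length lam}" using x piece_subset[OF pos] by blast
      then have e: "D 0 x = poly (pderiv (R a)) x" using d(1) R(2)[OF x] by simp
      have "(poly (R a) has_real_derivative D 0 x) (at x within piece p lam a)"
        unfolding e by (rule has_field_derivative_at_within[OF poly_DERIV])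
      then have "(g has_real_derivative D 0 x) (at x within piece p lam a)"
        by (rule has_field_derivative_transform_within[OF _ zero_less_one x]) (simp add: g)
      then show ?thesis using 0 by (simp add: D')
    next
      case (Suc m)
      then show ?thesis using d(2)[of m x a] l x by (simp add: D')
    qed
  next
    fix a
    obtain q where q: "r = Suc q" using r by (cases r) auto
    show "abs_continuous_on (D' (Suc r - 1)) (piece p lam a)" using d(3)[of a] by (simp add: q D')
    show "AE x in lebesgue. x \<in> piece p lam a \<longrightarrow> (D' (Suc r - 1) has_real_derivative D' (Suc r) x) (at x within piece p lam a)"
      using d(4)[of a] by (simp add: q D')
    show "bounded_variation_on (D' (Suc r)) (piece p lam a)" using d(5)[of a] by (simp add: D')
  next
    fix l assume l: "0 < l \<and> l \<le> Suc r"
    show "(D' l has_integral 0) {0..<total_length lam}"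
    proof (cases "l = 1")
      case True
      have "(D 0 has_integral 0) {0..<total_length lam}"
        by (rule has_integral_eq[OF _ mean]) (simp add: d(1))
      then show ?thesis using True by (simp add: D')
    next
      case False
      then obtain m where "l = Suc m" "0 < m" using l by (cases l) auto
      then show ?thesis using d(6)[of m] l by (simp add: D')
    qed
  qed
  then show "BV_star p lam (Suc r) g" by (auto simp: BV_star_iff)
qed

lemma has_integral_primitive_diff:
  fixes f :: "real \<Rightarrow> real"
  assumes "f integrable_on {0..L}" "0 \<le> u" "u \<le> v" "v \<le> L"
  shows "(f has_integral (integral {0..v} f - integral {0..u} f)) {u..v}"
proof -
  have i: "f integrable_on {0..v}" "f integrable_on {u..v}"
    using assms by (auto intro!: integrable_on_subinterval[OF assms(1)])
  have "integral {0..u} f + integral {u..v} f = integral {0..v} f"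
    by (rule Henstock_Kurzweil_Integration.integral_combine[OF assms(2,3) i(1)])
  then have "integral {0..v} f - integral {0..u} f = integral {u..v} f" by linarith
  then show ?thesis using integrable_integral[OF i(2)] by simp
qed

text \<open>For \<open>r = 1\<close> a bounded integrand has a Lipschitz primitive. For larger
  \<open>r\<close> continuity of the integrand makes the primitive differentiable at every point,
  and the derivatives shift by one.\<close>

lemma C_Lip_antiderivative:
  fixes \<psi> :: "real \<Rightarrow> real"
  assumes r: "1 \<le> r" and C: "C_Lip L r \<psi>" and int: "\<psi> integrable_on {0..L}"
    and cont: "2 \<le> r \<Longrightarrow> continuous_on {0..<L} \<psi>"
  defines "\<Psi> \<equiv> \<lambda>x. integral {0..x} \<psi>"
  shows "C_Lip L (Suc r) \<Psi>"
proof -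
  show ?thesis
  proof (cases "r = 1")
    case True
    then obtain B where B: "\<forall>x\<in>{0..<L}. \<bar>\<psi> x\<bar> \<le> B" using C unfolding C_Lip_def by auto
    have B0: "0 \<le> max B 0" by simp
    have half: "\<bar>\<Psi> v - \<Psi> u\<bar> \<le> max B 0 * (v - u)" if "0 \<le> u" "u \<le> v" "v < L" for u v
    proof -
      have "(\<psi> has_integral (\<Psi> v - \<Psi> u)) {u..v}"
        unfolding \<Psi>_def using that by (intro has_integral_primitive_diff[OF int]) auto
      moreover have "norm (\<psi> x) \<le> max B 0" if "x \<in> {u..v} - {}" for x
        using B[rule_format, of x] that \<open>0 \<le> u\<close> \<open>v < L\<close> by auto
      ultimately have "norm (\<Psi> v - \<Psi> u) \<le> max B 0 * Henstock_Kurzweil_Integration.content {u..v}"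
        by (intro has_integral_bound_real[OF B0 finite.emptyI])
      then show ?thesis using that by simp
    qed
    have "(max B 0)-lipschitz_on {0..<L} \<Psi>"
    proof (rule lipschitz_onI[OF _ B0])
      fix u v assume "u \<in> {0..<L}" "v \<in> {0..<L}"
      then show "dist (\<Psi> u) (\<Psi> v) \<le> max B 0 * dist u v"
        using half[of u v] half[of v u] by (cases "u \<le> v") (auto simp: dist_real_def)
    qed
    then show ?thesis using True unfolding C_Lip_def
      by (simp del: One_nat_def) (intro exI[of _ "\<lambda>_. \<Psi>"] conjI, auto)
  next
    case False
    then have r2: "2 \<le> r" using r by simp
    obtain D where D: "\<forall>x\<in>{0..<L}. D 0 x = \<psi> x"
      "\<forall>l. l + 2 < r \<longrightarrow> (\<forall>x\<in>{0..<L}. (D l has_real_derivative D (l + 1) x) (at x within {0..<L}))"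
      "\<exists>K. K-lipschitz_on {0..<L} (D (r - 2))"
      using C r2 unfolding C_Lip_def by auto
    define D' where "D' l = (case l of 0 \<Rightarrow> \<Psi> | Suc m \<Rightarrow> D m)" for l
    have D': "D' 0 = \<Psi>" "\<And>m. D' (Suc m) = D m" by (auto simp: D'_def)
    have der: "(\<Psi> has_real_derivative \<psi> x) (at x within {0..<L})" if x: "x \<in> {0..<L}" for x
    proof -
      \<comment> \<open>Continuity is known on the half-open interval only, so the derivative is
        computed on a compact subinterval that contains a neighbourhood of \<open>x\<close>.\<close>
      obtain b where b: "x < b" "b < L" using x dense by auto
      have "(\<Psi> has_real_derivative \<psi> x) (at x within {0..b})"
        unfolding \<Psi>_def
        by (rule integral_has_real_derivative[OF continuous_on_subset[OF cont[OF r2]]]) (use x b in auto)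
      moreover have "at x within {0..<L} = at x within {0..b}"
        by (rule at_within_nhd[of _ "{..<b}"]) (use x b in auto)
      ultimately show ?thesis by simp
    qed
    have "(\<forall>x\<in>{0..<L}. D' 0 x = \<Psi> x) \<and>
      (\<forall>l. l + 2 < Suc r \<longrightarrow> (\<forall>x\<in>{0..<L}. (D' l has_real_derivative D' (l + 1) x) (at x within {0..<L}))) \<and>
      (\<exists>K. K-lipschitz_on {0..<L} (D' (Suc r - 2)))"
    proof (intro conjI allI impI ballI)
      fix x show "D' 0 x = \<Psi> x" by (simp add: D')
    next
      fix l x assume l: "l + 2 < Suc r" and x: "x \<in> {0..<L}"
      show "(D' l has_real_derivative D' (l + 1) x) (at x within {0..<L})"
      proof (cases l)
        case 0
        then show ?thesis using der[OF x] D(1) x by (simp add: D')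
      next
        case (Suc m)
        then show ?thesis using D(2) l x by (simp add: D')
      qed
    next
      have "Suc r - 2 = Suc (r - 2)" using r2 by simp
      then show "\<exists>K. K-lipschitz_on {0..<L} (D' (Suc r - 2))" using D(3) by (simp add: D')
    qed
    then show ?thesis using r2 unfolding C_Lip_def by auto
  qed
qed

text \<open>Integrability and continuity of \<open>\<Psi>\<close> are carried along so that its
  primitive can be taken. In the induction step \<open>chi\<close> is defined as the residual, so
  the equation is automatic and only the form of \<open>chi\<close> is at stake: on a piece
  \<open>T\<close> is a translation, so increments of \<open>chi\<close> are integrals of the
  polynomial \<open>g\<close>.\<close>

lemma cohomological_equation:
  fixes p0 p1 :: "'a::finite \<Rightarrow> nat"
  assumes card: "CARD('a) \<ge> 2" and adm: "admissible p0 p1" and pos: "\<forall>a. lam a > 0"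
    and roth: "roth_type p0 p1 lam" and r: "1 \<le> r" and BV: "BV_star p0 lam r \<Phi>"
  shows "\<exists>chi \<Psi>. Gamma_star p0 lam r chi \<and> C_Lip (total_length lam) r \<Psi> \<and>
      \<Psi> integrable_on {0..total_length lam} \<and> (2 \<le> r \<longrightarrow> continuous_on {0..<total_length lam} \<Psi>) \<and>
      (\<forall>x\<in>{0..<total_length lam}. \<Phi> x = chi x + \<Psi> (iem p0 p1 lam x) - \<Psi> x)"
  using r BV
proof (induction r arbitrary: \<Phi> rule: dec_induct)
  case base
  have bij: "bij_betw p0 UNIV {1..CARD('a)}" using adm by (auto simp: admissible_def)
  obtain c \<Psi> B where h: "\<And>x. x \<in> {0..<total_length lam} \<Longrightarrow> \<bar>\<Psi> x\<bar> \<le> B" "\<Psi> integrable_on {0..total_length lam}"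
    "\<And>a x. x \<in> piece p0 lam a \<Longrightarrow> \<Phi> x = c a + \<Psi> (iem p0 p1 lam x) - \<Psi> x"
    using cohomological_base[OF card adm pos roth base] by metis
  define chi where "chi x = \<Phi> x - \<Psi> (iem p0 p1 lam x) + \<Psi> x" for x
  have "Gamma_star p0 lam 1 chi"
    by (rule Gamma_star_piecewise_const[where c=c]) (simp add: chi_def h(3))
  moreover have "C_Lip (total_length lam) 1 \<Psi>" using h(1) unfolding C_Lip_def by (simp only: order_refl if_True) blast
  moreover have "\<forall>x\<in>{0..<total_length lam}. \<Phi> x = chi x + \<Psi> (iem p0 p1 lam x) - \<Psi> x"
    by (simp add: chi_def)
  ultimately show ?case using h(2) by (intro exI[of _ chi] exI[of _ \<Psi>]) simp
next
  case (step r)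
  define L where "L = total_length lam"
  define T where "T = iem p0 p1 lam"
  define E where "E = left_end p0 lam"
  define B where "B = left_end p1 lam"
  have bij: "bij_betw p0 UNIV {1..CARD('a)}" "bij_betw p1 UNIV {1..CARD('a)}"
    using adm by (auto simp: admissible_def)
  have inj: "inj p0" using bij_last(3)[OF bij(1)] .
  obtain D where D: "BV_derivatives p0 lam (Suc r) \<Phi> D" using step.prems by (auto simp: BV_star_iff)
  note d = BV_derivativesD[OF D]
  have "BV_derivatives p0 lam r (D 1) (\<lambda>l. D (Suc l))"
  proof -
    obtain q where q: "r = Suc q" using step.hyps by (cases r) auto
    show ?thesis
      unfolding BV_derivatives_def
    proof (intro conjI allI ballI impI)
      fix a l x assume "l + 1 < r" "x \<in> piece p0 lam a"
      then show "(D (Suc l) has_real_derivative D (Suc (l + 1)) x) (at x within piece p0 lam a)"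
        using d(2)[of "Suc l" x a] by simp
    next
      fix a
      show "abs_continuous_on (D (Suc (r - 1))) (piece p0 lam a)" using d(3)[of a] by (simp add: q)
      show "AE x in lebesgue. x \<in> piece p0 lam a \<longrightarrow> (D (Suc (r - 1)) has_real_derivative D (Suc r) x) (at x within piece p0 lam a)"
        using d(4)[of a] by (simp add: q)
      show "bounded_variation_on (D (Suc r)) (piece p0 lam a)" by (rule d(5))
    next
      fix l assume "0 < l \<and> l \<le> r"
      then show "(D (Suc l) has_integral 0) {0..<total_length lam}" by (intro d(6)) auto
    qed simp
  qed
  then have "BV_star p0 lam r (D 1)" by (auto simp: BV_star_iff)
  from step.IH[OF this] obtain g \<psi> where g: "Gamma_star p0 lam r g" and \<psi>: "C_Lip L r \<psi>" "\<psi> integrable_on {0..L}"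
    "2 \<le> r \<Longrightarrow> continuous_on {0..<L} \<psi>" and eq: "\<And>x. x \<in> {0..<L} \<Longrightarrow> D 1 x = g x + \<psi> (T x) - \<psi> x"
    unfolding L_def T_def by blast
  define \<Psi> where "\<Psi> x = integral {0..x} \<psi>" for x
  define chi where "chi x = \<Phi> x - \<Psi> (T x) + \<Psi> x" for x
  have \<Psi>int: "(\<psi> has_integral (\<Psi> v - \<Psi> u)) {u..v}" if "0 \<le> u" "u \<le> v" "v \<le> L" for u v
    unfolding \<Psi>_def using \<psi>(2) that by (rule has_integral_primitive_diff)
  have E: "0 \<le> E a" "E a + lam a \<le> L" "0 \<le> B a" "B a + lam a \<le> L" for a
    unfolding E_def B_def L_def
    using left_end_nonneg[OF pos] left_end_add_le_total[OF pos] by auto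
  have piece_iff: "x \<in> piece p0 lam a \<longleftrightarrow> E a \<le> x \<and> x < E a + lam a" for x a by (auto simp: piece_def E_def)
  have Tx: "T x = x + (B a - E a)" if "x \<in> piece p0 lam a" for x a
    using iem_eq[OF inj pos that, of p1] by (simp add: T_def E_def B_def)
  have \<psi>T: "((\<lambda>t. \<psi> (t + (B a - E a))) has_integral (\<Psi> (v + (B a - E a)) - \<Psi> (u + (B a - E a)))) {u..v}"
    if "E a \<le> u" "u \<le> v" "v \<le> E a + lam a" for u v a
  proof -
    have "(\<psi> has_integral (\<Psi> (v + (B a - E a)) - \<Psi> (u + (B a - E a)))) {u + (B a - E a)..v + (B a - E a)}"
      using that E[of a] by (intro \<Psi>int) auto
    then show ?thesis unfolding has_integral_shift_Icc_real[symmetric] by (simp add: o_def add.commute)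
  qed
  obtain P where P: "\<And>a. degree (P a) < r" "\<And>a x. x \<in> piece p0 lam a \<Longrightarrow> g x = poly (P a) x"
    using g unfolding Gamma_star_def Gamma_poly_def by metis
  have "\<exists>R. pderiv R = P a \<and> degree R \<le> Suc (degree (P a))" for a
    using antiderivative_poly[of "P a"] by metis
  then obtain R where R: "\<And>a. pderiv (R a) = P a" "\<And>a. degree (R a) \<le> Suc (degree (P a))" by metis
  \<comment> \<open>The constant of integration is fixed by the residual at the left end of the
    piece.\<close>
  define R' where "R' a = R a + [:chi (E a) - poly (R a) (E a):]" for a
  have R': "degree (R' a) < Suc r" "pderiv (R' a) = P a" for a
  proof -
    have "degree (R' a) \<le> max (degree (R a)) 0" unfolding R'_def by (rule order.trans[OF degree_add_le_max]) simp
    then show "degree (R' a) < Suc r" using R(2)[of a] P(1)[of a] by simp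
    show "pderiv (R' a) = P a" by (simp add: R'_def pderiv_add R(1) pderiv_pCons)
  qed
  have chi: "chi x = poly (R' a) x" if x: "x \<in> piece p0 lam a" for x a
  proof -
    have xE: "E a \<le> x" "x < E a + lam a" using x by (auto simp: piece_iff)
    have Ea: "E a \<in> piece p0 lam a" using pos by (simp add: piece_iff)
    have sub: "{E a..x} \<subseteq> piece p0 lam a" using xE by (auto simp: piece_iff)
    have pI: "t \<in> {0..<L}" if "t \<in> piece p0 lam a" for t using that piece_subset[OF pos] unfolding L_def by blast
    have "(D 1 has_integral (D 0 x - D 0 (E a))) {E a..x}"
    proof (rule fundamental_theorem_of_calculus[OF xE(1)])
      fix t assume t: "t \<in> {E a..x}"
      have "(D 0 has_real_derivative D (0 + 1) t) (at t within piece p0 lam a)"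
        using t sub step.hyps by (intro d(2)) auto
      then show "(D 0 has_vector_derivative D 1 t) (at t within {E a..x})"
        using has_field_derivative_subset[OF _ sub] by (simp add: has_real_derivative_iff_has_vector_derivative)
    qed
    then have 1: "(D 1 has_integral (\<Phi> x - \<Phi> (E a))) {E a..x}"
      using d(1)[of x] d(1)[of "E a"] pI[OF x] pI[OF Ea] by (simp add: L_def)
    have "(poly (P a) has_integral (poly (R a) x - poly (R a) (E a))) {E a..x}"
    proof (rule fundamental_theorem_of_calculus[OF xE(1)])
      fix t assume "t \<in> {E a..x}"
      show "(poly (R a) has_vector_derivative poly (P a) t) (at t within {E a..x})"
        using has_field_derivative_at_within[OF poly_DERIV[of "R a" t]] R(1)[of a]
        by (simp add: has_real_derivative_iff_has_vector_derivative)
    qed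
    from has_integral_diff[OF has_integral_add[OF this \<psi>T[of a "E a" x]] \<Psi>int[of "E a" x]] xE E[of a]
    have 2: "((\<lambda>t. poly (P a) t + \<psi> (t + (B a - E a)) - \<psi> t) has_integral
      (poly (R a) x - poly (R a) (E a) + (\<Psi> (x + (B a - E a)) - \<Psi> (E a + (B a - E a))) - (\<Psi> x - \<Psi> (E a)))) {E a..x}"
      by auto
    have "(D 1 has_integral (poly (R a) x - poly (R a) (E a) +
      (\<Psi> (x + (B a - E a)) - \<Psi> (E a + (B a - E a))) - (\<Psi> x - \<Psi> (E a)))) {E a..x}"
    proof (rule has_integral_eq[OF _ 2])
      fix t assume "t \<in> {E a..x}"
      then have t: "t \<in> piece p0 lam a" using sub by blast
      show "poly (P a) t + \<psi> (t + (B a - E a)) - \<psi> t = D 1 t"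
        using eq[OF pI[OF t]] P(2)[OF t] Tx[OF t] by simp
    qed
    from has_integral_unique[OF 1 this]
    have "chi x - chi (E a) = poly (R a) x - poly (R a) (E a)"
      unfolding chi_def Tx[OF x] Tx[OF Ea] by simp
    then show ?thesis by (simp add: R'_def)
  qed
  \<comment> \<open>\<open>D 1\<close> has mean 0, and \<open>\<psi> \<circ> T - \<psi>\<close>
    integrates to 0 because the bottom pieces tile the same interval as the top ones.\<close>
  have mean: "(g has_integral 0) {0..<total_length lam}"
  proof -
    have D1: "(D 1 has_integral 0) {0..L}" using d(6)[of 1] unfolding has_integral_Ico_iff L_def by simp
    then have D1i: "D 1 integrable_on {0..total_length lam}" "integral {0..total_length lam} (D 1) = 0"
      by (auto simp: L_def integral_unique)
    define J where "J a = integral {E a..E a + lam a} (D 1) -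
       (integral {B a..B a + lam a} \<psi> - integral {E a..E a + lam a} \<psi>)" for a
    have "(g has_integral J a) {E a..E a + lam a}" for a
    proof -
      have i\<psi>: "integral {E a..E a + lam a} \<psi> = \<Psi> (E a + lam a) - \<Psi> (E a)"
        "integral {B a..B a + lam a} \<psi> = \<Psi> (B a + lam a) - \<Psi> (B a)"
        using E[of a] pos by (auto intro!: integral_unique \<Psi>int simp: less_imp_le)
      have "((\<lambda>t. D 1 t - (\<psi> (t + (B a - E a)) - \<psi> t)) has_integral J a) {E a..E a + lam a}"
        unfolding J_def
      proof (intro has_integral_diff)
        show "(D 1 has_integral integral {E a..E a + lam a} (D 1)) {E a..E a + lam a}"
          using integrable_integral[OF integrable_on_piece[OF pos D1i(1), of p0 a]] by (simp add: E_def)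
        show "((\<lambda>t. \<psi> (t + (B a - E a))) has_integral integral {B a..B a + lam a} \<psi>) {E a..E a + lam a}"
          using \<psi>T[of a "E a" "E a + lam a"] pos unfolding i\<psi> by (simp add: less_imp_le add.commute)
        show "(\<psi> has_integral integral {E a..E a + lam a} \<psi>) {E a..E a + lam a}"
          unfolding i\<psi> using E[of a] pos by (intro \<Psi>int) (auto simp: less_imp_le)
      qed
      then show ?thesis
      \<comment> \<open>The pieces are half-open, so the equation for \<open>g\<close> is available
        everywhere except at the right end point.\<close>
      proof (rule has_integral_spike[of "{E a + lam a}", rotated 2])
        fix t assume "t \<in> {E a..E a + lam a} - {E a + lam a}"
        then have t: "t \<in> piece p0 lam a" by (auto simp: piece_iff)
        then have "t \<in> {0..<L}" using piece_subset[OF pos] unfolding L_def by blast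
        then show "g t = D 1 t - (\<psi> (t + (B a - E a)) - \<psi> t)" using eq Tx[OF t] by simp
      qed simp
    qed
    then have "(g has_integral (\<Sum>a\<in>UNIV. J a)) {0..total_length lam}"
      unfolding E_def by (rule has_integral_pieces[OF bij(1) pos])
    moreover have "(\<Sum>a\<in>UNIV. J a) = 0"
      using sum_integral_pieces[OF bij(1) pos D1i(1)] D1i(2) sum_integral_pieces[OF bij(1) pos, of \<psi>]
        sum_integral_pieces[OF bij(2) pos, of \<psi>] \<psi>(2)
      by (simp add: J_def sum_subtractf E_def B_def L_def)
    ultimately show ?thesis by (simp add: has_integral_Ico_iff)
  qed
  have "Gamma_star p0 lam (Suc r) chi"
    using Gamma_star_antiderivative[OF pos step.hyps(1) g mean R'(1) _ chi] R'(2) P(2) by simp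
  moreover have "C_Lip L (Suc r) \<Psi>"
    unfolding \<Psi>_def[abs_def] by (rule C_Lip_antiderivative[OF step.hyps(1) \<psi>])
  moreover have "continuous_on {0..L} \<Psi>"
    unfolding \<Psi>_def[abs_def] by (rule indefinite_integral_continuous_1[OF \<psi>(2)])
  then have "\<Psi> integrable_on {0..L}" "continuous_on {0..<L} \<Psi>"
    by (auto intro: integrable_continuous_real continuous_on_subset)
  moreover have "\<forall>x\<in>{0..<L}. \<Phi> x = chi x + \<Psi> (T x) - \<Psi> x" by (simp add: chi_def)
  ultimately show ?case unfolding L_def T_def by blast
qed

theorem mainTheorem8:
  fixes p0 p1 :: "'a::finite \<Rightarrow> nat" and lam :: "'a \<Rightarrow> real" and r :: nat
    and \<Phi> :: "real \<Rightarrow> real"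
  assumes "CARD('a) \<ge> 2"
    and "admissible p0 p1"
    and "\<forall>a. lam a > 0"
    and "roth_type p0 p1 lam"
    and "r \<ge> 1"
    and "BV_star p0 lam r \<Phi>"
  shows "\<exists>chi \<Psi>. Gamma_star p0 lam r chi \<and> C_Lip (total_length lam) r \<Psi> \<and>
           (\<forall>x\<in>{0..<total_length lam}. \<Phi> x = chi x + \<Psi> (iem p0 p1 lam x) - \<Psi> x)"
  using cohomological_equation[OF assms] by blast

end
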